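(* Let $\phi\colon X\to\mathbb R$ be acceptable and satisfy $P(\phi)<\infty$. Suppose there exists an induced system $(\Sigma,\tau|_\Sigma)$ for which the induced potentials $\Phi_\gamma$, $\gamma\in\mathbb R$, associated with $\phi$ are locally H\"older continuous, and there exists $\gamma_0\in\mathbb R$ such that $P(\Phi_{\gamma_0})=0$. Assume that the minimizer of the rate function $I_\phi$ (i.e. the element $\mu\in\mathcal M(X)$ with $I_\phi(\mu)=0$) is unique, denoted by $\mu_{\min}$. Then the following hold. (a) For all $\varphi,\psi\in C(X)$, $$\lim_{n\to\infty}\frac{1}{Z_n(\phi)}\sum_{x\in E_n}\exp(S_n\phi(x))\frac{1}{n^2}S_n\varphi(x)S_n\psi(x)=\int\varphi\,d\mu_{\min}\int\psi\,d\mu_{\min}.$$ (b) For all $\varphi,\psi\in C(X)$ with $\inf\psi>0$, $$\lim_{n\to\infty}\frac{1}{Z_n(\phi)}\sum_{x\in E_n}\exp(S_n\phi(x))\frac{S_n\varphi(x)}{S_n\psi(x)}=\frac{\int\varphi\,d\mu_{\min}}{\int\psi\,d\mu_{\min}}.$$ (c) For all $\pi_1,\pi_2\in C(X)$ and every bounded continuous function $f\colon\mathbb R\to\mathbb R$, $$\lim_{n\to\infty}\frac{1}{Z_n(\phi)}\sum_{x\in E_n}\exp(S_n\phi(x))\frac{1}{n^2}\sum_{k_1,k_2=0}^{n-1}f(\pi_1(\sigma^{k_1}x)+\pi_2(\sigma^{k_2}x))=\int f\,d(\mu_{\min}\circ\pi_1^{-1}\otimes\mu_{\min}\circ\pi_2^{-1}),$$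 where $\otimes$ denotes the convolution of Borel probability measures on $\mathbb R$.
   Context: Full shift. $\mathbb N=\{1,2,\dots\}$ is discrete and $X=\mathbb N^{\mathbb N}$ has the product topology, with metric $d_X(x,y)=\exp(-\inf\{n\ge1: x_n\ne y_n\})$ ($\exp(-\infty)=0$). $C(X)$ is the set of real-valued bounded continuous functions on $X$. For $p_1\cdots p_n\in\mathbb N^n$, $[p_1\cdots p_n]=\{x\in X: x_k=p_k,\ 1\le k\le n\}$. $\sigma\colon X\to X$ is the left shift. For $\phi\colon X\to\mathbb R$, $S_n\phi=\sum_{k=0}^{n-1}\phi\circ\sigma^k$. $\phi$ is acceptable if it is uniformly continuous and $\sup_{p\in\mathbb N}(\sup_{[p]}\phi-\inf_{[p]}\phi)<\infty$. $\phi$ is locally H\"older continuous if there are $C>0$, $\alpha\in(0,1]$ such that $|\phi(x)-\phi(y)|\le C d_X(x,y)^\alpha$ for all $p\in\mathbb N$ and $x,y\in[p]$. The pressure is $P(\phi)=\lim_{n\to\infty}\frac1n\log\sum_{p_1\cdots p_n\in\mathbb N^n}\sup_{[p_1\cdots p_n]}\exp S_n\phi$. The same definitions are used for the full shift over any countably infinite alphabet. Induced systems. Fix an integer $p^*\ge2$ and put $\mathbb N^*=\mathbb N\cap[p^*,\infty)$, $\mathbb N_*=\mathbb N\cap[1,p^* )$, $X^*=X\setminus\bigcup_{p\in\mathbb N_*}[p]$. Let $R\colon X^*\to\mathbb N\cup\{\infty\}$, $R(x)=\inf\{n\ge1:\sigma^nx\in X^*\}$; $\tau(x)=\sigma^{R(x)}x$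 on $\{R<\infty\}=\bigcup_{k\geq 1}\{R=k\}$; $\Sigma=\bigcap_{n=0}^\infty\tau^{-n}(\bigcup_{k=1}^\infty\{R=k\})$. The pair $(\Sigma,\tau|_\Sigma)$ is called an induced system (one for each choice of $p^*$). The induced potentials are $\Phi_\gamma\colon\Sigma\to\mathbb R$, $\Phi_\gamma(x)=S_{R(x)}\phi(x)-\gamma R(x)$, $\gamma\in\mathbb R$. Let $W_0(\mathbb N_* )$ be the set of finite words (including the empty one) over $\mathbb N_*$ and let $\mathbb A=\{\bigcup_{q\in\mathbb N^*}[p\omega q]: p\in\mathbb N^*,\ \omega\in W_0(\mathbb N_* )\}$, a countably infinite alphabet. Let $\mathbb A^{\mathbb N}$ be the full shift over $\mathbb A$ with left shift $\theta$. The map $\Pi\colon\mathbb A^{\mathbb N}\to\Sigma$ sending $(z_n)_n$, $z_n=\bigcup_{q\in\mathbb N^*}[p_n\omega^{(n)}q]$, to the infinite concatenation $p_1\omega^{(1)}p_2\omega^{(2)}\cdots$ is a homeomorphism with $\Pi\circ\theta=\tau|_\Sigma\circ\Pi$. $\Phi_\gamma$ is called locally H\"older continuous if $\Phi_\gamma\circ\Pi$ is so on the full shift $\mathbb A^{\mathbb N}$, and $P(\Phi_\gamma)$ is the pressure of $\Phi_\gamma\circ\Pi$ on $(\mathbb A^{\mathbb N},\theta)$. Measures and rate function. $\mathcal M(X)$ is the space of Borel probability measures on $X$ with the weak* topology (tested against bounded continuous functions). $E_n=\{x\in X:\sigma^nx=x\}$; $Z_n(\phi)=\sum_{x\in E_n}\exp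 S_n\phi(x)$. $\mathcal M(X,\sigma)$ is the set of $\sigma$-invariant elements of $\mathcal M(X)$, $\mathcal M_\phi(X,\sigma)=\{\mu\in\mathcal M(X,\sigma):\int\phi\,d\mu>-\infty\}$, and $h(\mu)$ is the measure-theoretic entropy of $\mu$ with respect to $\sigma$. Put $F_\phi(\mu)=h(\mu)+\int\phi\,d\mu-P(\phi)$ if $\mu\in\mathcal M_\phi(X,\sigma)$ and $F_\phi(\mu)=-\infty$ otherwise, and $I_\phi(\mu)=-\inf_{\mathcal G\ni\mu}\sup_{\mathcal G}F_\phi$, the infimum being over all open $\mathcal G\subset\mathcal M(X)$ containing $\mu$. *)

theory Defs
  imports "HOL-Probability.Probability"
begin

section \<open>Full shifts\<close>

text \<open>Coordinates are numbered from 0, so \<open>x k\<close> is the coordinate with index \<open>k + 1\<close> of a sequence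
  over \<open>\<nat> = {1, 2, \<dots>}\<close>. The alphabet is an arbitrary set, since induced systems are coded
  by a full shift whose alphabet consists of subsets of \<open>XN\<close>. Potentials are total functions; only
  their values on the full shift matter.\<close>

definition full_shift :: "'a set \<Rightarrow> (nat \<Rightarrow> 'a) set" where
  "full_shift A = {x. \<forall>k. x k \<in> A}"

definition shift_map :: "(nat \<Rightarrow> 'a) \<Rightarrow> nat \<Rightarrow> 'a" where
  "shift_map x = (\<lambda>k. x (Suc k))"

definition cyl :: "'a set \<Rightarrow> 'a list \<Rightarrow> (nat \<Rightarrow> 'a) set" where
  "cyl A w = {x \<in> full_shift A. \<forall>k<length w. x k = w ! k}"

text \<open>The summand 1 in the exponent accounts for the numbering of coordinates from 0.\<close>

definition shift_dist :: "(nat \<Rightarrow> 'a) \<Rightarrow> (nat \<Rightarrow> 'a) \<Rightarrow> real" where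
  "shift_dist x y = (if x = y then 0 else exp (- real ((LEAST k. x k \<noteq> y k) + 1)))"

lemma Metric_space_full_shift: "Metric_space (full_shift A) shift_dist"
proof
  fix x y z :: "nat \<Rightarrow> 'a"
  show "0 \<le> shift_dist x y" by (simp add: shift_dist_def)
  show "shift_dist x y = shift_dist y x" by (simp add: shift_dist_def eq_commute)
  show "shift_dist x y = 0 \<longleftrightarrow> x = y" by (simp add: shift_dist_def)
  show "shift_dist x z \<le> shift_dist x y + shift_dist y z"
  proof (cases "x = y \<or> y = z \<or> x = z")
    case True
    then show ?thesis by (auto simp: shift_dist_def)
  next
    case False
    define m where "m = (LEAST k. x k \<noteq> z k)"
    define a where "a = (LEAST k. x k \<noteq> y k)"
    define b where "b = (LEAST k. y k \<noteq> z k)"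
    have "\<exists>k. x k \<noteq> z k"
      using False by (simp add: fun_eq_iff)
    then have "x m \<noteq> z m"
      unfolding m_def by (rule LeastI_ex)
    then have "x m \<noteq> y m \<or> y m \<noteq> z m" by fastforce
    then have "a \<le> m \<or> b \<le> m"
      unfolding a_def b_def using Least_le[of "\<lambda>k. x k \<noteq> y k" m] Least_le[of "\<lambda>k. y k \<noteq> z k" m]
      by blast
    then have "exp (- real (m + 1)) \<le> exp (- real (a + 1)) \<or> exp (- real (m + 1)) \<le> exp (- real (b + 1))"
      by (simp only: exp_le_cancel_iff neg_le_iff_le of_nat_le_iff add_le_cancel_right)
    then have "exp (- real (m + 1)) \<le> exp (- real (a + 1)) + exp (- real (b + 1))"
      using exp_ge_zero[of "- real (a + 1)"] exp_ge_zero[of "- real (b + 1)"] by linarith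
    then show ?thesis using False by (simp add: shift_dist_def m_def a_def b_def)
  qed
qed

definition birkhoff :: "nat \<Rightarrow> ((nat \<Rightarrow> 'a) \<Rightarrow> real) \<Rightarrow> (nat \<Rightarrow> 'a) \<Rightarrow> real" where
  "birkhoff n \<phi> x = (\<Sum>k<n. \<phi> ((shift_map ^^ k) x))"

definition acceptable :: "'a set \<Rightarrow> ((nat \<Rightarrow> 'a) \<Rightarrow> real) \<Rightarrow> bool" where
  "acceptable A \<phi> \<longleftrightarrow>
     uniformly_continuous_map (metric (full_shift A, shift_dist)) euclidean_metric \<phi> \<and>
     (SUP p\<in>A. (SUP x\<in>cyl A [p]. ereal (\<phi> x)) - (INF x\<in>cyl A [p]. ereal (\<phi> x))) < \<infinity>"

definition locally_holder :: "'a set \<Rightarrow> ((nat \<Rightarrow> 'a) \<Rightarrow> real) \<Rightarrow> bool" where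
  "locally_holder A \<phi> \<longleftrightarrow>
     (\<exists>C>0. \<exists>\<alpha>\<in>{0<..1}. \<forall>p\<in>A. \<forall>x\<in>cyl A [p]. \<forall>y\<in>cyl A [p].
        \<bar>\<phi> x - \<phi> y\<bar> \<le> C * shift_dist x y powr \<alpha>)"

definition ln_ennreal :: "ennreal \<Rightarrow> ereal" where
  "ln_ennreal t = (if t = 0 then -\<infinity> else if t = \<infinity> then \<infinity> else ereal (ln (enn2real t)))"

definition words :: "'a set \<Rightarrow> nat \<Rightarrow> 'a list set" where
  "words A n = {w. length w = n \<and> set w \<subseteq> A}"

text \<open>The limit is taken in the extended reals. By submultiplicativity it exists for acceptable and
  for locally Hoelder continuous potentials.\<close>

definition pressure :: "'a set \<Rightarrow> ((nat \<Rightarrow> 'a) \<Rightarrow> real) \<Rightarrow> ereal" where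
  "pressure A \<phi> =
     lim (\<lambda>n. ln_ennreal (\<Sum>\<^sub>\<infinity>w\<in>words A n. SUP x\<in>cyl A w. ennreal (exp (birkhoff n \<phi> x)))
              / ereal (real n))"


section \<open>The full shift over the positive integers\<close>

definition XN :: "(nat \<Rightarrow> nat) set" where
  "XN = full_shift {1..}"

text \<open>Topology and Borel sets of \<open>XN\<close> are inherited from the product topology on \<^typ>\<open>nat \<Rightarrow> nat\<close>.\<close>

definition CX :: "((nat \<Rightarrow> nat) \<Rightarrow> real) set" where
  "CX = {f. continuous_on XN f \<and> bounded (f ` XN)}"

definition EN :: "nat \<Rightarrow> (nat \<Rightarrow> nat) set" where
  "EN n = {x \<in> XN. (shift_map ^^ n) x = x}"

definition ZN :: "nat \<Rightarrow> ((nat \<Rightarrow> nat) \<Rightarrow> real) \<Rightarrow> real" where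
  "ZN n \<phi> = (\<Sum>\<^sub>\<infinity>x\<in>EN n. exp (birkhoff n \<phi> x))"


section \<open>Induced systems\<close>

text \<open>The parameter \<open>P\<close> is the integer \<open>p\<^sup>*\<close> that determines the induced system.\<close>

definition Xstar :: "nat \<Rightarrow> (nat \<Rightarrow> nat) set" where
  "Xstar P = XN - (\<Union>p\<in>{1..<P}. cyl {1..} [p])"

definition return_time :: "nat \<Rightarrow> (nat \<Rightarrow> nat) \<Rightarrow> enat" where
  "return_time P x = Inf {enat n | n. n \<ge> 1 \<and> (shift_map ^^ n) x \<in> Xstar P}"

definition returns_at :: "nat \<Rightarrow> nat \<Rightarrow> (nat \<Rightarrow> nat) set" where
  "returns_at P k = {x \<in> Xstar P. return_time P x = enat k}"

text \<open>The map \<open>\<tau>\<close> is only defined on \<open>\<Union>k\<ge>1. returns_at P k\<close>. Its extension to all sequences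
  does not affect \<open>induced_space\<close>: a point belongs to it iff its orbit never leaves this domain.\<close>

definition induced_map :: "nat \<Rightarrow> (nat \<Rightarrow> nat) \<Rightarrow> nat \<Rightarrow> nat" where
  "induced_map P x = (shift_map ^^ the_enat (return_time P x)) x"

definition induced_space :: "nat \<Rightarrow> (nat \<Rightarrow> nat) set" where
  "induced_space P = (\<Inter>n. (induced_map P ^^ n) -` (\<Union>k\<in>{1..}. returns_at P k))"

definition induced_potential ::
    "nat \<Rightarrow> ((nat \<Rightarrow> nat) \<Rightarrow> real) \<Rightarrow> real \<Rightarrow> (nat \<Rightarrow> nat) \<Rightarrow> real" where
  "induced_potential P \<phi> \<gamma> x =
     (let R = the_enat (return_time P x) in birkhoff R \<phi> x - \<gamma> * real R)"

definition letter :: "nat \<Rightarrow> nat \<Rightarrow> nat list \<Rightarrow> (nat \<Rightarrow> nat) set" where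
  "letter P p \<omega> = (\<Union>q\<in>{P..}. cyl {1..} (p # \<omega> @ [q]))"

definition induced_alphabet :: "nat \<Rightarrow> (nat \<Rightarrow> nat) set set" where
  "induced_alphabet P = {letter P p \<omega> | p \<omega>. p \<in> {P..} \<and> \<omega> \<in> lists {1..<P}}"

definition letter_word :: "nat \<Rightarrow> (nat \<Rightarrow> nat) set \<Rightarrow> nat list" where
  "letter_word P z =
     (THE w. \<exists>p\<in>{P..}. \<exists>\<omega>\<in>lists {1..<P}. w = p # \<omega> \<and> z = letter P p \<omega>)"

text \<open>Infinite concatenation; meaningful when all words are nonempty, so that the first
  \<open>k + 1\<close> words have total length larger than \<open>k\<close>.\<close>

definition concat_words :: "(nat \<Rightarrow> 'a list) \<Rightarrow> nat \<Rightarrow> 'a" where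
  "concat_words w k = concat (map w [0..<Suc k]) ! k"

definition coding :: "nat \<Rightarrow> (nat \<Rightarrow> (nat \<Rightarrow> nat) set) \<Rightarrow> nat \<Rightarrow> nat" where
  "coding P z = concat_words (\<lambda>n. letter_word P (z n))"

lemma mem_letter:
  "x \<in> letter P p \<omega> \<longleftrightarrow>
     x \<in> full_shift {1..} \<and> x 0 = p \<and> (\<forall>k<length \<omega>. x (Suc k) = \<omega> ! k) \<and> x (Suc (length \<omega>)) \<ge> P"
proof -
  have "x \<in> cyl {1..} (p # \<omega> @ [q]) \<longleftrightarrow>
      x \<in> full_shift {1..} \<and> x 0 = p \<and> (\<forall>k<length \<omega>. x (Suc k) = \<omega> ! k) \<and> x (Suc (length \<omega>)) = q"
    for q
  proof -
    have "(\<forall>k<Suc (Suc (length \<omega>)). x k = (p # \<omega> @ [q]) ! k) \<longleftrightarrow>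
        x 0 = p \<and> (\<forall>k<Suc (length \<omega>). x (Suc k) = (\<omega> @ [q]) ! k)"
      by (subst All_less_Suc2) simp
    also have "\<dots> \<longleftrightarrow> x 0 = p \<and> x (Suc (length \<omega>)) = q \<and> (\<forall>k<length \<omega>. x (Suc k) = \<omega> ! k)"
      by (subst All_less_Suc) (simp add: nth_append)
    finally show ?thesis by (auto simp: cyl_def)
  qed
  then show ?thesis by (auto simp: letter_def)
qed

lemma letter_word_letter:
  assumes P: "P \<ge> 2" and p: "p \<in> {P..}" and \<omega>: "\<omega> \<in> lists {1..<P}"
  shows "letter_word P (letter P p \<omega>) = p # \<omega>"
proof -
  define x where "x k = (if k = 0 then p else if k \<le> length \<omega> then \<omega> ! (k - 1) else P)" for k
  have low: "v ! k \<in> {1..<P}" if "v \<in> lists {1..<P}" "k < length v" for v k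
    using that by (metis in_listsD nth_mem)
  have "1 \<le> x k" for k
    using P p low[OF \<omega>, of "k - 1"] by (auto simp: x_def)
  then have x: "x \<in> letter P p \<omega>"
    by (simp add: mem_letter full_shift_def) (simp add: x_def)
  have uniq: "p' # \<omega>' = p # \<omega>"
    if \<omega>': "\<omega>' \<in> lists {1..<P}" and eq: "letter P p \<omega> = letter P p' \<omega>'" for p' \<omega>'
  proof -
    have x': "x \<in> letter P p' \<omega>'" using x eq by simp
    have "\<not> length \<omega> < length \<omega>'"
      using x x' low[OF \<omega>', of "length \<omega>"] unfolding mem_letter by fastforce
    moreover have "\<not> length \<omega>' < length \<omega>"
      using x x' low[OF \<omega>, of "length \<omega>'"] unfolding mem_letter by fastforce
    ultimately have len: "length \<omega>' = length \<omega>" by simp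
    have "\<omega>' = \<omega>"
      by (rule nth_equalityI[OF len]) (use x x' len in \<open>simp add: mem_letter\<close>)
    then show ?thesis using x x' by (simp add: mem_letter)
  qed
  show ?thesis
    unfolding letter_word_def
  proof (rule the_equality)
    show "\<exists>p'\<in>{P..}. \<exists>\<omega>'\<in>lists {1..<P}. p # \<omega> = p' # \<omega>' \<and> letter P p \<omega> = letter P p' \<omega>'"
      using p \<omega> by blast
  qed (use uniq in fast)
qed


section \<open>Invariant measures, entropy and the rate function\<close>

definition MX :: "(nat \<Rightarrow> nat) measure set" where
  "MX = {\<mu>. prob_space \<mu> \<and> sets \<mu> = sets (restrict_space borel XN)}"

definition weak_star :: "(nat \<Rightarrow> nat) measure topology" where
  "weak_star = topology_generated_by
     {{\<mu> \<in> MX. (LINT x|\<mu>. f x) \<in> U} | f U. f \<in> CX \<and> open U}"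

lemma topspace_weak_star: "topspace weak_star = MX"
proof -
  have "{\<mu> \<in> MX. (LINT x|\<mu>. (\<lambda>_. 0) x) \<in> (UNIV :: real set)}
      \<in> {{\<mu> \<in> MX. (LINT x|\<mu>. f x) \<in> U} | f U. f \<in> CX \<and> open U}"
    by (intro CollectI exI[of _ "\<lambda>_. 0"] exI[of _ UNIV])
       (auto simp: CX_def bounded_iff intro!: exI[of _ 0])
  then show ?thesis
    unfolding weak_star_def topology_generated_by_topspace by auto
qed

definition MX_inv :: "(nat \<Rightarrow> nat) measure set" where
  "MX_inv = {\<mu> \<in> MX. distr \<mu> \<mu> shift_map = \<mu>}"

text \<open>The integral as an extended real number, for functions whose positive part or negative part
  has finite integral.\<close>

definition ext_integral :: "'a measure \<Rightarrow> ('a \<Rightarrow> real) \<Rightarrow> ereal" where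
  "ext_integral \<mu> f =
     enn2ereal (\<integral>\<^sup>+x. ennreal (f x) \<partial>\<mu>) - enn2ereal (\<integral>\<^sup>+x. ennreal (- f x) \<partial>\<mu>)"

definition MX_phi :: "((nat \<Rightarrow> nat) \<Rightarrow> real) \<Rightarrow> (nat \<Rightarrow> nat) measure set" where
  "MX_phi \<phi> = {\<mu> \<in> MX_inv. ext_integral \<mu> \<phi> > -\<infinity>}"

text \<open>Kolmogorov--Sinai entropy of a map \<open>T\<close> with respect to an invariant probability measure.\<close>

definition finite_partitions :: "'a measure \<Rightarrow> 'a set set set" where
  "finite_partitions \<mu> = {\<xi>. finite \<xi> \<and> \<xi> \<subseteq> sets \<mu> \<and> partition_on (space \<mu>) \<xi>}"

definition partition_entropy :: "'a measure \<Rightarrow> 'a set set \<Rightarrow> real" where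
  "partition_entropy \<mu> \<xi> = - (\<Sum>A\<in>\<xi>. measure \<mu> A * ln (measure \<mu> A))"

text \<open>The join \<open>\<xi> \<or> T\<^sup>-\<^sup>1 \<xi> \<or> \<dots> \<or> T\<^sup>-\<^sup>(\<^sup>n\<^sup>-\<^sup>1\<^sup>) \<xi>\<close>.\<close>

definition iterated_join :: "'a measure \<Rightarrow> ('a \<Rightarrow> 'a) \<Rightarrow> 'a set set \<Rightarrow> nat \<Rightarrow> 'a set set" where
  "iterated_join \<mu> T \<xi> n =
     {{x \<in> space \<mu>. \<forall>k<n. (T ^^ k) x \<in> c k} | c. c \<in> {..<n} \<rightarrow> \<xi>} - {{}}"

definition ks_entropy :: "'a measure \<Rightarrow> ('a \<Rightarrow> 'a) \<Rightarrow> ereal" where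
  "ks_entropy \<mu> T =
     (SUP \<xi>\<in>finite_partitions \<mu>.
        ereal (lim (\<lambda>n. partition_entropy \<mu> (iterated_join \<mu> T \<xi> n) / real n)))"

definition free_energy :: "((nat \<Rightarrow> nat) \<Rightarrow> real) \<Rightarrow> (nat \<Rightarrow> nat) measure \<Rightarrow> ereal" where
  "free_energy \<phi> \<mu> =
     (if \<mu> \<in> MX_phi \<phi> then ks_entropy \<mu> shift_map + ext_integral \<mu> \<phi> - pressure {1..} \<phi>
      else -\<infinity>)"

definition rate_function :: "((nat \<Rightarrow> nat) \<Rightarrow> real) \<Rightarrow> (nat \<Rightarrow> nat) measure \<Rightarrow> ereal" where
  "rate_function \<phi> \<mu> =
     - (INF G\<in>{G. openin weak_star G \<and> \<mu> \<in> G}. SUP \<nu>\<in>G. free_energy \<phi> \<nu>)"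

end

theory Submission
  imports Defs
begin

text \<open>
  Give a point \<open>x\<close> of \<open>EN n\<close> the probability \<open>exp (birkhoff n \<phi> x) / ZN n \<phi>\<close> (\<open>per_pmf\<close>). The three
  limits hold because, for these probabilities, the average \<open>birkhoff n f x / n\<close> of every \<open>f \<in> CX\<close>
  converges in probability to \<open>\<integral>f d\<mu>min\<close> (\<open>conv_prob_birkhoff\<close>). The quantity in (a) is a product and
  that in (b) a quotient of two such averages. In (c), \<open>f\<close> may be replaced by a polynomial on the
  bounded range of its argument, and for a polynomial the double sum is a combination of products of
  averages of powers of \<open>\<pi>1\<close> and \<open>\<pi>2\<close>.

  The convergence in probability is a large deviation upper bound (\<open>deviation_limit\<close>). Let \<open>f\<close> depend
  on finitely many coordinates and suppose that, for infinitely many \<open>n\<close>, averages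
  \<open>birkhoff n f x / n \<ge> c\<close> have probability at least \<open>\<delta>\<close>. A finite set \<open>S\<close> of such periodic points
  then carries a fixed fraction of \<open>ZN n \<phi>\<close>, which grows like \<open>exp (n P(\<phi>))\<close>. Concatenate the period
  words of points of \<open>S\<close> independently, with probabilities proportional to \<open>exp (birkhoff n \<phi>)\<close>, and
  average over the phase: this gives a shift invariant measure \<open>\<nu>\<^sub>n\<close> whose entropy plus integral of \<open>\<phi>\<close>
  is at least the logarithm of the weight of \<open>S\<close>, divided by \<open>n\<close>, up to a vanishing distortion
  (\<open>large_block_measure\<close>). Hence the lower limit of the free energies of the \<open>\<nu>\<^sub>n\<close> is at least 0,
  while \<open>\<integral>f d\<nu>\<^sub>n\<close> stays above \<open>c\<close> up to a vanishing error.

  The alphabet is infinite, so a limit of the \<open>\<nu>\<^sub>n\<close> has to be secured. Points in which large symbols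
  are too frequent have vanishing probability (\<open>tight_periodic\<close>); they are left out of \<open>S\<close>, which makes
  the \<open>\<nu>\<^sub>n\<close> tight, and a subsequence converges to some \<open>\<nu>\<close> on all cylinders
  (\<open>tight_cylinder_subsequence\<close>), hence in the weak* topology (\<open>cylinder_neighbourhood\<close>). Every open set
  around \<open>\<nu>\<close> contains measures of free energy close to 0, and free energies are never positive
  (\<open>free_energy_le_0\<close>, one half of the variational principle). So the rate function vanishes at \<open>\<nu>\<close>,
  that is, \<open>\<nu> = \<mu>min\<close> and \<open>c \<le> \<integral>f d\<mu>min\<close>.
\<close>

section \<open>The full shift and its potentials\<close>

declare One_nat_def [simp del]

lemma shift_pow: "(shift_map ^^ k) x = (\<lambda>i. x (i + k))"
  by (induction k) (auto simp: shift_map_def)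

lemma XN_iff: "x \<in> XN \<longleftrightarrow> (\<forall>k. 1 \<le> x k)"
  by (simp add: XN_def full_shift_def)

lemma shift_pow_XN: "x \<in> XN \<Longrightarrow> (shift_map ^^ k) x \<in> XN"
  by (simp add: shift_pow XN_iff)

definition agree :: "nat \<Rightarrow> (nat \<Rightarrow> nat) \<Rightarrow> (nat \<Rightarrow> nat) \<Rightarrow> bool" where
  "agree n x y \<longleftrightarrow> (\<forall>k<n. x k = y k)"

lemma agree_mono: "agree n x y \<Longrightarrow> m \<le> n \<Longrightarrow> agree m x y"
  by (simp add: agree_def)

lemma agree_shift: "agree (m + k) x y \<Longrightarrow> agree m ((shift_map ^^ k) x) ((shift_map ^^ k) y)"
  by (simp add: agree_def shift_pow)

lemma birkhoff_add: "birkhoff (m + n) f x = birkhoff m f x + birkhoff n f ((shift_map ^^ m) x)"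
proof -
  have "birkhoff (m + n) f x = (\<Sum>k<m. f ((shift_map ^^ k) x)) + (\<Sum>k=m..<m+n. f ((shift_map ^^ k) x))"
    unfolding birkhoff_def
    by (metis atLeast0LessThan le_add1 sum.atLeastLessThan_concat zero_le)
  also have "(\<Sum>k=m..<m+n. f ((shift_map ^^ k) x)) = (\<Sum>k<n. f ((shift_map ^^ (k + m)) x))"
    using sum.shift_bounds_nat_ivl[of "\<lambda>k. f ((shift_map ^^ k) x)" 0 m n]
    by (simp add: atLeast0LessThan add.commute)
  finally show ?thesis
    by (simp add: birkhoff_def shift_pow add.commute add.left_commute)
qed

text \<open>Acceptability in terms of coordinates instead of the metric.\<close>

definition tame :: "((nat \<Rightarrow> nat) \<Rightarrow> real) \<Rightarrow> bool" where
  "tame \<phi> \<longleftrightarrow>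
     (\<forall>\<epsilon>>0. \<exists>N. \<forall>x\<in>XN. \<forall>y\<in>XN. agree N x y \<longrightarrow> \<bar>\<phi> x - \<phi> y\<bar> \<le> \<epsilon>) \<and>
     (\<exists>c. \<forall>x\<in>XN. \<forall>y\<in>XN. x 0 = y 0 \<longrightarrow> \<bar>\<phi> x - \<phi> y\<bar> \<le> c)"

lemma shift_dist_agree: "agree n x y \<Longrightarrow> shift_dist x y \<le> exp (- real n)"
proof (cases "x = y")
  case False
  assume ag: "agree n x y"
  from False have "\<exists>k. x k \<noteq> y k" by auto
  then have "x (LEAST k. x k \<noteq> y k) \<noteq> y (LEAST k. x k \<noteq> y k)" by (rule LeastI_ex)
  with ag have "n \<le> (LEAST k. x k \<noteq> y k)" unfolding agree_def by (meson not_le)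
  then show ?thesis using False by (simp add: shift_dist_def)
qed (simp add: shift_dist_def)

lemma acceptable_tame:
  assumes "acceptable {1..} \<phi>"
  shows "tame \<phi>"
proof -
  interpret M: Metric_space "full_shift {1::nat..}" shift_dist by (rule Metric_space_full_shift)
  have uc: "uniformly_continuous_map (metric (XN, shift_dist)) euclidean_metric \<phi>"
    and osc: "(SUP p\<in>{1..}. (SUP x\<in>cyl {1..} [p]. ereal (\<phi> x)) - (INF x\<in>cyl {1..} [p]. ereal (\<phi> x))) < \<infinity>"
    using assms by (auto simp: acceptable_def XN_def)
  have "\<exists>N. \<forall>x\<in>XN. \<forall>y\<in>XN. agree N x y \<longrightarrow> \<bar>\<phi> x - \<phi> y\<bar> \<le> \<epsilon>" if eps: "\<epsilon> > 0" for \<epsilon>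
  proof -
    obtain \<delta> where \<delta>: "\<delta> > 0" "\<And>x y. x \<in> XN \<Longrightarrow> y \<in> XN \<Longrightarrow> shift_dist y x < \<delta> \<Longrightarrow> dist (\<phi> y) (\<phi> x) < \<epsilon>"
    proof -
      have "\<exists>\<delta>>0. \<forall>x\<in>XN. \<forall>y\<in>XN. shift_dist y x < \<delta> \<longrightarrow> dist (\<phi> y) (\<phi> x) < \<epsilon>"
        using uc eps unfolding uniformly_continuous_map_def XN_def
        by (simp add: M.mspace_metric M.mdist_metric del: One_nat_def)
      then show thesis using that by blast
    qed
    obtain N where N: "- ln \<delta> < real N" using reals_Archimedean2 by blast
    then have "exp (- real N) < \<delta>" using \<delta>(1) by (metis exp_less_mono exp_ln minus_less_iff)
    then have "\<bar>\<phi> x - \<phi> y\<bar> \<le> \<epsilon>" if "x \<in> XN" "y \<in> XN" "agree N x y" for x y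
      using \<delta>(2)[of y x] shift_dist_agree[of N x y] that by (simp add: dist_real_def)
    then show ?thesis by blast
  qed
  moreover have "\<exists>c. \<forall>x\<in>XN. \<forall>y\<in>XN. x 0 = y 0 \<longrightarrow> \<bar>\<phi> x - \<phi> y\<bar> \<le> c"
  proof -
    define V where "V = (SUP p\<in>{1..}. (SUP x\<in>cyl {1..} [p]. ereal (\<phi> x)) - (INF x\<in>cyl {1..} [p]. ereal (\<phi> x)))"
    have "V < \<infinity>" using osc by (simp only: V_def)
    then obtain c where c: "V \<le> ereal c"
      by (cases V) (auto intro: order_refl)
    have "\<phi> x - \<phi> y \<le> c" if xy: "x \<in> XN" "y \<in> XN" "x 0 = y 0" for x y
    proof -
      have m: "x \<in> cyl {1..} [x 0]" "y \<in> cyl {1..} [x 0]" using xy by (auto simp: cyl_def XN_def)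
      have "ereal (\<phi> x) - ereal (\<phi> y) \<le>
          (SUP z\<in>cyl {1..} [x 0]. ereal (\<phi> z)) - (INF z\<in>cyl {1..} [x 0]. ereal (\<phi> z))"
        by (intro ereal_minus_mono SUP_upper INF_lower m)
      also have "\<dots> \<le> V"
        unfolding V_def using xy(1) by (intro SUP_upper2[of "x 0"]) (auto simp: XN_iff)
      also note c
      finally show ?thesis by simp
    qed
    then show ?thesis
      by (intro exI[of _ c]) (auto simp: abs_le_iff)
  qed
  ultimately show ?thesis by (simp add: tame_def)
qed

text \<open>The terms of the two Birkhoff sums have at least \<open>N\<close> common coordinates, except for the last \<open>N\<close>
  ones, where only the oscillation on cylinders of length 1 is available. So nearby orbits have the same
  weight up to a factor that is subexponential in \<open>n\<close>.\<close>

lemma distortion: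
  assumes "tame \<phi>" and "\<epsilon> > 0"
  obtains C where "C \<ge> 0" and "\<And>n x y. x \<in> XN \<Longrightarrow> y \<in> XN \<Longrightarrow> agree n x y \<Longrightarrow>
     \<bar>birkhoff n \<phi> x - birkhoff n \<phi> y\<bar> \<le> real n * \<epsilon> + C"
proof -
  obtain N where N: "\<And>x y. x \<in> XN \<Longrightarrow> y \<in> XN \<Longrightarrow> agree N x y \<Longrightarrow> \<bar>\<phi> x - \<phi> y\<bar> \<le> \<epsilon>"
    using assms unfolding tame_def by metis
  obtain c0 where c0: "\<And>x y. x \<in> XN \<Longrightarrow> y \<in> XN \<Longrightarrow> x 0 = y 0 \<Longrightarrow> \<bar>\<phi> x - \<phi> y\<bar> \<le> c0"
    using assms unfolding tame_def by metis
  define c where "c = max c0 0"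
  have c: "c \<ge> 0" and c1: "\<And>x y. x \<in> XN \<Longrightarrow> y \<in> XN \<Longrightarrow> x 0 = y 0 \<Longrightarrow> \<bar>\<phi> x - \<phi> y\<bar> \<le> c"
    using c0 by (auto simp: c_def le_max_iff_disj)
  show thesis
  proof (rule that[of "N * c"])
    fix n x y assume xy: "x \<in> XN" "y \<in> XN" "agree n x y"
    let ?S = "\<lambda>k. (shift_map ^^ k)"
    have tm: "\<bar>\<phi> (?S k x) - \<phi> (?S k y)\<bar> \<le> \<epsilon> + (if n < k + N then c else 0)" if "k < n" for k
    proof (cases "n < k + N")
      case True
      have "?S k x 0 = ?S k y 0" using xy(3) that by (simp add: shift_pow agree_def)
      then show ?thesis using c1[OF shift_pow_XN[OF xy(1)] shift_pow_XN[OF xy(2)]] True assms(2)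
        by (smt (verit))
    next
      case False
      have "agree N (?S k x) (?S k y)"
        by (rule agree_shift) (use xy(3) False in \<open>auto intro: agree_mono\<close>)
      then show ?thesis using N[OF shift_pow_XN[OF xy(1)] shift_pow_XN[OF xy(2)]] False by simp
    qed
    have "\<bar>birkhoff n \<phi> x - birkhoff n \<phi> y\<bar> \<le> (\<Sum>k<n. \<bar>\<phi> (?S k x) - \<phi> (?S k y)\<bar>)"
      unfolding birkhoff_def sum_subtractf[symmetric] by (rule sum_abs)
    also have "\<dots> \<le> (\<Sum>k<n. \<epsilon> + (if n < k + N then c else 0))"
      by (rule sum_mono) (use tm in auto)
    also have "\<dots> = n * \<epsilon> + real (card {k. k < n \<and> n < k + N}) * c"
      by (simp add: sum.distrib sum.If_cases Int_def)
    also have "real (card {k. k < n \<and> n < k + N}) * c \<le> N * c"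
    proof (intro mult_right_mono c)
      have "{k. k < n \<and> n < k + N} \<subseteq> {n-N..<n}" by auto
      then have "card {k. k < n \<and> n < k + N} \<le> card {n-N..<n}" by (intro card_mono) auto
      then show "real (card {k. k < n \<and> n < k + N}) \<le> N" by simp
    qed
    finally show "\<bar>birkhoff n \<phi> x - birkhoff n \<phi> y\<bar> \<le> real n * \<epsilon> + N * c" by simp
  qed (use c in simp)
qed

text \<open>The Borel space that carries the measures in \<open>MX\<close>.\<close>

definition BX :: "(nat \<Rightarrow> nat) measure" where
  "BX = restrict_space borel XN"

lemma coord_measurable_borel: "(\<lambda>x. x k) \<in> borel \<rightarrow>\<^sub>M count_space (UNIV :: nat set)" for k :: nat
proof -
  have "continuous_on UNIV (\<lambda>x::nat\<Rightarrow>nat. x k)" by (rule continuous_on_product_coordinates)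
  then have "(\<lambda>x::nat\<Rightarrow>nat. x k) \<in> borel \<rightarrow>\<^sub>M borel"
    by (rule borel_measurable_continuous_onI)
  then show ?thesis
    using measurable_cong_sets[OF refl sets_borel_eq_count_space] by blast
qed

lemma coord_measurable[measurable]: "(\<lambda>x. x k) \<in> BX \<rightarrow>\<^sub>M count_space (UNIV :: nat set)" for k :: nat
  unfolding BX_def by (intro measurable_restrict_space1 coord_measurable_borel)

lemma space_BX[simp]: "space BX = XN"
  by (simp add: BX_def space_restrict_space)

lemma measurable_into_BX:
  assumes "\<And>k. (\<lambda>z. f z k) \<in> M \<rightarrow>\<^sub>M count_space (UNIV :: nat set)" and "\<And>z. z \<in> space M \<Longrightarrow> f z \<in> XN"
  shows "f \<in> M \<rightarrow>\<^sub>M BX"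
  unfolding BX_def
proof (rule measurable_restrict_space2)
  have "\<And>k. (\<lambda>z. f z k) \<in> M \<rightarrow>\<^sub>M borel"
    using assms(1) measurable_cong_sets[OF refl sets_borel_eq_count_space] by blast
  then show "f \<in> M \<rightarrow>\<^sub>M borel" by (rule measurable_coordinatewise_then_product)
qed (use assms(2) in auto)

lemma shift_measurable[measurable]: "(shift_map ^^ k) \<in> BX \<rightarrow>\<^sub>M BX"
  by (rule measurable_into_BX) (auto simp: shift_pow XN_iff)

lemma shift_measurable1[measurable]: "shift_map \<in> BX \<rightarrow>\<^sub>M BX"
  using shift_measurable[of 1] by (simp add: One_nat_def)



lemma open_agree: "open {y. agree n x y}"
proof -
  have "{y. agree n x y} = (\<Inter>k\<in>{..<n}. (\<lambda>y. y k) -` {x k})" by (auto simp: agree_def)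
  also have "open \<dots>"
    by (intro open_INT finite_lessThan ballI open_vimage continuous_on_product_coordinates)
       (simp_all add: discrete_topology_class.open_discrete)
  finally show ?thesis .
qed

lemma continuous_onI_agree:
  assumes "\<And>x \<epsilon>. x \<in> XN \<Longrightarrow> \<epsilon> > 0 \<Longrightarrow> \<exists>N. \<forall>y\<in>XN. agree N x y \<longrightarrow> \<bar>f x - f y\<bar> \<le> (\<epsilon>::real)"
  shows "continuous_on XN f"
  unfolding continuous_on_topological
proof (intro ballI allI impI)
  fix x B assume x: "x \<in> XN" "open (B :: real set)" "f x \<in> B"
  then obtain e where e: "e > 0" "\<And>t. dist t (f x) < e \<Longrightarrow> t \<in> B" by (auto simp: open_dist)
  obtain N where N: "\<forall>y\<in>XN. agree N x y \<longrightarrow> \<bar>f x - f y\<bar> \<le> e / 2"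
    using assms[of x "e/2"] x e by auto
  have "f y \<in> B" if "y \<in> XN" "agree N x y" for y
  proof (rule e(2))
    have "\<bar>f x - f y\<bar> \<le> e / 2" using N that by blast
    then show "dist (f y) (f x) < e" using e(1) by (simp add: dist_real_def abs_minus_commute)
  qed
  moreover have "agree N x x" by (simp add: agree_def)
  ultimately show "\<exists>A. open A \<and> x \<in> A \<and> (\<forall>y\<in>XN. y \<in> A \<longrightarrow> f y \<in> B)"
    by (intro exI[of _ "{y. agree N x y}"]) (simp add: open_agree)
qed

lemma agree_nhds_base:
  assumes "open U" "x \<in> U"
  shows "\<exists>N. \<forall>y. agree N x y \<longrightarrow> y \<in> U"
proof -
  obtain X where X: "x \<in> Pi\<^sub>E UNIV X" "\<And>i. open (X i)" "finite {i. X i \<noteq> UNIV}" "Pi\<^sub>E UNIV X \<subseteq> U"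
    using product_topology_open_contains_basis[of "\<lambda>_. euclidean" UNIV U x] assms
    by (auto simp: open_fun_def)
  obtain N where N: "\<And>i. X i \<noteq> UNIV \<Longrightarrow> i < N"
    using X(3) finite_nat_iff_bounded by (auto simp: subset_eq)
  have "y \<in> U" if "agree N x y" for y
  proof -
    have "y i \<in> X i" for i
    proof (cases "X i = UNIV")
      case False
      then have "x i = y i" using N[of i] that by (simp add: agree_def)
      moreover have "x i \<in> X i" using X(1) by (rule PiE_mem) simp
      ultimately show ?thesis by simp
    qed simp
    then show ?thesis using X(4) by auto
  qed
  then show ?thesis by blast
qed

lemma continuous_on_agreeD:
  assumes "continuous_on XN f" "x \<in> XN" "\<epsilon> > 0"
  shows "\<exists>N. \<forall>y\<in>XN. agree N x y \<longrightarrow> \<bar>f x - f y\<bar> < (\<epsilon>::real)"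
proof -
  have "open (ball (f x) \<epsilon>)" "f x \<in> ball (f x) \<epsilon>" using assms by auto
  then obtain A where A: "open A" "x \<in> A" "\<And>y. y \<in> XN \<Longrightarrow> y \<in> A \<Longrightarrow> f y \<in> ball (f x) \<epsilon>"
    using assms(1,2) unfolding continuous_on_topological by metis
  obtain N where "\<forall>y. agree N x y \<longrightarrow> y \<in> A" using agree_nhds_base[OF A(1,2)] by blast
  then show ?thesis using A(3) by (intro exI[of _ N]) (auto simp: dist_real_def)
qed

lemma measurable_continuous_XN: "continuous_on XN f \<Longrightarrow> f \<in> BX \<rightarrow>\<^sub>M (borel :: real measure)"
  unfolding BX_def by (rule borel_measurable_continuous_on_restrict)

lemma tame_measurable: "tame \<phi> \<Longrightarrow> \<phi> \<in> BX \<rightarrow>\<^sub>M borel"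
proof (rule measurable_continuous_XN, rule continuous_onI_agree)
  fix x and \<epsilon> :: real assume "tame \<phi>" and x: "x \<in> XN" and "\<epsilon> > 0"
  then obtain N where "\<forall>x\<in>XN. \<forall>y\<in>XN. agree N x y \<longrightarrow> \<bar>\<phi> x - \<phi> y\<bar> \<le> \<epsilon>"
    unfolding tame_def by metis
  with x show "\<exists>N. \<forall>y\<in>XN. agree N x y \<longrightarrow> \<bar>\<phi> x - \<phi> y\<bar> \<le> \<epsilon>" by blast
qed

section \<open>Pressure as the growth rate of cylinder sums\<close>

lemma fekete:
  fixes a :: "nat \<Rightarrow> real"
  assumes sub: "\<And>m n. a (m + n) \<le> a m + a n" and low: "\<And>n. real n * b \<le> a n"
  obtains L where "(\<lambda>n. a n / real n) \<longlonglongrightarrow> L" and "\<And>n. n > 0 \<Longrightarrow> L \<le> a n / real n"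
proof -
  define L where "L = (INF n\<in>{1..}. a n / real n)"
  have bdd: "bdd_below ((\<lambda>n. a n / real n) ` {1..})"
    using low by (intro bdd_belowI2[of _ b]) (auto simp: field_simps)
  have L: "L \<le> a n / real n" if "n > 0" for n
    unfolding L_def using that by (intro cINF_lower bdd) auto
  have mult: "a (q * m + r) \<le> real q * a m + a r" for q m r
  proof (induction q)
    case (Suc q)
    have "a (Suc q * m + r) \<le> a m + a (q * m + r)" using sub[of m "q * m + r"] by (simp add: add.assoc)
    with Suc show ?case by (simp add: algebra_simps)
  qed simp
  have "(\<lambda>n. a n / real n) \<longlonglongrightarrow> L"
  proof (rule LIMSEQ_I)
    fix e :: real assume e: "e > 0"
    obtain m where m: "m \<ge> 1" "a m / real m < L + e / 2"
      using cINF_less_iff[OF _ bdd, of "L + e / 2"] e unfolding L_def by auto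
    define B where "B = (\<Sum>r<m. \<bar>a r\<bar>) + \<bar>a m\<bar>"
    have B0: "B \<ge> 0" by (simp add: B_def sum_nonneg)
    have up: "a n / real n \<le> a m / real m + B / real n" if n: "n > 0" for n
    proof -
      let ?r = "n mod m"
      have r: "?r < m" using m by simp
      have nn: "real n = real (n div m) * real m + real ?r"
        by (metis mult_div_mod_eq of_nat_add of_nat_mult mult.commute)
      have "a n \<le> real (n div m) * a m + a ?r" using mult[of "n div m" m ?r] by simp
      also have "real (n div m) * a m = real n * (a m / real m) - real ?r / real m * a m"
        using m(1) unfolding nn by (simp add: field_simps)
      finally have 1: "a n \<le> real n * (a m / real m) - real ?r / real m * a m + a ?r" .
      have 2: "- (real ?r / real m * a m) \<le> \<bar>a m\<bar>"
      proof -
        have "- (real ?r / real m * a m) \<le> \<bar>real ?r / real m\<bar> * \<bar>a m\<bar>"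
          by (metis abs_ge_minus_self abs_mult)
        also have "\<dots> \<le> 1 * \<bar>a m\<bar>" using r by (intro mult_right_mono) auto
        finally show ?thesis by simp
      qed
      have 3: "a ?r \<le> (\<Sum>r<m. \<bar>a r\<bar>)"
        using member_le_sum[of ?r "{..<m}" "\<lambda>r. \<bar>a r\<bar>"] r by force
      have "a n \<le> real n * (a m / real m) + B" using 1 2 3 by (simp add: B_def)
      then show ?thesis using n by (simp add: field_simps)
    qed
    obtain n0 where n0: "real n0 > 2 * B / e" using reals_Archimedean2 by blast
    show "\<exists>no. \<forall>n\<ge>no. norm (a n / real n - L) < e"
    proof (intro exI[of _ "Suc n0"] allI impI)
      fix n assume n: "Suc n0 \<le> n"
      have "2 * B / e < real n" using n n0 by linarith
      then have "B / real n < e / 2" using e n by (simp add: field_simps)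
      then show "norm (a n / real n - L) < e" using up[of n] L[of n] m(2) n by (simp only: real_norm_def) linarith
    qed
  qed
  then show thesis using L by (rule that)
qed

definition cyl_weight :: "((nat \<Rightarrow> nat) \<Rightarrow> real) \<Rightarrow> nat list \<Rightarrow> ennreal" where
  "cyl_weight \<phi> w = (SUP x\<in>cyl {1..} w. ennreal (exp (birkhoff (length w) \<phi> x)))"

definition cyl_sum :: "((nat \<Rightarrow> nat) \<Rightarrow> real) \<Rightarrow> nat \<Rightarrow> ennreal" where
  "cyl_sum \<phi> n = (\<Sum>\<^sub>\<infinity>w\<in>words {1..} n. cyl_weight \<phi> w)"

lemma pressure_cyl_sum: "pressure {1..} \<phi> = lim (\<lambda>n. ln_ennreal (cyl_sum \<phi> n) / ereal (real n))"
  unfolding pressure_def cyl_sum_def cyl_weight_def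
  by (intro arg_cong[where f = lim] ext arg_cong2[where f = "(/)"] arg_cong[where f = ln_ennreal] infsum_cong refl)
     (simp add: words_def)

lemma cyl_sum_SUP: "cyl_sum \<phi> n = (SUP F\<in>{F. finite F \<and> F \<subseteq> words {1..} n}. sum (cyl_weight \<phi>) F)"
  unfolding cyl_sum_def by (rule nonneg_infsum_complete) simp

lemma sum_le_cyl_sum: "finite F \<Longrightarrow> F \<subseteq> words {1..} n \<Longrightarrow> sum (cyl_weight \<phi>) F \<le> cyl_sum \<phi> n"
  unfolding cyl_sum_SUP by (rule SUP_upper) auto

lemma cyl_sum_le: "(\<And>F. finite F \<Longrightarrow> F \<subseteq> words {1..} n \<Longrightarrow> sum (cyl_weight \<phi>) F \<le> c) \<Longrightarrow> cyl_sum \<phi> n \<le> c"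
  unfolding cyl_sum_SUP by (rule SUP_least) auto

lemma cyl_iff: "x \<in> cyl {1..} w \<longleftrightarrow> x \<in> XN \<and> (\<forall>k<length w. x k = w ! k)"
  by (simp add: cyl_def XN_def)

lemma cyl_append:
  fixes u v :: "nat list"
  assumes "x \<in> cyl {1..} (u @ v)"
  shows "x \<in> cyl {1..} u" and "(shift_map ^^ length u) x \<in> cyl {1..} v"
proof -
  have al: "x k = (u @ v) ! k" if "k < length (u @ v)" for k
    using assms that unfolding cyl_iff by blast
  have "x k = u ! k" if "k < length u" for k
    using al[of k] that by (simp add: nth_append)
  then show "x \<in> cyl {1..} u" using assms by (simp add: cyl_iff)
  have "x (k + length u) = v ! k" if "k < length v" for k
    using al[of "k + length u"] that by (simp add: nth_append)
  then show "(shift_map ^^ length u) x \<in> cyl {1..} v"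
    using assms by (auto simp: cyl_iff shift_pow XN_iff)
qed

lemma cyl_weight_append: "cyl_weight \<phi> (u @ v) \<le> cyl_weight \<phi> u * cyl_weight \<phi> v"
  unfolding cyl_weight_def[of \<phi> "u @ v"]
proof (rule SUP_least)
  fix x assume x: "x \<in> cyl {1..} (u @ v)"
  have "ennreal (exp (birkhoff (length (u @ v)) \<phi> x)) =
      ennreal (exp (birkhoff (length u) \<phi> x)) * ennreal (exp (birkhoff (length v) \<phi> ((shift_map ^^ length u) x)))"
    by (simp add: birkhoff_add exp_add ennreal_mult)
  also have "\<dots> \<le> cyl_weight \<phi> u * cyl_weight \<phi> v"
    unfolding cyl_weight_def by (intro mult_mono SUP_upper cyl_append[OF x]) auto
  finally show "ennreal (exp (birkhoff (length (u @ v)) \<phi> x)) \<le> cyl_weight \<phi> u * cyl_weight \<phi> v" .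
qed

text \<open>The bound holds in \<open>ennreal\<close> for every \<open>\<phi>\<close>. It is used twice: for the potential of the
  theorem, to obtain its pressure from Fekete's lemma, and for the potential that favours large
  symbols in the proof of tightness.\<close>

lemma cyl_sum_submult: "cyl_sum \<phi> (m + n) \<le> cyl_sum \<phi> m * cyl_sum \<phi> n"
proof (rule cyl_sum_le)
  fix F :: "nat list set" assume F: "finite F" "F \<subseteq> words {1..} (m + n)"
  let ?T = "take m ` F" and ?D = "drop m ` F"
  have len: "length w = m + n" if "w \<in> F" for w using F that by (auto simp: words_def)
  have "sum (cyl_weight \<phi>) F \<le> (\<Sum>w\<in>F. cyl_weight \<phi> (take m w) * cyl_weight \<phi> (drop m w))"
    by (rule sum_mono) (metis append_take_drop_id cyl_weight_append)
  also have "\<dots> = (\<Sum>p\<in>(\<lambda>w. (take m w, drop m w)) ` F. cyl_weight \<phi> (fst p) * cyl_weight \<phi> (snd p))"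
    by (subst sum.reindex) (auto intro!: inj_onI, metis append_take_drop_id)
  also have "\<dots> \<le> (\<Sum>p\<in>?T \<times> ?D. cyl_weight \<phi> (fst p) * cyl_weight \<phi> (snd p))"
    by (rule sum_mono2) (use F in auto)
  also have "\<dots> = sum (cyl_weight \<phi>) ?T * sum (cyl_weight \<phi>) ?D"
    by (simp add: sum_product sum.cartesian_product case_prod_beta)
  also have "\<dots> \<le> cyl_sum \<phi> m * cyl_sum \<phi> n"
  proof (intro mult_mono sum_le_cyl_sum)
    show "?T \<subseteq> words {1..} m" "?D \<subseteq> words {1..} n"
      using F(2) by (auto simp: words_def dest!: in_set_takeD in_set_dropD)
  qed (use F in auto)
  finally show "sum (cyl_weight \<phi>) F \<le> cyl_sum \<phi> m * cyl_sum \<phi> n" .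
qed

lemma cyl_sum_pow: "n > 0 \<Longrightarrow> cyl_sum \<phi> n \<le> cyl_sum \<phi> 1 ^ n"
proof (induction n rule: nat_induct_non_zero)
  case (Suc n)
  have "cyl_sum \<phi> (Suc n) \<le> cyl_sum \<phi> 1 * cyl_sum \<phi> n" using cyl_sum_submult[of \<phi> 1 n] by (simp add: One_nat_def)
  also have "\<dots> \<le> cyl_sum \<phi> 1 * cyl_sum \<phi> 1 ^ n" by (intro mult_left_mono Suc.IH) simp
  finally show ?case by simp
qed simp

lemma cyl_sum_0_le: "cyl_sum \<phi> 0 \<le> 1"
proof -
  have "words {1..} 0 = {[] :: nat list}" by (auto simp: words_def)
  then show ?thesis by (auto simp: cyl_sum_def cyl_weight_def birkhoff_def intro!: SUP_least)
qed

section \<open>Periodic points\<close>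

definition periodic :: "nat list \<Rightarrow> nat \<Rightarrow> nat" where
  "periodic w = (\<lambda>i. w ! (i mod length w))"

definition prefix_word :: "nat \<Rightarrow> (nat \<Rightarrow> 'a) \<Rightarrow> 'a list" where
  "prefix_word n x = map x [0..<n]"

lemma length_prefix_word[simp]: "length (prefix_word n x) = n"
  by (simp add: prefix_word_def)

lemma nth_prefix_word[simp]: "k < n \<Longrightarrow> prefix_word n x ! k = x k"
  by (simp add: prefix_word_def)

lemma prefix_word_words: "x \<in> XN \<Longrightarrow> prefix_word n x \<in> words {1..} n"
  by (auto simp: prefix_word_def words_def XN_iff)

lemma words_nth: "w \<in> words {1..} n \<Longrightarrow> k < n \<Longrightarrow> 1 \<le> w ! k"
  by (auto simp: words_def dest: nth_mem)

lemma periodic_EN: "w \<in> words {1..} n \<Longrightarrow> n > 0 \<Longrightarrow> periodic w \<in> EN n"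
  using words_nth[of w n] by (auto simp: EN_def XN_iff periodic_def shift_pow words_def)

lemma prefix_word_periodic: "w \<in> words {1..} n \<Longrightarrow> prefix_word n (periodic w) = w"
  by (auto simp: prefix_word_def periodic_def words_def intro!: nth_equalityI)

lemma EN_mod: "x \<in> EN n \<Longrightarrow> x i = x (i mod n)"
proof -
  assume "x \<in> EN n"
  then have *: "x (k + n) = x k" for k
    by (metis (mono_tags, lifting) EN_def mem_Collect_eq shift_pow)
  have "x (k + q * n) = x k" for k q
    by (induction q) (simp_all add: * add.assoc[symmetric] add.commute[of n])
  then show ?thesis by (metis mod_div_mult_eq)
qed

lemma EN_eqI: "x \<in> EN n \<Longrightarrow> y \<in> EN n \<Longrightarrow> n > 0 \<Longrightarrow> agree n x y \<Longrightarrow> x = y"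
  by (rule ext) (metis EN_mod agree_def mod_less_divisor)

lemma periodic_prefix_word: "x \<in> EN n \<Longrightarrow> n > 0 \<Longrightarrow> periodic (prefix_word n x) = x"
  by (rule ext) (simp add: periodic_def EN_mod[symmetric])

lemma EN_XN: "x \<in> EN n \<Longrightarrow> x \<in> XN" by (simp add: EN_def)

lemma inj_on_prefix_word: "n > 0 \<Longrightarrow> inj_on (prefix_word n) (EN n)"
  by (metis inj_onI periodic_prefix_word)

lemma EN_agree: "x \<in> XN \<Longrightarrow> n > 0 \<Longrightarrow> \<exists>y\<in>EN n. agree n x y"
  by (rule bexI[OF _ periodic_EN[OF prefix_word_words]]) (auto simp: agree_def periodic_def)

lemma exp_le_cyl_weight: "x \<in> XN \<Longrightarrow> ennreal (exp (birkhoff n \<phi> x)) \<le> cyl_weight \<phi> (prefix_word n x)"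
  unfolding cyl_weight_def by (rule SUP_upper2[of x]) (auto simp: cyl_iff)

lemma EN_sum_le_cyl_sum:
  assumes "finite F" "F \<subseteq> EN n" "n > 0"
  shows "ennreal (\<Sum>x\<in>F. exp (birkhoff n \<phi> x)) \<le> cyl_sum \<phi> n"
proof -
  have "ennreal (\<Sum>x\<in>F. exp (birkhoff n \<phi> x)) = (\<Sum>x\<in>F. ennreal (exp (birkhoff n \<phi> x)))" by simp
  also have "\<dots> \<le> (\<Sum>x\<in>F. cyl_weight \<phi> (prefix_word n x))"
    by (intro sum_mono exp_le_cyl_weight) (use assms EN_XN in auto)
  also have "\<dots> = sum (cyl_weight \<phi>) (prefix_word n ` F)"
    using inj_on_prefix_word[OF assms(3)] assms(2) by (subst sum.reindex) (auto intro: inj_on_subset)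
  also have "\<dots> \<le> cyl_sum \<phi> n"
    using assms EN_XN by (intro sum_le_cyl_sum) (auto intro!: prefix_word_words)
  finally show ?thesis .
qed

lemma ZN_summable:
  assumes "cyl_sum \<phi> n < \<infinity>" "n > 0"
  shows "(\<lambda>x. exp (birkhoff n \<phi> x)) summable_on EN n" and "ennreal (ZN n \<phi>) \<le> cyl_sum \<phi> n"
proof -
  have b: "(\<Sum>x\<in>F. exp (birkhoff n \<phi> x)) \<le> enn2real (cyl_sum \<phi> n)" if "finite F" "F \<subseteq> EN n" for F
    using enn2real_mono[OF EN_sum_le_cyl_sum[OF that assms(2), of \<phi>]] assms(1)
    by (simp add: sum_nonneg)
  show s: "(\<lambda>x. exp (birkhoff n \<phi> x)) summable_on EN n"
    by (rule nonneg_bdd_above_summable_on) (auto intro!: bdd_aboveI2[where M = "enn2real (cyl_sum \<phi> n)"] b)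
  have "ZN n \<phi> \<le> enn2real (cyl_sum \<phi> n)"
    unfolding ZN_def by (rule infsum_le_finite_sums[OF s b])
  then show "ennreal (ZN n \<phi>) \<le> cyl_sum \<phi> n" using assms(1) ennreal_leI by fastforce
qed

text \<open>A cylinder of length \<open>n\<close> contains exactly one point of \<open>EN n\<close>, whose weight is the
  supremum over the cylinder up to the distortion.\<close>

lemma cyl_sum_le_ZN:
  assumes fin: "cyl_sum \<phi> n < \<infinity>" and n: "n > 0"
    and dist: "\<And>x y. x \<in> XN \<Longrightarrow> y \<in> XN \<Longrightarrow> agree n x y \<Longrightarrow> birkhoff n \<phi> x \<le> birkhoff n \<phi> y + d"
  shows "cyl_sum \<phi> n \<le> ennreal (exp d * ZN n \<phi>)"
proof (rule cyl_sum_le)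
  fix F :: "nat list set" assume F: "finite F" "F \<subseteq> words {1..} n"
  have "cyl_weight \<phi> w \<le> ennreal (exp d * exp (birkhoff n \<phi> (periodic w)))" if w: "w \<in> F" for w
    unfolding cyl_weight_def
  proof (rule SUP_least)
    fix x assume x: "x \<in> cyl {1..} w"
    have lw: "length w = n" using w F by (auto simp: words_def)
    have "birkhoff n \<phi> x \<le> birkhoff n \<phi> (periodic w) + d"
      using w F n x lw EN_XN[OF periodic_EN[of w n]]
      by (intro dist) (auto simp: cyl_iff agree_def periodic_def)
    then have "exp (birkhoff n \<phi> x) \<le> exp (d + birkhoff n \<phi> (periodic w))" by simp
    then show "ennreal (exp (birkhoff (length w) \<phi> x)) \<le> ennreal (exp d * exp (birkhoff n \<phi> (periodic w)))"
      by (simp add: lw exp_add)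
  qed
  then have "sum (cyl_weight \<phi>) F \<le> (\<Sum>w\<in>F. ennreal (exp d * exp (birkhoff n \<phi> (periodic w))))"
    by (rule sum_mono)
  also have "\<dots> = ennreal (exp d * (\<Sum>w\<in>F. exp (birkhoff n \<phi> (periodic w))))"
    by (simp add: sum_distrib_left)
  also have "(\<Sum>w\<in>F. exp (birkhoff n \<phi> (periodic w))) = (\<Sum>x\<in>periodic ` F. exp (birkhoff n \<phi> x))"
    by (subst sum.reindex) (use F in \<open>auto intro!: inj_onI dest: prefix_word_periodic[of _ n] simp: subset_eq, metis prefix_word_periodic\<close>)
  also have "\<dots> \<le> ZN n \<phi>"
    unfolding ZN_def using F n by (intro finite_sum_le_infsum ZN_summable fin) (auto intro!: periodic_EN)
  finally show "sum (cyl_weight \<phi>) F \<le> ennreal (exp d * ZN n \<phi>)" by (simp add: ennreal_leI)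
qed

locale finite_pressure =
  fixes \<phi> :: "(nat \<Rightarrow> nat) \<Rightarrow> real"
  assumes tame: "tame \<phi>" and pressure_finite: "pressure {1..} \<phi> < \<infinity>"
begin

lemma const1_XN: "(\<lambda>_. 1) \<in> XN" by (simp add: XN_iff)

lemma birkhoff_const1: "birkhoff n \<phi> (\<lambda>_. 1) = real n * \<phi> (\<lambda>_. 1)"
  by (simp add: birkhoff_def shift_pow)

text \<open>If the sum over letters diverged, then so would all sums over words, already those over
  the words \<open>p 1 1 \<dots> 1\<close>, and the pressure would be infinite.\<close>

lemma cyl_sum_1_finite: "cyl_sum \<phi> 1 < \<infinity>"
proof (rule ccontr)
  assume "\<not> cyl_sum \<phi> 1 < \<infinity>"
  then have top: "cyl_sum \<phi> 1 = \<infinity>" by (simp add: less_top[symmetric])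
  obtain c where c: "\<And>x y. x \<in> XN \<Longrightarrow> y \<in> XN \<Longrightarrow> x 0 = y 0 \<Longrightarrow> \<bar>\<phi> x - \<phi> y\<bar> \<le> c"
    using tame unfolding tame_def by metis
  have cyl_sum_top: "cyl_sum \<phi> (Suc n) = \<infinity>" for n
  proof -
    define K where "K = exp (c - real n * \<phi> (\<lambda>_. 1))"
    have le: "cyl_weight \<phi> w \<le> ennreal K * cyl_weight \<phi> (w @ replicate n 1)" if w: "w \<in> words {1..} 1" for w
      unfolding cyl_weight_def[of _ w]
    proof (rule SUP_least)
      fix x assume x: "x \<in> cyl {1..} w"
      obtain p where p: "w = [p]" "p \<ge> 1" using w by (auto simp: words_def length_Suc_conv One_nat_def)
      define y where "y = (\<lambda>k::nat. if k = 0 then p else 1)"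
      have y: "y \<in> XN" "y \<in> cyl {1..} (w @ replicate n 1)"
        using p by (auto simp: y_def XN_iff cyl_iff nth_append nth_Cons split: nat.splits)
      have sy: "(shift_map ^^ 1) y = (\<lambda>_. 1)" by (simp add: shift_pow y_def)
      have "birkhoff (1 + n) \<phi> y = \<phi> y + real n * \<phi> (\<lambda>_. 1)"
        by (subst birkhoff_add, subst sy) (simp add: birkhoff_const1, simp add: birkhoff_def One_nat_def)
      moreover have "\<phi> x \<le> \<phi> y + c"
        using c[of x y] x y p by (auto simp: cyl_iff y_def)
      ultimately have "birkhoff 1 \<phi> x \<le> (c - real n * \<phi> (\<lambda>_. 1)) + birkhoff (Suc n) \<phi> y"
        by (simp add: birkhoff_def One_nat_def)
      then have "exp (birkhoff 1 \<phi> x) \<le> K * exp (birkhoff (Suc n) \<phi> y)"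
        unfolding K_def exp_add[symmetric] by simp
      then have "ennreal (exp (birkhoff 1 \<phi> x)) \<le> ennreal K * ennreal (exp (birkhoff (Suc n) \<phi> y))"
        by (simp add: K_def ennreal_leI flip: ennreal_mult)
      also have "\<dots> \<le> ennreal K * cyl_weight \<phi> (w @ replicate n 1)"
        unfolding cyl_weight_def using y p by (intro mult_left_mono SUP_upper2[of y]) auto
      finally show "ennreal (exp (birkhoff (length w) \<phi> x)) \<le> ennreal K * cyl_weight \<phi> (w @ replicate n 1)"
        using p by (simp add: One_nat_def)
    qed
    have "cyl_sum \<phi> 1 \<le> ennreal K * cyl_sum \<phi> (Suc n)"
    proof (rule cyl_sum_le)
      fix F :: "nat list set" assume F: "finite F" "F \<subseteq> words {1..} 1"
      have "sum (cyl_weight \<phi>) F \<le> (\<Sum>w\<in>F. ennreal K * cyl_weight \<phi> (w @ replicate n 1))"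
        by (rule sum_mono) (use le F in auto)
      also have "\<dots> = ennreal K * sum (cyl_weight \<phi>) ((\<lambda>w. w @ replicate n 1) ` F)"
        by (simp add: sum_distrib_left sum.reindex inj_on_def)
      also have "\<dots> \<le> ennreal K * cyl_sum \<phi> (Suc n)"
        using F by (intro mult_left_mono sum_le_cyl_sum) (auto simp: words_def subset_eq)
      finally show "sum (cyl_weight \<phi>) F \<le> ennreal K * cyl_sum \<phi> (Suc n)" .
    qed
    then show ?thesis using top by (auto simp: K_def top_unique ennreal_mult_eq_top_iff)
  qed
  have "(\<lambda>n. ln_ennreal (cyl_sum \<phi> n) / ereal (real n)) \<longlonglongrightarrow> \<infinity>"
  proof (rule tendsto_eventually)
    show "\<forall>\<^sub>F n in sequentially. ln_ennreal (cyl_sum \<phi> n) / ereal (real n) = \<infinity>"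
      using eventually_gt_at_top[of 0]
    proof eventually_elim
      case (elim n)
      then show ?case using cyl_sum_top[of "n - 1"] by (simp add: ln_ennreal_def)
    qed
  qed
  then have "pressure {1..} \<phi> = \<infinity>" unfolding pressure_cyl_sum by (rule limI)
  then show False using pressure_finite by simp
qed

lemma cyl_sum_finite: "cyl_sum \<phi> n < \<infinity>"
proof (cases "n > 0")
  case True
  have "cyl_sum \<phi> n \<le> cyl_sum \<phi> 1 ^ n" by (rule cyl_sum_pow[OF True])
  also have "\<dots> < \<infinity>" using cyl_sum_1_finite by (simp add: power_less_top_ennreal)
  finally show ?thesis .
next
  case False
  then show ?thesis using cyl_sum_0_le[of \<phi>] by (auto simp: less_le_trans intro: le_less_trans)
qed

definition log_cyl_sum :: "nat \<Rightarrow> real" where "log_cyl_sum n = ln (enn2real (cyl_sum \<phi> n))"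

lemma cyl_sum_low: "ennreal (exp (real n * \<phi> (\<lambda>_. 1))) \<le> cyl_sum \<phi> n"
proof -
  have "ennreal (exp (birkhoff n \<phi> (\<lambda>_. 1))) \<le> cyl_weight \<phi> (prefix_word n (\<lambda>_. 1))"
    by (rule exp_le_cyl_weight[OF const1_XN])
  also have "\<dots> \<le> cyl_sum \<phi> n"
    using sum_le_cyl_sum[of "{prefix_word n (\<lambda>_. 1)}" n \<phi>] prefix_word_words[OF const1_XN] by simp
  finally show ?thesis by (simp add: birkhoff_const1)
qed

lemma cyl_sum_exp: "cyl_sum \<phi> n = ennreal (exp (log_cyl_sum n))"
proof -
  have "0 < ennreal (exp (real n * \<phi> (\<lambda>_. 1)))" by simp
  also note cyl_sum_low
  finally have "enn2real (cyl_sum \<phi> n) > 0"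
    using cyl_sum_finite[of n] by (simp add: enn2real_positive_iff)
  then show ?thesis using cyl_sum_finite[of n] by (simp add: log_cyl_sum_def)
qed

lemma log_cyl_sum_sub: "log_cyl_sum (m + n) \<le> log_cyl_sum m + log_cyl_sum n"
  using cyl_sum_submult[of \<phi> m n] by (simp add: cyl_sum_exp flip: ennreal_mult exp_add)

lemma log_cyl_sum_low: "real n * \<phi> (\<lambda>_. 1) \<le> log_cyl_sum n"
  using cyl_sum_low[of n] by (simp add: cyl_sum_exp)

definition press :: real where "press = real_of_ereal (pressure {1..} \<phi>)"

lemma log_cyl_sum_tendsto: "(\<lambda>n. log_cyl_sum n / real n) \<longlonglongrightarrow> press"
  and pressure_eq: "pressure {1..} \<phi> = ereal press"
  and press_le: "n > 0 \<Longrightarrow> real n * press \<le> log_cyl_sum n"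
proof -
  obtain L where L: "(\<lambda>n. log_cyl_sum n / real n) \<longlonglongrightarrow> L" "\<And>n. n > 0 \<Longrightarrow> L \<le> log_cyl_sum n / real n"
    using fekete[of log_cyl_sum] log_cyl_sum_sub log_cyl_sum_low by metis
  have "ln_ennreal (cyl_sum \<phi> n) = ereal (log_cyl_sum n)" for n
    unfolding ln_ennreal_def by (simp add: cyl_sum_exp)
  then have "(\<lambda>n. ln_ennreal (cyl_sum \<phi> n) / ereal (real n)) \<longlonglongrightarrow> ereal L"
    using L(1) by (auto intro!: Lim_transform_eventually[OF tendsto_ereal[OF L(1)]] eventually_mono[OF eventually_gt_at_top[of 0]])
  then have "pressure {1..} \<phi> = ereal L" unfolding pressure_cyl_sum by (rule limI)
  then show "(\<lambda>n. log_cyl_sum n / real n) \<longlonglongrightarrow> press" "pressure {1..} \<phi> = ereal press" "n > 0 \<Longrightarrow> real n * press \<le> log_cyl_sum n"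
    using L by (auto simp: press_def field_simps)
qed

lemma summable: "n > 0 \<Longrightarrow> (\<lambda>x. exp (birkhoff n \<phi> x)) summable_on EN n"
  by (rule ZN_summable[OF cyl_sum_finite])

lemma ZN_pos: "n > 0 \<Longrightarrow> ZN n \<phi> > 0"
proof -
  assume n: "n > 0"
  have "(\<lambda>_. 1) \<in> EN n" by (simp add: EN_def const1_XN shift_pow)
  then have "exp (birkhoff n \<phi> (\<lambda>_. 1)) \<le> ZN n \<phi>"
    unfolding ZN_def using finite_sum_le_infsum[OF summable[OF n], of "{\<lambda>_. 1}"] by simp
  then show ?thesis by (rule less_le_trans[rotated]) simp
qed

lemma ln_ZN_le: "n > 0 \<Longrightarrow> ln (ZN n \<phi>) \<le> log_cyl_sum n"
proof -
  assume n: "n > 0"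
  have "ennreal (ZN n \<phi>) \<le> ennreal (exp (log_cyl_sum n))"
    using ZN_summable(2)[OF cyl_sum_finite n] by (simp add: cyl_sum_exp)
  then have "ZN n \<phi> \<le> exp (log_cyl_sum n)" by simp
  then show ?thesis using ZN_pos[OF n] ln_le_cancel_iff[of "ZN n \<phi>" "exp (log_cyl_sum n)"] by simp
qed

lemma ln_ZN_ge:
  assumes n: "n > 0"
    and dist: "\<And>x y. x \<in> XN \<Longrightarrow> y \<in> XN \<Longrightarrow> agree n x y \<Longrightarrow> birkhoff n \<phi> x \<le> birkhoff n \<phi> y + d"
  shows "real n * press - d \<le> ln (ZN n \<phi>)"
proof -
  have "ennreal (exp (log_cyl_sum n)) \<le> ennreal (exp d * ZN n \<phi>)"
    using cyl_sum_le_ZN[OF cyl_sum_finite n dist] by (simp add: cyl_sum_exp)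
  then have "exp (log_cyl_sum n) \<le> exp d * ZN n \<phi>" using ZN_pos[OF n] by simp
  then have "ln (exp (log_cyl_sum n)) \<le> ln (exp d * ZN n \<phi>)" using ZN_pos[OF n] by (subst ln_le_cancel_iff) auto
  then have "log_cyl_sum n \<le> d + ln (ZN n \<phi>)" using ZN_pos[OF n] by (simp add: ln_mult)
  then show ?thesis using press_le[OF n] by simp
qed

lemma abs_summable: "n > 0 \<Longrightarrow> Infinite_Set_Sum.abs_summable_on (\<lambda>x. exp (birkhoff n \<phi> x)) (EN n)"
  using summable[of n] abs_summable_equivalent[of "\<lambda>x. exp (birkhoff n \<phi> x)" "EN n"] by simp

text \<open>The weighted averages of the theorem are expectations under this distribution (\<open>per_average\<close>).\<close>

definition per_pmf :: "nat \<Rightarrow> (nat \<Rightarrow> nat) pmf" where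
  "per_pmf n = embed_pmf (\<lambda>x. if x \<in> EN n then exp (birkhoff n \<phi> x) / ZN n \<phi> else 0)"

lemma pmf_per:
  assumes n: "n > 0"
  shows "pmf (per_pmf n) x = (if x \<in> EN n then exp (birkhoff n \<phi> x) / ZN n \<phi> else 0)"
  unfolding per_pmf_def
proof (rule pmf_embed_pmf)
  show nn: "0 \<le> (if x \<in> EN n then exp (birkhoff n \<phi> x) / ZN n \<phi> else 0)" for x
    using ZN_pos[OF n] by simp
  have abs: "Infinite_Set_Sum.abs_summable_on (\<lambda>x. exp (birkhoff n \<phi> x)) (EN n)"
    by (rule abs_summable[OF n])
  have "(\<integral>\<^sup>+ x. ennreal (if x \<in> EN n then exp (birkhoff n \<phi> x) / ZN n \<phi> else 0) \<partial>count_space UNIV) =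
      (\<integral>\<^sup>+ x. ennreal (exp (birkhoff n \<phi> x) / ZN n \<phi>) * indicator (EN n) x \<partial>count_space UNIV)"
    by (intro nn_integral_cong) (auto split: split_indicator)
  also have "\<dots> = (\<integral>\<^sup>+ x. ennreal (exp (birkhoff n \<phi> x) / ZN n \<phi>) \<partial>count_space (EN n))"
    by (subst nn_integral_count_space_indicator) auto
  also have "\<dots> = ennreal (infsetsum (\<lambda>x. exp (birkhoff n \<phi> x) / ZN n \<phi>) (EN n))"
    using ZN_pos[OF n] abs by (intro nn_integral_conv_infsetsum) (auto simp: divide_inverse intro: Infinite_Set_Sum.abs_summable_on_cmult_left)
  also have "infsetsum (\<lambda>x. exp (birkhoff n \<phi> x) / ZN n \<phi>) (EN n) = 1"
    using ZN_pos[OF n] abs by (simp add: infsetsum_cdiv infsetsum_infsum ZN_def)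
  finally show "(\<integral>\<^sup>+ x. ennreal (if x \<in> EN n then exp (birkhoff n \<phi> x) / ZN n \<phi> else 0) \<partial>count_space UNIV) = 1"
    by simp
qed

lemma set_per_pmf: "n > 0 \<Longrightarrow> set_pmf (per_pmf n) = EN n"
  using ZN_pos[of n] by (auto simp: set_pmf_eq pmf_per)

lemma per_average:
  assumes n: "n > 0" and bdd: "\<And>x. x \<in> EN n \<Longrightarrow> \<bar>g x\<bar> \<le> B"
  shows "1 / ZN n \<phi> * (\<Sum>\<^sub>\<infinity>x\<in>EN n. exp (birkhoff n \<phi> x) * g x) = measure_pmf.expectation (per_pmf n) g"
proof -
  have abs: "Infinite_Set_Sum.abs_summable_on (\<lambda>x. exp (birkhoff n \<phi> x) * g x) (EN n)"
  proof (rule Infinite_Set_Sum.abs_summable_on_comparison_test)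
    show "Infinite_Set_Sum.abs_summable_on (\<lambda>x. B * exp (birkhoff n \<phi> x)) (EN n)"
      using abs_summable[OF n] by (rule Infinite_Set_Sum.abs_summable_on_cmult_right)
    show "norm (exp (birkhoff n \<phi> x) * g x) \<le> norm (B * exp (birkhoff n \<phi> x))" if "x \<in> EN n" for x
      using bdd[OF that] by (simp add: abs_mult mult.commute[of B] mult_left_mono)
  qed
  have "measure_pmf.expectation (per_pmf n) g = infsetsum (\<lambda>x. pmf (per_pmf n) x * g x) UNIV"
    by (simp add: pmf_expectation_eq_infsetsum)
  also have "\<dots> = infsetsum (\<lambda>x. (exp (birkhoff n \<phi> x) * g x) / ZN n \<phi>) (EN n)"
    by (rule infsetsum_cong_neutral) (auto simp: pmf_per[OF n])
  also have "\<dots> = infsetsum (\<lambda>x. exp (birkhoff n \<phi> x) * g x) (EN n) / ZN n \<phi>"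
    by (rule infsetsum_cdiv) (rule abs)
  also have "infsetsum (\<lambda>x. exp (birkhoff n \<phi> x) * g x) (EN n) = (\<Sum>\<^sub>\<infinity>x\<in>EN n. exp (birkhoff n \<phi> x) * g x)"
    by (rule infsetsum_infsum) (rule abs)
  finally show ?thesis by simp
qed

end

section \<open>Entropy along itineraries\<close>

definition fiber_prob :: "'a measure \<Rightarrow> ('a \<Rightarrow> 'b) \<Rightarrow> 'b \<Rightarrow> real" where
  "fiber_prob M f b = measure M (f -` {b} \<inter> space M)"

definition fun_entropy :: "'a measure \<Rightarrow> ('a \<Rightarrow> 'b) \<Rightarrow> real" where
  "fun_entropy M f = - (\<Sum>b\<in>f ` space M. fiber_prob M f b * ln (fiber_prob M f b))"

lemma fiber_prob_nonneg: "0 \<le> fiber_prob M f b"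
  by (simp add: fiber_prob_def)

context prob_space
begin

lemma integral_simple_range:
  fixes h :: "'b \<Rightarrow> real"
  assumes f: "simple_function M f"
  shows "integrable M (\<lambda>x. h (f x))" and "(\<integral>x. h (f x) \<partial>M) = (\<Sum>b\<in>f ` space M. fiber_prob M f b * h b)"
proof -
  have fin: "finite (f ` space M)" and meas: "\<And>b. b \<in> f ` space M \<Longrightarrow> f -` {b} \<inter> space M \<in> sets M"
    using f by (auto simp: simple_function_def)
  have eq: "h (f x) = (\<Sum>b\<in>f ` space M. indicator (f -` {b} \<inter> space M) x * h b)" if x: "x \<in> space M" for x
  proof -
    have "(\<Sum>b\<in>f ` space M. indicator (f -` {b} \<inter> space M) x * h b) =
        (\<Sum>b\<in>f ` space M. if b = f x then h b else 0)"
      by (rule sum.cong) (use x in auto)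
    then show ?thesis using fin x by (simp add: sum.delta)
  qed
  have i: "integrable M (\<lambda>x. \<Sum>b\<in>f ` space M. indicator (f -` {b} \<inter> space M) x * h b)"
    using meas by (intro Bochner_Integration.integrable_sum integrable_mult_left integrable_real_indicator)
      (auto simp: emeasure_eq_measure)
  show "integrable M (\<lambda>x. h (f x))"
    using i by (rule Bochner_Integration.integrable_cong[THEN iffD2, rotated -1]) (auto simp: eq)
  have "(\<integral>x. h (f x) \<partial>M) = (\<integral>x. (\<Sum>b\<in>f ` space M. indicator (f -` {b} \<inter> space M) x * h b) \<partial>M)"
    by (rule Bochner_Integration.integral_cong) (auto simp: eq)
  also have "\<dots> = (\<Sum>b\<in>f ` space M. (\<integral>x. indicator (f -` {b} \<inter> space M) x * h b \<partial>M))"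
    using meas by (intro Bochner_Integration.integral_sum integrable_mult_left integrable_real_indicator)
      (auto simp: emeasure_eq_measure)
  also have "\<dots> = (\<Sum>b\<in>f ` space M. fiber_prob M f b * h b)"
    using meas by (intro sum.cong refl) (simp add: fiber_prob_def Int_absorb1)
  finally show "(\<integral>x. h (f x) \<partial>M) = (\<Sum>b\<in>f ` space M. fiber_prob M f b * h b)" .
qed

lemma sum_fiber_prob: "simple_function M f \<Longrightarrow> (\<Sum>b\<in>f ` space M. fiber_prob M f b) = 1"
  using integral_simple_range(2)[of f "\<lambda>_. 1"] by (simp add: prob_space)

lemma fun_entropy_integral:
  "simple_function M f \<Longrightarrow> fun_entropy M f = (\<integral>x. - ln (fiber_prob M f (f x)) \<partial>M)"
  using integral_simple_range(2)[of f "\<lambda>b. - ln (fiber_prob M f b)"]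
  by (simp add: fun_entropy_def sum_negf)

lemma fun_entropy_nonneg: "0 \<le> fun_entropy M f"
proof -
  have "fiber_prob M f b * ln (fiber_prob M f b) \<le> 0" for b
    by (cases "fiber_prob M f b = 0")
       (auto intro!: mult_nonneg_nonpos simp: fiber_prob_nonneg ln_le_zero_iff less_le fiber_prob_def)
  then show ?thesis by (simp add: fun_entropy_def sum_nonpos)
qed

text \<open>Gibbs' inequality. All upper bounds for entropies below come from a choice of \<open>q\<close>; the
  positivity assumption keeps the convention \<open>ln 0 = 0\<close> out of the way.\<close>

lemma gibbs_sum:
  assumes f: "simple_function M f"
    and q0: "\<And>b. b \<in> f ` space M \<Longrightarrow> 0 \<le> q b"
    and qpos: "\<And>b. b \<in> f ` space M \<Longrightarrow> 0 < fiber_prob M f b \<Longrightarrow> 0 < q b"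
    and q1: "(\<Sum>b\<in>f ` space M. q b) \<le> 1"
  shows "fun_entropy M f \<le> (\<Sum>b\<in>f ` space M. fiber_prob M f b * - ln (q b))"
proof -
  let ?p = "fiber_prob M f"
  have "?p b * ln (q b) - ?p b * ln (?p b) \<le> q b - ?p b" if b: "b \<in> f ` space M" for b
  proof (cases "?p b = 0")
    case False
    then have p: "?p b > 0" using fiber_prob_nonneg[of M f b] by simp
    have q: "q b > 0" using qpos[OF b p] .
    have "?p b * ln (q b / ?p b) \<le> ?p b * (q b / ?p b - 1)"
      using p q by (intro mult_left_mono ln_le_minus_one) auto
    moreover have "?p b * (q b / ?p b - 1) = q b - ?p b" using p by (simp add: field_simps)
    ultimately show ?thesis using p q by (simp add: ln_div right_diff_distrib)
  qed (use q0 b in simp)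
  then have "(\<Sum>b\<in>f ` space M. ?p b * ln (q b) - ?p b * ln (?p b)) \<le> (\<Sum>b\<in>f ` space M. q b - ?p b)"
    by (rule sum_mono)
  also have "\<dots> \<le> 0" using q1 sum_fiber_prob[OF f] by (simp add: sum_subtractf)
  finally show ?thesis by (simp add: fun_entropy_def sum_subtractf sum_negf)
qed

text \<open>If \<open>q\<close> comes from a probability distribution, its total mass on the range need not be computed.\<close>

lemma gibbs_pmf:
  assumes f: "simple_function M f"
    and le: "\<And>x. x \<in> space M \<Longrightarrow> 0 < pmf q (f x) \<and> - ln (pmf q (f x)) \<le> g x" and g: "integrable M g"
  shows "fun_entropy M f \<le> (\<integral>x. g x \<partial>M)"
proof -
  have fin: "finite (f ` space M)" using f by (rule simple_functionD)
  have "fun_entropy M f \<le> (\<Sum>b\<in>f ` space M. fiber_prob M f b * - ln (pmf q b))"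
    using f
  proof (rule gibbs_sum)
    show "(\<Sum>b\<in>f ` space M. pmf q b) \<le> 1"
      using measure_measure_pmf_finite[OF fin, of q] measure_pmf.prob_le_1[of q] by metis
  qed (use le in auto)
  also have "\<dots> = (\<integral>x. - ln (pmf q (f x)) \<partial>M)"
    by (rule integral_simple_range(2)[OF f, symmetric])
  also have "\<dots> \<le> (\<integral>x. g x \<partial>M)"
    by (intro integral_mono integral_simple_range(1)[OF f] g) (use le in auto)
  finally show ?thesis .
qed

end

definition itinerary :: "('a \<Rightarrow> 'a) \<Rightarrow> ('a \<Rightarrow> 'b) \<Rightarrow> nat \<Rightarrow> 'a \<Rightarrow> 'b list" where
  "itinerary T g n x = map (\<lambda>k. g ((T ^^ k) x)) [0..<n]"

lemma length_itinerary[simp]: "length (itinerary T g n x) = n"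
  by (simp add: itinerary_def)

lemma nth_itinerary[simp]: "k < n \<Longrightarrow> itinerary T g n x ! k = g ((T ^^ k) x)"
  by (simp add: itinerary_def)

lemma itinerary_eq_iff: "itinerary T g n x = itinerary T h n y \<longleftrightarrow> (\<forall>k<n. g ((T ^^ k) x) = h ((T ^^ k) y))"
  by (auto simp: list_eq_iff_nth_eq)

lemma itinerary_take: "take m (itinerary T g (m + n) x) = itinerary T g m x"
  by (auto intro!: nth_equalityI)

lemma itinerary_drop: "drop m (itinerary T g (m + n) x) = itinerary T g n ((T ^^ m) x)"
  by (auto intro!: nth_equalityI simp: funpow_add[symmetric, unfolded o_def, THEN fun_cong] add.commute)

definition part_of :: "'a set set \<Rightarrow> 'a \<Rightarrow> 'a set" where
  "part_of \<xi> x = (THE A. A \<in> \<xi> \<and> x \<in> A)"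

locale mp_system = prob_space M for M :: "'a measure" +
  fixes T :: "'a \<Rightarrow> 'a"
  assumes T[measurable]: "T \<in> M \<rightarrow>\<^sub>M M" and inv: "distr M M T = M"
begin

lemma T_pow[measurable]: "T ^^ k \<in> M \<rightarrow>\<^sub>M M"
  by (induction k) (auto intro: measurable_comp[OF _ T])

lemma distr_pow: "distr M M (T ^^ k) = M"
proof (induction k)
  case (Suc k)
  have "distr M M (T ^^ Suc k) = distr (distr M M (T ^^ k)) M T"
    by (subst distr_distr) auto
  then show ?case by (simp only: Suc inv)
qed (simp add: distr_id2)

lemma T_space: "x \<in> space M \<Longrightarrow> (T ^^ k) x \<in> space M"
  using measurable_space[OF T_pow] .

lemma integral_pow:
  fixes f :: "'a \<Rightarrow> real"
  assumes "f \<in> borel_measurable M"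
  shows "(\<integral>x. f ((T ^^ k) x) \<partial>M) = (\<integral>x. f x \<partial>M)"
  using integral_distr[OF T_pow assms, of k] by (simp add: distr_pow)

lemma integrable_pow:
  fixes f :: "'a \<Rightarrow> real"
  assumes "integrable M f"
  shows "integrable M (\<lambda>x. f ((T ^^ k) x))"
  using integrable_distr_eq[OF T_pow[of k], of f] assms by (simp add: distr_pow)

lemma simple_itinerary:
  assumes g: "simple_function M g"
  shows "simple_function M (itinerary T g n)"
proof (induction n)
  case 0
  then show ?case by (simp add: itinerary_def[abs_def])
next
  case (Suc n)
  have "simple_function M (\<lambda>x. g ((T ^^ n) x))"
    unfolding simple_function_def
  proof (intro conjI ballI)
    have "(\<lambda>x. g ((T ^^ n) x)) ` space M \<subseteq> g ` space M" using T_space by auto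
    then show "finite ((\<lambda>x. g ((T ^^ n) x)) ` space M)"
      using simple_functionD(1)[OF g] by (rule finite_subset)
    fix b
    have "(\<lambda>x. g ((T ^^ n) x)) -` {b} \<inter> space M = (T ^^ n) -` (g -` {b} \<inter> space M) \<inter> space M"
      using T_space by auto
    then show "(\<lambda>x. g ((T ^^ n) x)) -` {b} \<inter> space M \<in> sets M"
      using measurable_sets[OF T_pow simple_functionD(2)[OF g]] by simp
  qed
  from simple_function_compose[OF simple_function_Pair[OF Suc this], of "\<lambda>(u, a). u @ [a]"]
  show ?case by (simp add: o_def itinerary_def[abs_def])
qed

text \<open>Gibbs' inequality with the product of the laws of the first \<open>m\<close> and the last \<open>n\<close> symbols;
  invariance identifies the second law with that of an itinerary starting at time 0.\<close>

lemma entropy_subadditive: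
  assumes g: "simple_function M g"
  shows "fun_entropy M (itinerary T g (m + n)) \<le> fun_entropy M (itinerary T g m) + fun_entropy M (itinerary T g n)"
proof -
  let ?I = "itinerary T g" and ?P = "\<lambda>n. fiber_prob M (itinerary T g n)"
  have s: "simple_function M (?I n)" for n by (rule simple_itinerary[OF g])
  define q where "q v = ?P m (take m v) * ?P n (drop m v)" for v
  have fin: "finite (?I n ` space M)" for n by (rule simple_functionD[OF s])
  have range: "take m v \<in> ?I m ` space M" "drop m v \<in> ?I n ` space M" if "v \<in> ?I (m + n) ` space M" for v
    using that T_space by (auto simp: itinerary_take itinerary_drop)
  have pos: "0 < ?P m (take m v)" "0 < ?P n (drop m v)"
    if v: "v \<in> ?I (m + n) ` space M" "0 < ?P (m + n) v" for v
  proof -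
    have "?P (m + n) v \<le> ?P m (take m v)"
      unfolding fiber_prob_def
      by (rule finite_measure_mono) (auto simp: itinerary_take simple_functionD(2)[OF s])
    then show "0 < ?P m (take m v)" using v by linarith
    have "?P (m + n) v \<le> measure M ((T ^^ m) -` (?I n -` {drop m v} \<inter> space M) \<inter> space M)"
      unfolding fiber_prob_def
      using T_space by (intro finite_measure_mono measurable_sets[OF T_pow] simple_functionD(2)[OF s])
        (auto simp: itinerary_drop)
    also have "\<dots> = measure (distr M M (T ^^ m)) (?I n -` {drop m v} \<inter> space M)"
      by (subst measure_distr) (auto intro: simple_functionD(2)[OF s])
    also have "\<dots> = ?P n (drop m v)" by (simp add: distr_pow fiber_prob_def)
    finally show "0 < ?P n (drop m v)" using v by linarith
  qed
  have "fun_entropy M (?I (m + n)) \<le> (\<Sum>v\<in>?I (m + n) ` space M. ?P (m + n) v * - ln (q v))"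
    using s
  proof (rule gibbs_sum)
    show "0 \<le> q v" for v by (simp add: q_def fiber_prob_nonneg)
    show "0 < q v" if "v \<in> ?I (m + n) ` space M" "0 < ?P (m + n) v" for v
      using pos[OF that] by (simp add: q_def)
    have "(\<Sum>v\<in>?I (m + n) ` space M. q v) =
        (\<Sum>p\<in>(\<lambda>v. (take m v, drop m v)) ` ?I (m + n) ` space M. ?P m (fst p) * ?P n (snd p))"
      by (subst sum.reindex) (auto intro!: inj_onI simp: q_def, metis append_take_drop_id)
    also have "\<dots> \<le> (\<Sum>p\<in>?I m ` space M \<times> ?I n ` space M. ?P m (fst p) * ?P n (snd p))"
      using fin range by (intro sum_mono2) (auto simp: fiber_prob_nonneg)
    also have "\<dots> = (\<Sum>u\<in>?I m ` space M. ?P m u) * (\<Sum>w\<in>?I n ` space M. ?P n w)"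
      by (simp add: sum_product sum.cartesian_product case_prod_beta)
    finally show "(\<Sum>v\<in>?I (m + n) ` space M. q v) \<le> 1" by (simp add: sum_fiber_prob[OF s])
  qed
  also have "\<dots> = (\<Sum>v\<in>?I (m + n) ` space M. ?P (m + n) v * (- ln (?P m (take m v)) - ln (?P n (drop m v))))"
  proof (rule sum.cong[OF refl])
    fix v assume v: "v \<in> ?I (m + n) ` space M"
    show "?P (m + n) v * - ln (q v) = ?P (m + n) v * (- ln (?P m (take m v)) - ln (?P n (drop m v)))"
    proof (cases "?P (m + n) v = 0")
      case False
      then have "0 < ?P (m + n) v" using fiber_prob_nonneg[of M "?I (m + n)" v] by simp
      from pos[OF v this] show ?thesis by (simp add: q_def ln_mult)
    qed simp
  qed
  also have "\<dots> = (\<integral>x. - ln (?P m (?I m x)) - ln (?P n (?I n ((T ^^ m) x))) \<partial>M)"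
    using integral_simple_range(2)[OF s, of "\<lambda>v. - ln (?P m (take m v)) - ln (?P n (drop m v))" "m + n"]
    by (simp add: itinerary_take itinerary_drop)
  also have "\<dots> = (\<integral>x. - ln (?P m (?I m x)) \<partial>M) - (\<integral>x. ln (?P n (?I n ((T ^^ m) x))) \<partial>M)"
    by (intro Bochner_Integration.integral_diff integral_simple_range(1)[OF s, of "\<lambda>v. - ln (?P m v)"]
        integrable_pow[of "\<lambda>x. ln (?P n (?I n x))"] integral_simple_range(1)[OF s])
  also have "(\<integral>x. ln (?P n (?I n ((T ^^ m) x))) \<partial>M) = (\<integral>x. ln (?P n (?I n x)) \<partial>M)"
    by (intro integral_pow[of "\<lambda>x. ln (?P n (?I n x))"] borel_measurable_integrable integral_simple_range(1)[OF s])
  finally show ?thesis by (simp add: fun_entropy_integral[OF s])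
qed

lemma part_of:
  assumes "\<xi> \<in> finite_partitions M" "x \<in> space M"
  shows "part_of \<xi> x \<in> \<xi>" "x \<in> part_of \<xi> x" and part_of_eq: "A \<in> \<xi> \<Longrightarrow> x \<in> A \<Longrightarrow> part_of \<xi> x = A"
proof -
  have p: "partition_on (space M) \<xi>" using assms by (simp add: finite_partitions_def)
  have "\<exists>!A. A \<in> \<xi> \<and> x \<in> A"
    using p assms(2) partition_onD1[OF p] partition_onD2[OF p] by (auto simp: disjoint_def)
  from theI'[OF this] this show "part_of \<xi> x \<in> \<xi>" "x \<in> part_of \<xi> x" "A \<in> \<xi> \<Longrightarrow> x \<in> A \<Longrightarrow> part_of \<xi> x = A"
    by (auto simp: part_of_def)
qed

lemma simple_part_of:
  assumes \<xi>: "\<xi> \<in> finite_partitions M"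
  shows "simple_function M (part_of \<xi>)"
  unfolding simple_function_def
proof (intro conjI ballI)
  have sub: "part_of \<xi> ` space M \<subseteq> \<xi>" using part_of[OF \<xi>] by auto
  then show "finite (part_of \<xi> ` space M)" using \<xi> by (auto simp: finite_partitions_def intro: finite_subset)
  fix A assume "A \<in> part_of \<xi> ` space M"
  then have A: "A \<in> \<xi>" using sub by auto
  then have "part_of \<xi> -` {A} \<inter> space M = A"
  proof (intro set_eqI iffI)
    fix x assume "x \<in> part_of \<xi> -` {A} \<inter> space M"
    then show "x \<in> A" using part_of(2)[OF \<xi>, of x] by simp
  next
    fix x assume x: "x \<in> A"
    have "A \<subseteq> space M" using A \<xi> by (auto simp: finite_partitions_def dest: sets.sets_into_space)
    then show "x \<in> part_of \<xi> -` {A} \<inter> space M" using part_of_eq[OF \<xi> _ A x] x by auto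
  qed
  then show "part_of \<xi> -` {A} \<inter> space M \<in> sets M" using A \<xi> by (auto simp: finite_partitions_def)
qed

text \<open>This translates the entropy of joined partitions into that of itineraries of labels: two points
  lie in the same element of the join iff their label itineraries coincide.\<close>

lemma iterated_join_eq:
  assumes \<xi>: "\<xi> \<in> finite_partitions M"
  shows "iterated_join M T \<xi> n =
    (\<lambda>b. itinerary T (part_of \<xi>) n -` {b} \<inter> space M) ` (itinerary T (part_of \<xi>) n ` space M)"
    (is "?L = ?R")
proof -
  let ?I = "itinerary T (part_of \<xi>) n"
  have eq: "{y \<in> space M. \<forall>k<n. (T ^^ k) y \<in> c k} = ?I -` {?I x} \<inter> space M"
    if x: "x \<in> space M" and c: "\<And>k. k < n \<Longrightarrow> c k = part_of \<xi> ((T ^^ k) x)" for x c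
  proof -
    have "(T ^^ k) y \<in> c k \<longleftrightarrow> part_of \<xi> ((T ^^ k) y) = part_of \<xi> ((T ^^ k) x)" if "y \<in> space M" "k < n" for y k
      unfolding c[OF that(2)]
      using part_of[OF \<xi> T_space[OF x, of k]] part_of[OF \<xi> T_space[OF that(1), of k]] part_of_eq[OF \<xi> T_space[OF that(1), of k]]
      by metis
    then show ?thesis by (auto simp: itinerary_eq_iff)
  qed
  show ?thesis
  proof (intro set_eqI iffI)
    fix S assume "S \<in> ?L"
    then obtain c where c: "c \<in> {..<n} \<rightarrow> \<xi>" "S = {x \<in> space M. \<forall>k<n. (T ^^ k) x \<in> c k}" "S \<noteq> {}"
      unfolding iterated_join_def by auto
    then obtain x where x: "x \<in> space M" "\<And>k. k < n \<Longrightarrow> (T ^^ k) x \<in> c k" by auto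
    have "c k = part_of \<xi> ((T ^^ k) x)" if "k < n" for k
      using part_of_eq[OF \<xi> T_space[OF x(1)] _ x(2)[OF that]] c(1) that by auto
    from eq[OF x(1) this] show "S \<in> ?R" using c(2) x(1) by blast
  next
    fix S assume "S \<in> ?R"
    then obtain x where x: "x \<in> space M" "S = ?I -` {?I x} \<inter> space M" by auto
    then have "S = {y \<in> space M. \<forall>k<n. (T ^^ k) y \<in> part_of \<xi> ((T ^^ k) x)}" "x \<in> S"
      using eq[OF x(1), of "\<lambda>k. part_of \<xi> ((T ^^ k) x)"] by auto
    note S = this
    have c: "(\<lambda>k. part_of \<xi> ((T ^^ k) x)) \<in> {..<n} \<rightarrow> \<xi>"
      using part_of(1)[OF \<xi> T_space[OF x(1)]] by auto
    have "S \<in> {{x \<in> space M. \<forall>k<n. (T ^^ k) x \<in> c k} | c. c \<in> {..<n} \<rightarrow> \<xi>}"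
      using S(1) c by (intro CollectI exI[of _ "\<lambda>k. part_of \<xi> ((T ^^ k) x)"] conjI)
    then show "S \<in> ?L" unfolding iterated_join_def using S(2) by auto
  qed
qed

lemma partition_entropy_join:
  assumes \<xi>: "\<xi> \<in> finite_partitions M"
  shows "partition_entropy M (iterated_join M T \<xi> n) = fun_entropy M (itinerary T (part_of \<xi>) n)"
  unfolding iterated_join_eq[OF \<xi>] partition_entropy_def fun_entropy_def fiber_prob_def
  by (subst sum.reindex) (auto intro!: inj_onI)

text \<open>By subadditivity the limit in the definition of the entropy exists, so that \<open>lim\<close> has its meaning.\<close>

lemma entropy_rate:
  assumes \<xi>: "\<xi> \<in> finite_partitions M"
  defines "L \<equiv> lim (\<lambda>n. partition_entropy M (iterated_join M T \<xi> n) / real n)"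
  shows "(\<lambda>n. fun_entropy M (itinerary T (part_of \<xi>) n) / real n) \<longlonglongrightarrow> L"
    and "n > 0 \<Longrightarrow> L \<le> fun_entropy M (itinerary T (part_of \<xi>) n) / real n"
proof -
  let ?a = "\<lambda>n. fun_entropy M (itinerary T (part_of \<xi>) n)"
  have sub: "?a (m + n) \<le> ?a m + ?a n" for m n by (rule entropy_subadditive[OF simple_part_of[OF \<xi>]])
  have low: "real n * 0 \<le> ?a n" for n using fun_entropy_nonneg by simp
  obtain L' where L': "(\<lambda>n. ?a n / real n) \<longlonglongrightarrow> L'" "\<And>n. n > 0 \<Longrightarrow> L' \<le> ?a n / real n"
    by (rule fekete[OF sub low]) (rule that)
  have "L = L'" unfolding L_def partition_entropy_join[OF \<xi>] by (rule limI[OF L'(1)])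
  then show "(\<lambda>n. ?a n / real n) \<longlonglongrightarrow> L" "n > 0 \<Longrightarrow> L \<le> ?a n / real n" using L' by auto
qed

end

section \<open>The variational inequality\<close>

lemma pmf_bind_ge: "pmf p x * pmf (f x) y \<le> pmf (bind_pmf p f) y"
proof -
  have "pmf p x * pmf (f x) y = measure_pmf.expectation p (\<lambda>z. indicator {x} z * pmf (f x) y)"
    by (simp add: measure_pmf_single)
  also have "\<dots> \<le> measure_pmf.expectation p (\<lambda>z. pmf (f z) y)"
    by (intro integral_mono integrable_mult_left measure_pmf.integrable_const_bound[where B=1])
       (auto split: split_indicator simp: pmf_le_1)
  also have "\<dots> = pmf (bind_pmf p f) y" by (simp add: pmf_bind)
  finally show ?thesis .
qed

text \<open>The labels of a Borel partition are close to, but not equal to, functions of finitely many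
  coordinates. In Gibbs' inequality the difference is absorbed by observing these functions through a
  noisy channel, which gives every label a positive probability.\<close>

definition noise :: "real \<Rightarrow> 'b set \<Rightarrow> 'b \<Rightarrow> 'b pmf" where
  "noise \<epsilon> S b = bind_pmf (bernoulli_pmf \<epsilon>) (\<lambda>t. if t then pmf_of_set S else return_pmf b)"

lemma pmf_noise:
  assumes "0 < \<epsilon>" "\<epsilon> < 1" "finite S" "S \<noteq> {}" "a \<in> S"
  shows "(if a = b then 1 - \<epsilon> else \<epsilon> / card S) \<le> pmf (noise \<epsilon> S b) a"
proof -
  have "pmf (bernoulli_pmf \<epsilon>) True * pmf (pmf_of_set S) a \<le> pmf (noise \<epsilon> S b) a"
    unfolding noise_def using pmf_bind_ge[of "bernoulli_pmf \<epsilon>" True "\<lambda>t. if t then pmf_of_set S else return_pmf b" a] by simp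
  moreover have "pmf (bernoulli_pmf \<epsilon>) False * pmf (return_pmf b) a \<le> pmf (noise \<epsilon> S b) a"
    unfolding noise_def using pmf_bind_ge[of "bernoulli_pmf \<epsilon>" False "\<lambda>t. if t then pmf_of_set S else return_pmf b" a] by simp
  ultimately show ?thesis using assms by (auto simp: pmf_of_set)
qed

primrec noisy_word :: "real \<Rightarrow> 'b set \<Rightarrow> 'b list \<Rightarrow> 'b list pmf" where
  "noisy_word \<epsilon> S [] = return_pmf []"
| "noisy_word \<epsilon> S (b # bs) = bind_pmf (noise \<epsilon> S b) (\<lambda>a. map_pmf ((#) a) (noisy_word \<epsilon> S bs))"

lemma pmf_noisy_word:
  assumes "0 < \<epsilon>" "\<epsilon> < 1" "finite S" "S \<noteq> {}" "length as = length bs" "set as \<subseteq> S"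
  shows "(\<Prod>i<length as. if as ! i = bs ! i then 1 - \<epsilon> else \<epsilon> / card S) \<le> pmf (noisy_word \<epsilon> S bs) as"
  using assms(5,6)
proof (induction as bs rule: list_induct2)
  case (Cons a as b bs)
  have "(\<Prod>i<length (a # as). if (a # as) ! i = (b # bs) ! i then 1 - \<epsilon> else \<epsilon> / card S) =
      (if a = b then 1 - \<epsilon> else \<epsilon> / card S) * (\<Prod>i<length as. if as ! i = bs ! i then 1 - \<epsilon> else \<epsilon> / card S)"
    by (simp add: prod.lessThan_Suc_shift del: prod.lessThan_Suc)
  also have "\<dots> \<le> pmf (noise \<epsilon> S b) a * pmf (noisy_word \<epsilon> S bs) as"
    using assms(1-4) Cons by (intro mult_mono pmf_noise prod_nonneg) auto
  also have "pmf (noisy_word \<epsilon> S bs) as = pmf (map_pmf ((#) a) (noisy_word \<epsilon> S bs)) (a # as)"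
    by (rule pmf_map_inj'[symmetric]) (simp add: inj_on_def)
  also have "pmf (noise \<epsilon> S b) a * \<dots> \<le> pmf (noisy_word \<epsilon> S (b # bs)) (a # as)"
    unfolding noisy_word.simps by (rule pmf_bind_ge)
  finally show ?case .
qed simp

lemma measurable_prefix_word[measurable]: "prefix_word N \<in> BX \<rightarrow>\<^sub>M count_space UNIV"
proof (induction N)
  case (Suc N)
  have "prefix_word (Suc N) = (\<lambda>x::nat \<Rightarrow> nat. prefix_word N x @ [x N])"
    by (auto simp: prefix_word_def)
  moreover have "(\<lambda>x::nat \<Rightarrow> nat. prefix_word N x @ [x N]) \<in> BX \<rightarrow>\<^sub>M count_space UNIV"
    by (rule measurable_compose_countable[where f = "\<lambda>u x. u @ [x N]" and g = "prefix_word N", OF _ Suc])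
       (auto intro!: measurable_compose[OF coord_measurable])
  ultimately show ?case by simp
qed (simp add: prefix_word_def)

lemma take_prefix_word: "M \<le> N \<Longrightarrow> take M (prefix_word N x) = prefix_word M x"
  by (auto intro!: nth_equalityI)

definition cyl_set :: "nat \<Rightarrow> nat list set \<Rightarrow> (nat \<Rightarrow> nat) set" where
  "cyl_set N W = prefix_word N -` W \<inter> XN"

lemma cyl_set_sets[measurable]: "cyl_set N W \<in> sets BX"
  using measurable_sets[OF measurable_prefix_word, of W N] by (simp add: cyl_set_def)

lemma cyl_set_refine: "M \<le> N \<Longrightarrow> cyl_set M W = cyl_set N {w. take M w \<in> W}"
  by (auto simp: cyl_set_def take_prefix_word)

text \<open>The sets that are approximated by sets determined by finitely many coordinates form a
  \<open>\<sigma>\<close>-algebra that contains the open sets, hence they contain all Borel sets.\<close>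

definition cyl_approx :: "(nat \<Rightarrow> nat) measure \<Rightarrow> (nat \<Rightarrow> nat) set \<Rightarrow> bool" where
  "cyl_approx \<mu> A \<longleftrightarrow> A \<in> sets BX \<and> (\<forall>e>0. \<exists>N W. measure \<mu> (A - cyl_set N W \<union> (cyl_set N W - A)) < e)"

context
  fixes \<mu> :: "(nat \<Rightarrow> nat) measure"
  assumes \<mu>: "\<mu> \<in> MX"
begin

interpretation prob_space \<mu> using \<mu> by (simp add: MX_def)

lemma sets_MX: "sets \<mu> = sets BX" and space_MX: "space \<mu> = XN"
proof -
  show s: "sets \<mu> = sets BX" using \<mu> by (simp add: MX_def BX_def)
  show "space \<mu> = XN" using sets_eq_imp_space_eq[OF s] by simp
qed

lemma cyl_approx_cyl_set: "cyl_approx \<mu> (cyl_set N W)"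
  unfolding cyl_approx_def by (auto intro!: exI[of _ N] exI[of _ W])

lemma cyl_approx_compl: assumes "cyl_approx \<mu> A" shows "cyl_approx \<mu> (XN - A)"
  unfolding cyl_approx_def
proof (intro conjI allI impI)
  show "XN - A \<in> sets BX" using assms sets.compl_sets[of A BX] by (simp add: cyl_approx_def)
  fix e :: real assume "e > 0"
  then obtain N W where NW: "measure \<mu> (A - cyl_set N W \<union> (cyl_set N W - A)) < e"
    using assms unfolding cyl_approx_def by metis
  have "A \<subseteq> XN" using assms sets.sets_into_space[of A BX] by (simp add: cyl_approx_def)
  then have "XN - A - cyl_set N (- W) \<union> (cyl_set N (- W) - (XN - A)) = A - cyl_set N W \<union> (cyl_set N W - A)"
    by (auto simp: cyl_set_def)
  then show "\<exists>N W. measure \<mu> (XN - A - cyl_set N W \<union> (cyl_set N W - (XN - A))) < e"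
    using NW by metis
qed

lemma cyl_approx_Un: assumes "cyl_approx \<mu> A" "cyl_approx \<mu> B" shows "cyl_approx \<mu> (A \<union> B)"
  unfolding cyl_approx_def
proof (intro conjI allI impI)
  have [measurable]: "A \<in> sets BX" "B \<in> sets BX" using assms by (auto simp: cyl_approx_def)
  show "A \<union> B \<in> sets BX" by simp
  fix e :: real assume "e > 0"
  then obtain M V N W where *: "measure \<mu> (A - cyl_set M V \<union> (cyl_set M V - A)) < e / 2"
      "measure \<mu> (B - cyl_set N W \<union> (cyl_set N W - B)) < e / 2"
    using assms unfolding cyl_approx_def by (meson half_gt_zero)
  define C where "C = cyl_set (max M N) ({w. take M w \<in> V} \<union> {w. take N w \<in> W})"
  have C: "C = cyl_set M V \<union> cyl_set N W"
    unfolding C_def using cyl_set_refine[of M "max M N" V] cyl_set_refine[of N "max M N" W]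
    by (auto simp: cyl_set_def)
  have "measure \<mu> (A \<union> B - C \<union> (C - (A \<union> B))) \<le>
      measure \<mu> ((A - cyl_set M V \<union> (cyl_set M V - A)) \<union> (B - cyl_set N W \<union> (cyl_set N W - B)))"
    unfolding C by (intro finite_measure_mono) (auto simp: sets_MX)
  also have "\<dots> \<le> measure \<mu> (A - cyl_set M V \<union> (cyl_set M V - A)) + measure \<mu> (B - cyl_set N W \<union> (cyl_set N W - B))"
    by (intro measure_Un_le) (auto simp: sets_MX)
  also have "\<dots> < e" using * by linarith
  finally show "\<exists>N W. measure \<mu> (A \<union> B - cyl_set N W \<union> (cyl_set N W - (A \<union> B))) < e"
    unfolding C_def by (intro exI)
qed

lemma cyl_approx_UN: assumes A: "\<And>i::nat. cyl_approx \<mu> (A i)" shows "cyl_approx \<mu> (\<Union>i. A i)"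
  unfolding cyl_approx_def
proof (intro conjI allI impI)
  have [measurable]: "A i \<in> sets BX" for i using A by (auto simp: cyl_approx_def)
  show U[measurable]: "(\<Union>i. A i) \<in> sets BX" by auto
  fix e :: real assume e: "e > 0"
  define B where "B n = (\<Union>i<n. A i)" for n
  have [measurable]: "B n \<in> sets BX" for n by (auto simp: B_def)
  have BA: "cyl_approx \<mu> (B n)" for n
  proof (induction n)
    case 0
    then show ?case using cyl_approx_cyl_set[of 0 "{}"] by (simp add: B_def cyl_set_def)
  next
    case (Suc n)
    then show ?case using cyl_approx_Un[OF A[of n]] by (simp add: B_def lessThan_Suc)
  qed
  have "incseq B" unfolding incseq_def B_def by (intro allI impI UN_mono) auto
  then have "(\<lambda>n. measure \<mu> (B n)) \<longlonglongrightarrow> measure \<mu> (\<Union>n. B n)"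
    by (intro finite_Lim_measure_incseq) (auto simp: sets_MX)
  moreover have "(\<Union>n. B n) = (\<Union>i. A i)" by (auto simp: B_def)
  ultimately obtain n where n: "measure \<mu> (\<Union>i. A i) - e / 2 < measure \<mu> (B n)"
    using order_tendstoD(1)[of "\<lambda>n. measure \<mu> (B n)" "measure \<mu> (\<Union>i. A i)" sequentially "measure \<mu> (\<Union>i. A i) - e / 2"] e
    by (auto simp: eventually_sequentially)
  obtain N W where NW: "measure \<mu> (B n - cyl_set N W \<union> (cyl_set N W - B n)) < e / 2"
    using BA[of n] e unfolding cyl_approx_def by (meson half_gt_zero)
  have sub: "B n \<subseteq> (\<Union>i. A i)" by (auto simp: B_def)
  have "measure \<mu> ((\<Union>i. A i) - cyl_set N W \<union> (cyl_set N W - (\<Union>i. A i))) \<le>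
      measure \<mu> ((B n - cyl_set N W \<union> (cyl_set N W - B n)) \<union> ((\<Union>i. A i) - B n))"
    using sub by (intro finite_measure_mono) (auto simp: sets_MX)
  also have "\<dots> \<le> measure \<mu> (B n - cyl_set N W \<union> (cyl_set N W - B n)) + measure \<mu> ((\<Union>i. A i) - B n)"
    by (intro measure_Un_le) (auto simp: sets_MX)
  also have "measure \<mu> ((\<Union>i. A i) - B n) = measure \<mu> (\<Union>i. A i) - measure \<mu> (B n)"
    using sub by (intro finite_measure_Diff) (auto simp: sets_MX)
  finally show "\<exists>N W. measure \<mu> ((\<Union>i. A i) - cyl_set N W \<union> (cyl_set N W - (\<Union>i. A i))) < e"
    using NW n by (intro exI[of _ N] exI[of _ W]) linarith
qed

lemma cyl_approx_borel:
  assumes "A \<in> sets \<mu>"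
  shows "cyl_approx \<mu> A"
proof -
  have "A \<in> (\<inter>) XN ` sets borel" using assms by (simp add: sets_MX BX_def sets_restrict_space)
  then obtain B where B: "B \<in> sets borel" "A = XN \<inter> B" by auto
  have "B \<in> sigma_sets UNIV {S. open S}" using B(1) by (simp add: borel_def)
  then have "cyl_approx \<mu> (XN \<inter> B)"
  proof induction
    case (Basic U)
    have "XN \<inter> U = (\<Union>N. cyl_set N {w. \<forall>y. prefix_word N y = w \<longrightarrow> y \<in> U})"
    proof (intro set_eqI iffI)
      fix x assume x: "x \<in> XN \<inter> U"
      then obtain N where N: "\<forall>y. agree N x y \<longrightarrow> y \<in> U" using agree_nhds_base[of U x] Basic by auto
      have "y \<in> U" if "prefix_word N y = prefix_word N x" for y
      proof -
        have "x k = y k" if "k < N" for k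
          using \<open>prefix_word N y = prefix_word N x\<close> that by (metis nth_prefix_word)
        then show ?thesis using N by (simp add: agree_def)
      qed
      then show "x \<in> (\<Union>N. cyl_set N {w. \<forall>y. prefix_word N y = w \<longrightarrow> y \<in> U})"
        using x by (auto simp: cyl_set_def)
    qed (auto simp: cyl_set_def)
    then show ?case by (simp add: cyl_approx_UN cyl_approx_cyl_set)
  next
    case Empty
    then show ?case using cyl_approx_cyl_set[of 0 "{}"] by (simp add: cyl_set_def)
  next
    case (Compl B)
    have "XN \<inter> (UNIV - B) = XN - XN \<inter> B" by auto
    then show ?case using cyl_approx_compl[OF Compl.IH] by simp
  next
    case (Union B)
    have "XN \<inter> (\<Union>i. B i) = (\<Union>i. XN \<inter> B i)" by auto
    then show ?case using cyl_approx_UN[of "\<lambda>i. XN \<inter> B i"] Union.IH by simp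
  qed
  then show ?thesis using B by simp
qed

end

lemma mp_system_MX_inv:
  assumes "\<mu> \<in> MX_inv"
  shows "mp_system \<mu> shift_map"
proof -
  have MX: "\<mu> \<in> MX" and inv: "distr \<mu> \<mu> shift_map = \<mu>" using assms by (auto simp: MX_inv_def)
  have s: "sets \<mu> = sets BX" by (rule sets_MX[OF MX])
  have "prob_space \<mu>" using MX by (simp add: MX_def)
  moreover have "shift_map \<in> \<mu> \<rightarrow>\<^sub>M \<mu>"
    using shift_measurable1 measurable_cong_sets[OF s s] by simp
  ultimately show ?thesis using inv by (simp add: mp_system_def mp_system_axioms_def)
qed

lemma label_approx:
  assumes \<mu>: "\<mu> \<in> MX_inv" and \<xi>: "\<xi> \<in> finite_partitions \<mu>" and \<delta>: "\<delta> > 0"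
  obtains N \<beta> where "measure \<mu> {x \<in> XN. \<beta> (prefix_word N x) \<noteq> part_of \<xi> x} \<le> \<delta>"
    and "{x \<in> XN. \<beta> (prefix_word N x) \<noteq> part_of \<xi> x} \<in> sets \<mu>"
proof -
  interpret mp_system \<mu> shift_map by (rule mp_system_MX_inv[OF \<mu>])
  have MX: "\<mu> \<in> MX" using \<mu> by (simp add: MX_inv_def)
  note sp = space_MX[OF MX] and st = sets_MX[OF MX]
  have fin: "finite \<xi>" and sub: "\<xi> \<subseteq> sets \<mu>" using \<xi> by (auto simp: finite_partitions_def)
  define e where "e = \<delta> / (card \<xi> + 1)"
  have e: "e > 0" using \<delta> by (simp add: e_def)
  have "\<exists>N W. measure \<mu> (A - cyl_set N W \<union> (cyl_set N W - A)) < e" if "A \<in> \<xi>" for A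
    using cyl_approx_borel[OF MX, of A] that sub e unfolding cyl_approx_def by blast
  then obtain n W where nW: "\<And>A. A \<in> \<xi> \<Longrightarrow> measure \<mu> (A - cyl_set (n A) (W A) \<union> (cyl_set (n A) (W A) - A)) < e"
    by metis
  define D where "D A = A - cyl_set (n A) (W A) \<union> (cyl_set (n A) (W A) - A)" for A
  define N where "N = Max (insert 0 (n ` \<xi>))"
  have N: "n A \<le> N" if "A \<in> \<xi>" for A using fin that by (auto simp: N_def intro!: Max_ge)
  define \<beta> where "\<beta> w = (SOME A. A \<in> \<xi> \<and> take (n A) w \<in> W A)" for w
  let ?E = "{x \<in> XN. \<beta> (prefix_word N x) \<noteq> part_of \<xi> x}"
  have Esub: "?E \<subseteq> (\<Union>A\<in>\<xi>. D A)"
  proof (rule ccontr)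
    assume "\<not> ?E \<subseteq> (\<Union>A\<in>\<xi>. D A)"
    then obtain x where x: "x \<in> XN" "\<beta> (prefix_word N x) \<noteq> part_of \<xi> x" "\<And>A. A \<in> \<xi> \<Longrightarrow> x \<notin> D A"
      by blast
    have iff: "take (n A) (prefix_word N x) \<in> W A \<longleftrightarrow> A = part_of \<xi> x" if A: "A \<in> \<xi>" for A
    proof -
      have "take (n A) (prefix_word N x) \<in> W A \<longleftrightarrow> x \<in> cyl_set (n A) (W A)"
        using x(1) by (simp add: take_prefix_word[OF N[OF A]] cyl_set_def)
      also have "\<dots> \<longleftrightarrow> x \<in> A" using x(3)[OF A] by (auto simp: D_def)
      also have "\<dots> \<longleftrightarrow> A = part_of \<xi> x"
        using part_of_eq[OF \<xi> _ A] part_of(2)[OF \<xi>] x(1) sp by auto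
      finally show ?thesis .
    qed
    have "\<beta> (prefix_word N x) = part_of \<xi> x"
      unfolding \<beta>_def by (rule some_equality) (use iff part_of(1)[OF \<xi>, of x] x(1) sp in auto)
    then show False using x(2) by simp
  qed
  have Dm: "D A \<in> sets \<mu>" if "A \<in> \<xi>" for A using sub that by (auto simp: D_def st)
  have "simple_function \<mu> (part_of \<xi>)" by (rule simple_part_of[OF \<xi>])
  then have m1: "part_of \<xi> -` {A} \<inter> XN \<in> sets \<mu>" for A
    using simple_functionD(2)[of \<mu> "part_of \<xi>" "{A}"] sp by simp
  have "?E = XN - (\<Union>A\<in>\<xi>. (part_of \<xi> -` {A} \<inter> XN) \<inter> cyl_set N (\<beta> -` {A}))"
    using part_of(1)[OF \<xi>] sp by (auto simp: cyl_set_def)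
  also have "\<dots> \<in> sets \<mu>"
  proof (intro sets.Diff sets.finite_UN fin)
    show "XN \<in> sets \<mu>" using sets.top[of \<mu>] sp by simp
    show "part_of \<xi> -` {A} \<inter> XN \<inter> cyl_set N (\<beta> -` {A}) \<in> sets \<mu>" for A
      using sets.Int[OF m1] by (simp add: st)
  qed
  finally have E: "?E \<in> sets \<mu>" .
  have "measure \<mu> ?E \<le> measure \<mu> (\<Union>A\<in>\<xi>. D A)"
    using Dm fin by (intro finite_measure_mono Esub) auto
  also have "\<dots> \<le> (\<Sum>A\<in>\<xi>. measure \<mu> (D A))"
    using Dm fin by (intro finite_measure_subadditive_finite) auto
  also have "\<dots> \<le> (\<Sum>A\<in>\<xi>. e)"
    by (intro sum_mono) (use nW in \<open>auto simp: D_def intro: less_imp_le\<close>)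
  also have "\<dots> \<le> \<delta>" using \<delta> by (simp add: e_def field_simps)
  finally show thesis using that E by blast
qed

text \<open>For integrable functions the extended integral is the Bochner integral.\<close>

lemma ext_integral_eq:
  assumes "integrable \<mu> f"
  shows "ext_integral \<mu> f = ereal (\<integral>x. f x \<partial>\<mu>)"
proof -
  have "(\<integral>\<^sup>+x. ennreal (f x) \<partial>\<mu>) \<noteq> \<infinity>" "(\<integral>\<^sup>+x. ennreal (- f x) \<partial>\<mu>) \<noteq> \<infinity>"
    using assms by (auto simp: real_integrable_def)
  then obtain r s where r: "(\<integral>\<^sup>+x. ennreal (f x) \<partial>\<mu>) = ennreal r" "r \<ge> 0"
    and s: "(\<integral>\<^sup>+x. ennreal (- f x) \<partial>\<mu>) = ennreal s" "s \<ge> 0"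
    by (cases "(\<integral>\<^sup>+x. ennreal (f x) \<partial>\<mu>)"; cases "(\<integral>\<^sup>+x. ennreal (- f x) \<partial>\<mu>)") auto
  show ?thesis
    unfolding ext_integral_def real_lebesgue_integral_def[OF assms] r(1) s(1) using r(2) s(2) by simp
qed

context finite_pressure
begin

lemma phi_bounded_above: obtains B where "\<And>x. x \<in> XN \<Longrightarrow> \<phi> x \<le> B"
proof -
  have "\<phi> x \<le> log_cyl_sum 1" if x: "x \<in> XN" for x
  proof -
    have "ennreal (exp (birkhoff 1 \<phi> x)) \<le> cyl_weight \<phi> (prefix_word 1 x)" by (rule exp_le_cyl_weight[OF x])
    also have "\<dots> \<le> cyl_sum \<phi> 1" using sum_le_cyl_sum[of "{prefix_word 1 x}" 1 \<phi>] prefix_word_words[OF x] by simp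
    finally show ?thesis by (simp add: cyl_sum_exp birkhoff_def One_nat_def)
  qed
  then show thesis by (rule that)
qed

text \<open>A potential of finite pressure is bounded above, so only its negative part could be non-integrable.\<close>

lemma phi_integrable:
  assumes \<mu>: "\<mu> \<in> MX_phi \<phi>"
  shows "integrable \<mu> \<phi>" and "ext_integral \<mu> \<phi> = ereal (\<integral>x. \<phi> x \<partial>\<mu>)"
proof -
  have MX: "\<mu> \<in> MX" using \<mu> by (auto simp: MX_phi_def MX_inv_def)
  interpret prob_space \<mu> using MX by (simp add: MX_def)
  obtain B where B: "\<And>x. x \<in> XN \<Longrightarrow> \<phi> x \<le> B" using phi_bounded_above by blast
  have meas: "\<phi> \<in> borel_measurable \<mu>"
    using tame_measurable[OF tame] measurable_cong_sets[OF sets_MX[OF MX] refl] by blast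
  have "(\<integral>\<^sup>+x. ennreal (\<phi> x) \<partial>\<mu>) \<le> (\<integral>\<^sup>+x. ennreal B \<partial>\<mu>)"
    using B by (intro nn_integral_mono ennreal_leI) (auto simp: space_MX[OF MX])
  also have "\<dots> < \<infinity>" by (simp add: emeasure_space_1)
  finally have pos: "(\<integral>\<^sup>+x. ennreal (\<phi> x) \<partial>\<mu>) < \<infinity>" .
  have neg: "(\<integral>\<^sup>+x. ennreal (- \<phi> x) \<partial>\<mu>) < \<infinity>"
  proof (rule ccontr)
    assume "\<not> ?thesis"
    then have "(\<integral>\<^sup>+x. ennreal (- \<phi> x) \<partial>\<mu>) = \<top>" by (simp add: less_top[symmetric])
    moreover obtain r where "(\<integral>\<^sup>+x. ennreal (\<phi> x) \<partial>\<mu>) = ennreal r" "r \<ge> 0"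
      using pos by (cases "(\<integral>\<^sup>+x. ennreal (\<phi> x) \<partial>\<mu>)") auto
    ultimately have "ext_integral \<mu> \<phi> = -\<infinity>" by (simp add: ext_integral_def)
    then show False using \<mu> by (simp add: MX_phi_def)
  qed
  show i: "integrable \<mu> \<phi>" using meas pos neg by (simp add: real_integrable_def less_top)
  show "ext_integral \<mu> \<phi> = ereal (\<integral>x. \<phi> x \<partial>\<mu>)" by (rule ext_integral_eq[OF i])
qed

text \<open>Gibbs' inequality for the following law \<open>q\<close> of label words: choose a periodic point of period
  \<open>n + N\<close> according to its weight, read off the approximate labels \<open>\<beta>\<close> along its orbit, and add noise.
  The point \<open>x\<close> shares \<open>n + N\<close> coordinates with a periodic point, hence all \<open>n\<close> approximate labels;
  each correct label costs \<open>- ln (1 - \<epsilon>)\<close> and each wrong one at most \<open>ln (card \<xi> / \<epsilon>)\<close>. Using periodic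
  points of weight \<open>exp (birkhoff \<phi>)\<close> makes \<open>- \<integral>\<phi>\<close> appear in the bound.\<close>

lemma itinerary_entropy_le:
  assumes \<mu>: "\<mu> \<in> MX_inv" and int: "integrable \<mu> \<phi>" and \<xi>: "\<xi> \<in> finite_partitions \<mu>"
    and \<epsilon>: "0 < \<epsilon>" "\<epsilon> < 1" and n: "n > 0"
    and E: "{x \<in> XN. \<beta> (prefix_word N x) \<noteq> part_of \<xi> x} \<in> sets \<mu>"
    and dist: "\<And>x y. x \<in> XN \<Longrightarrow> y \<in> XN \<Longrightarrow> agree (n + N) x y \<Longrightarrow> birkhoff (n + N) \<phi> x \<le> birkhoff (n + N) \<phi> y + d"
  shows "fun_entropy \<mu> (itinerary shift_map (part_of \<xi>) n) \<le>
    log_cyl_sum (n + N) - real (n + N) * (\<integral>x. \<phi> x \<partial>\<mu>) + d +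
    real n * (- ln (1 - \<epsilon>) + ln (card \<xi> / \<epsilon>) * measure \<mu> {x \<in> XN. \<beta> (prefix_word N x) \<noteq> part_of \<xi> x})"
proof -
  interpret mp_system \<mu> shift_map by (rule mp_system_MX_inv[OF \<mu>])
  have MX: "\<mu> \<in> MX" using \<mu> by (simp add: MX_inv_def)
  note sp = space_MX[OF MX] and st = sets_MX[OF MX]
  have fin: "finite \<xi>" using \<xi> by (auto simp: finite_partitions_def)
  let ?g = "part_of \<xi>" and ?S = "\<lambda>k. shift_map ^^ k" and ?n = "n + N"
  let ?E = "{x \<in> XN. \<beta> (prefix_word N x) \<noteq> ?g x}"
  have "?g (\<lambda>_. 1) \<in> \<xi>" using part_of(1)[OF \<xi>] sp const1_XN by simp
  then have ne: "\<xi> \<noteq> {}" and c1: "card \<xi> \<ge> 1" using fin by (auto simp: Suc_le_eq card_gt_0_iff One_nat_def)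
  define q where "q = bind_pmf (per_pmf ?n) (\<lambda>y. noisy_word \<epsilon> \<xi> (map (\<lambda>i. \<beta> (prefix_word N (?S i y))) [0..<n]))"
  define a where "a = - ln (1 - \<epsilon>)"
  define b where "b = ln (card \<xi> / \<epsilon>)"
  have a: "a \<ge> 0" using \<epsilon> by (simp add: a_def)
  have b: "b \<ge> 0" using \<epsilon> c1 unfolding b_def by (intro ln_ge_zero) (simp add: field_simps)
  define G where "G x = (log_cyl_sum ?n - birkhoff ?n \<phi> x + d) + (\<Sum>i<n. a + b * indicator ?E (?S i x))" for x
  have lnq: "ln (exp B / Z * P) = B - ln Z + ln P" if "Z > 0" "P > 0" for B Z P :: real
    using that by (simp add: ln_mult ln_div)
  have key: "0 < pmf q (itinerary shift_map ?g n x) \<and> - ln (pmf q (itinerary shift_map ?g n x)) \<le> G x"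
    if x: "x \<in> space \<mu>" for x
  proof -
    have x: "x \<in> XN" using x sp by simp
    obtain y where y: "y \<in> EN ?n" "agree ?n x y" using EN_agree[OF x, of ?n] n by auto
    let ?I = "itinerary shift_map ?g n x"
    let ?P = "\<Prod>i<n. if ?I ! i = \<beta> (prefix_word N (?S i y)) then 1 - \<epsilon> else \<epsilon> / card \<xi>"
    have pf: "(if ?I ! i = \<beta> (prefix_word N (?S i y)) then 1 - \<epsilon> else \<epsilon> / card \<xi>) > 0" for i
      using \<epsilon> c1 by auto
    have Ppos: "?P > 0" by (intro prod_pos ballI pf)
    have sI: "set ?I \<subseteq> \<xi>"
      using part_of(1)[OF \<xi>] shift_pow_XN[OF x] sp by (auto simp: itinerary_def)
    have perpos: "pmf (per_pmf ?n) y = exp (birkhoff ?n \<phi> y) / ZN ?n \<phi>" using n y by (simp add: pmf_per)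
    have Zpos: "ZN ?n \<phi> > 0" using n by (intro ZN_pos) simp
    have "pmf (per_pmf ?n) y * ?P \<le>
        pmf (per_pmf ?n) y * pmf (noisy_word \<epsilon> \<xi> (map (\<lambda>i. \<beta> (prefix_word N (?S i y))) [0..<n])) ?I"
      using pmf_noisy_word[OF \<epsilon> fin ne _ sI, of "map (\<lambda>i. \<beta> (prefix_word N (?S i y))) [0..<n]"]
      by (intro mult_left_mono) auto
    also have "\<dots> \<le> pmf q ?I" unfolding q_def by (rule pmf_bind_ge)
    finally have ge: "exp (birkhoff ?n \<phi> y) / ZN ?n \<phi> * ?P \<le> pmf q ?I" by (simp only: perpos)
    have lpos: "0 < exp (birkhoff ?n \<phi> y) / ZN ?n \<phi> * ?P" using Ppos Zpos by simp
    then have qpos: "0 < pmf q ?I" using ge by linarith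
    have "ln (exp (birkhoff ?n \<phi> y) / ZN ?n \<phi> * ?P) \<le> ln (pmf q ?I)"
      using ge lpos qpos by (subst ln_le_cancel_iff)
    then have 1: "- ln (pmf q ?I) \<le> ln (ZN ?n \<phi>) - birkhoff ?n \<phi> y - ln ?P"
      unfolding lnq[OF Zpos Ppos] by simp
    have lnP: "ln ?P = (\<Sum>i<n. ln (if ?I ! i = \<beta> (prefix_word N (?S i y)) then 1 - \<epsilon> else \<epsilon> / card \<xi>))"
      by (rule ln_prod[OF finite_lessThan less_imp_neq[OF pf, symmetric]])
    have 2: "- ln ?P \<le> (\<Sum>i<n. a + b * indicator ?E (?S i x))"
      unfolding lnP sum_negf[symmetric]
    proof (rule sum_mono)
      fix i assume i: "i \<in> {..<n}"
      have ag: "prefix_word N (?S i y) = prefix_word N (?S i x)"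
        using y(2) i by (auto simp: prefix_word_def shift_pow agree_def)
      have mem: "?S i x \<in> ?E \<longleftrightarrow> ?I ! i \<noteq> \<beta> (prefix_word N (?S i y))"
        using i shift_pow_XN[OF x] by (auto simp: ag)
      show "- ln (if ?I ! i = \<beta> (prefix_word N (?S i y)) then 1 - \<epsilon> else \<epsilon> / card \<xi>) \<le> a + b * indicator ?E (?S i x)"
      proof (cases "?S i x \<in> ?E")
        case True
        then have c: "\<not> ?I ! i = \<beta> (prefix_word N (?S i y))" using mem by blast
        have "- ln (\<epsilon> / card \<xi>) = b" using \<epsilon> c1 by (simp add: b_def ln_div)
        then show ?thesis unfolding if_not_P[OF c] indicator_simps(1)[OF True] using a by simp
      next
        case False
        then have c: "?I ! i = \<beta> (prefix_word N (?S i y))" using mem by blast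
        show ?thesis unfolding if_P[OF c] indicator_simps(2)[OF False] by (simp add: a_def)
      qed
    qed
    have 3: "birkhoff ?n \<phi> x \<le> birkhoff ?n \<phi> y + d"
      by (rule dist[OF x EN_XN[OF y(1)] y(2)])
    have 4: "ln (ZN ?n \<phi>) \<le> log_cyl_sum ?n" using n by (intro ln_ZN_le) simp
    have "- ln (pmf q ?I) \<le> G x" unfolding G_def using 1 2 3 4 by linarith
    with qpos show ?thesis by (rule conjI)
  qed
  have iS: "integrable \<mu> (\<lambda>x. \<phi> (?S k x))" for k by (rule integrable_pow[OF int])
  have iE: "integrable \<mu> (indicat_real ?E)" using E by (simp add: emeasure_eq_measure)
  have iES: "integrable \<mu> (\<lambda>x. indicat_real ?E (?S k x))" for k by (rule integrable_pow[OF iE])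
  have iB: "integrable \<mu> (birkhoff ?n \<phi>)" unfolding birkhoff_def by (intro Bochner_Integration.integrable_sum iS)
  have iT: "integrable \<mu> (\<lambda>x. \<Sum>i<n. a + b * indicat_real ?E (?S i x))"
    by (intro Bochner_Integration.integrable_sum Bochner_Integration.integrable_add integrable_mult_right iES) simp
  have iG: "integrable \<mu> G" unfolding G_def
    by (intro Bochner_Integration.integrable_add Bochner_Integration.integrable_diff iT iB) simp_all
  have "fun_entropy \<mu> (itinerary shift_map ?g n) \<le> (\<integral>x. G x \<partial>\<mu>)"
    by (rule gibbs_pmf[OF simple_itinerary[OF simple_part_of[OF \<xi>]] key iG])
  also have "(\<integral>x. G x \<partial>\<mu>) = (log_cyl_sum ?n - (\<integral>x. birkhoff ?n \<phi> x \<partial>\<mu>) + d) + (\<integral>x. (\<Sum>i<n. a + b * indicat_real ?E (?S i x)) \<partial>\<mu>)"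
    unfolding G_def using iT iB by (simp add: prob_space)
  also have "(\<integral>x. birkhoff ?n \<phi> x \<partial>\<mu>) = real ?n * (\<integral>x. \<phi> x \<partial>\<mu>)"
    unfolding birkhoff_def using integral_pow[OF borel_measurable_integrable[OF int]]
    by (subst Bochner_Integration.integral_sum) (simp_all add: iS)
  also have "(\<integral>x. (\<Sum>i<n. a + b * indicat_real ?E (?S i x)) \<partial>\<mu>) = real n * (a + b * measure \<mu> ?E)"
  proof -
    have "(\<integral>x. indicat_real ?E (?S i x) \<partial>\<mu>) = measure \<mu> ?E" for i
      using integral_pow[OF borel_measurable_integrable[OF iE], of i] E sets.sets_into_space[OF E] by (simp add: Int_absorb2)
    then have "(\<integral>x. a + b * indicat_real ?E (?S i x) \<partial>\<mu>) = a + b * measure \<mu> ?E" for i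
      using iES[of i] by (simp add: prob_space)
    then show ?thesis
      by (subst Bochner_Integration.integral_sum) (simp_all add: iES)
  qed
  finally show ?thesis by (simp add: a_def b_def)
qed

text \<open>The noise level is fixed first; then the labels are approximated so well that the wrong ones,
  though expensive, are too rare to matter.\<close>

lemma variational_inequality:
  assumes "\<mu> \<in> MX_inv" "integrable \<mu> \<phi>" "\<xi> \<in> finite_partitions \<mu>"
  shows "lim (\<lambda>n. partition_entropy \<mu> (iterated_join \<mu> shift_map \<xi> n) / real n) \<le> press - (\<integral>x. \<phi> x \<partial>\<mu>)" (is "?L \<le> _")
proof (rule field_le_epsilon)
  fix \<eta>0 :: real assume "\<eta>0 > 0"
  define \<eta> where "\<eta> = \<eta>0 / 3"
  have \<eta>: "\<eta> > 0" using \<open>\<eta>0 > 0\<close> by (simp add: \<eta>_def)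
  interpret mp_system \<mu> shift_map by (rule mp_system_MX_inv[OF assms(1)])
  define \<epsilon> where "\<epsilon> = 1 - exp (- \<eta>)"
  have \<epsilon>: "0 < \<epsilon>" "\<epsilon> < 1" "- ln (1 - \<epsilon>) = \<eta>" using \<eta> by (auto simp: \<epsilon>_def)
  define b where "b = \<bar>ln (card \<xi> / \<epsilon>)\<bar> + 1"
  have b: "b > 0" "ln (card \<xi> / \<epsilon>) \<le> b" by (auto simp: b_def)
  obtain N \<beta> where N: "measure \<mu> {x \<in> XN. \<beta> (prefix_word N x) \<noteq> part_of \<xi> x} \<le> \<eta> / b"
      "{x \<in> XN. \<beta> (prefix_word N x) \<noteq> part_of \<xi> x} \<in> sets \<mu>"
    by (rule label_approx[OF assms(1,3) divide_pos_pos[OF \<eta> b(1)]]) (rule that)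
  obtain C where C: "C \<ge> 0" "\<And>n x y. x \<in> XN \<Longrightarrow> y \<in> XN \<Longrightarrow> agree n x y \<Longrightarrow>
     \<bar>birkhoff n \<phi> x - birkhoff n \<phi> y\<bar> \<le> real n * \<eta> + C"
    by (rule distortion[OF tame \<eta>]) (rule that)
  let ?I = "\<integral>x. \<phi> x \<partial>\<mu>"
  let ?E = "{x \<in> XN. \<beta> (prefix_word N x) \<noteq> part_of \<xi> x}"
  let ?B = "\<lambda>n. log_cyl_sum (n + N) / real n - real (n + N) / real n * ?I + real (n + N) / real n * \<eta> + C / real n + 2 * \<eta>"
  have bd: "?L \<le> ?B n" if n: "n > 0" for n
  proof -
    have "ln (card \<xi> / \<epsilon>) * measure \<mu> ?E \<le> b * (\<eta> / b)"
      using b N(1) by (intro mult_mono) auto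
    then have m: "ln (card \<xi> / \<epsilon>) * measure \<mu> ?E \<le> \<eta>" using b by simp
    have "fun_entropy \<mu> (itinerary shift_map (part_of \<xi>) n) \<le>
      log_cyl_sum (n + N) - real (n + N) * ?I + (real (n + N) * \<eta> + C) + real n * (- ln (1 - \<epsilon>) + ln (card \<xi> / \<epsilon>) * measure \<mu> ?E)"
    proof (rule itinerary_entropy_le[OF assms \<epsilon>(1,2) n N(2)])
      fix x y assume "x \<in> XN" "y \<in> XN" "agree (n + N) x y"
      from C(2)[OF this] show "birkhoff (n + N) \<phi> x \<le> birkhoff (n + N) \<phi> y + (real (n + N) * \<eta> + C)"
        by linarith
    qed
    also have "\<dots> \<le> log_cyl_sum (n + N) - real (n + N) * ?I + (real (n + N) * \<eta> + C) + real n * (2 * \<eta>)"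
      using m \<epsilon>(3) by (intro add_left_mono mult_left_mono) auto
    finally have "fun_entropy \<mu> (itinerary shift_map (part_of \<xi>) n) / real n \<le>
        (log_cyl_sum (n + N) - real (n + N) * ?I + (real (n + N) * \<eta> + C) + real n * (2 * \<eta>)) / real n"
      by (rule divide_right_mono) simp
    also have "\<dots> = ?B n" using n by (simp only: add_divide_distrib diff_divide_distrib times_divide_eq_left nonzero_mult_div_cancel_left)
    finally show ?thesis using entropy_rate(2)[OF assms(3) n] by linarith
  qed
  have r: "(\<lambda>n. real (n + N) / real n) \<longlonglongrightarrow> 1"
  proof -
    have "(\<lambda>n. 1 + real N / real n) \<longlonglongrightarrow> 1 + 0" by (intro tendsto_intros lim_const_over_n)
    then show ?thesis
      by (simp, elim Lim_transform_eventually) (auto simp: field_simps intro!: eventually_mono[OF eventually_gt_at_top[of 0]])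
  qed
  have "(\<lambda>n. log_cyl_sum (n + N) / real (n + N) * (real (n + N) / real n)) \<longlonglongrightarrow> press * 1"
    using LIMSEQ_ignore_initial_segment[OF log_cyl_sum_tendsto, of N] by (intro tendsto_mult r) simp
  then have l: "(\<lambda>n. log_cyl_sum (n + N) / real n) \<longlonglongrightarrow> press"
    by (simp, elim Lim_transform_eventually) (auto intro!: eventually_mono[OF eventually_gt_at_top[of 0]])
  have "?B \<longlonglongrightarrow> press - 1 * ?I + 1 * \<eta> + 0 + 2 * \<eta>"
    by (intro tendsto_intros l r lim_const_over_n)
  then have "?L \<le> press - 1 * ?I + 1 * \<eta> + 0 + 2 * \<eta>"
    by (rule LIMSEQ_le_const) (use bd in \<open>auto intro!: exI[of _ 1]\<close>)
  then show "?L \<le> press - ?I + \<eta>0" by (simp add: \<eta>_def)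
qed

lemma free_energy_le_0: "free_energy \<phi> \<mu> \<le> 0"
proof (cases "\<mu> \<in> MX_phi \<phi>")
  case True
  then have inv: "\<mu> \<in> MX_inv" by (simp add: MX_phi_def)
  note i = phi_integrable[OF True]
  have "ks_entropy \<mu> shift_map \<le> ereal (press - (\<integral>x. \<phi> x \<partial>\<mu>))"
    unfolding ks_entropy_def by (rule SUP_least) (simp add: variational_inequality[OF inv i(1)])
  then have "ks_entropy \<mu> shift_map + ereal (\<integral>x. \<phi> x \<partial>\<mu>) - ereal press \<le>
      ereal (press - (\<integral>x. \<phi> x \<partial>\<mu>)) + ereal (\<integral>x. \<phi> x \<partial>\<mu>) - ereal press"
    by (intro ereal_minus_mono add_right_mono) auto
  then show ?thesis using True by (simp add: free_energy_def i(2) pressure_eq)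
qed (simp add: free_energy_def)

end

section \<open>Block Bernoulli measures\<close>

lemma (in prob_space) AE_fiber_prob_pos:
  assumes f: "simple_function M f"
  shows "AE x in M. 0 < fiber_prob M f (f x)"
proof -
  have "AE x in M. \<forall>b\<in>f ` space M. fiber_prob M f b = 0 \<longrightarrow> f x \<noteq> b"
  proof (rule AE_finite_allI)
    show "finite (f ` space M)" by (rule simple_functionD[OF f])
    fix b assume "b \<in> f ` space M"
    show "AE x in M. fiber_prob M f b = 0 \<longrightarrow> f x \<noteq> b"
    proof (cases "fiber_prob M f b = 0")
      case True
      then have "f -` {b} \<inter> space M \<in> null_sets M"
        using simple_functionD(2)[OF f] by (auto simp: fiber_prob_def emeasure_eq_measure null_sets_def)
      then have "AE x in M. x \<notin> f -` {b} \<inter> space M" by (rule AE_not_in)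
      then show ?thesis using AE_space by eventually_elim auto
    qed simp
  qed
  then show ?thesis using AE_space
  proof eventually_elim
    case (elim x)
    then have "fiber_prob M f (f x) \<noteq> 0" by auto
    then show ?case using fiber_prob_nonneg[of M f "f x"] by simp
  qed
qed

text \<open>The points of \<open>set_pmf p\<close> have period \<open>n\<close> and stand for their period words. Independent words with
  law \<open>p\<close> are concatenated; as block boundaries are only invariant under the \<open>n\<close>-th power of the shift, a
  uniformly distributed phase is added.\<close>

locale block_process =
  fixes n :: nat and p :: "(nat \<Rightarrow> nat) pmf"
  assumes n: "n > 0" and fin: "finite (set_pmf p)" and per: "set_pmf p \<subseteq> EN n"
begin

definition \<Omega> :: "(nat \<Rightarrow> nat \<Rightarrow> nat) measure" where
  "\<Omega> = (\<Pi>\<^sub>M i\<in>UNIV. measure_pmf p)"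

sublocale P: product_prob_space "\<lambda>_. measure_pmf p" "UNIV :: nat set"
  by unfold_locales

sublocale \<Omega>: prob_space \<Omega>
  unfolding \<Omega>_def by unfold_locales

text \<open>The maximum with 1 makes the result a point of \<open>XN\<close> for all \<open>\<omega>\<close>. It has no effect when the blocks
  come from \<open>set_pmf p\<close>, which happens almost surely.\<close>

definition paste :: "(nat \<Rightarrow> nat \<Rightarrow> nat) \<Rightarrow> nat \<Rightarrow> nat" where
  "paste \<omega> k = max 1 (\<omega> (k div n) (k mod n))"

definition blocks :: "(nat \<Rightarrow> nat \<Rightarrow> nat) \<Rightarrow> bool" where
  "blocks \<omega> \<longleftrightarrow> (\<forall>i. \<omega> i \<in> set_pmf p)"

lemma space_\<Omega>[simp]: "space \<Omega> = UNIV"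
  by (auto simp: \<Omega>_def space_PiM)

lemma block_measurable: "(\<lambda>\<omega>. g (\<omega> i)) \<in> \<Omega> \<rightarrow>\<^sub>M count_space UNIV"
proof -
  have "(\<lambda>\<omega>. \<omega> i) \<in> \<Omega> \<rightarrow>\<^sub>M measure_pmf p" unfolding \<Omega>_def by (rule measurable_component_singleton) simp
  then show ?thesis by (rule measurable_compose) simp
qed

lemma AE_blocks: "AE \<omega> in \<Omega>. blocks \<omega>"
  unfolding blocks_def AE_all_countable \<Omega>_def
  by (intro allI AE_PiM_component measure_pmf.prob_space_axioms) (auto simp: AE_measure_pmf_iff)

lemma paste_XN: "paste \<omega> \<in> XN"
  by (simp add: XN_iff paste_def)

lemma paste_measurable: "paste \<in> \<Omega> \<rightarrow>\<^sub>M BX"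
  by (rule measurable_into_BX) (auto simp: paste_def paste_XN intro: block_measurable[of "\<lambda>y. max 1 (y _)"])

definition sample :: "nat \<times> (nat \<Rightarrow> nat \<Rightarrow> nat) \<Rightarrow> nat \<Rightarrow> nat" where
  "sample = (\<lambda>(j, \<omega>). (shift_map ^^ j) (paste \<omega>))"

definition phase :: "nat pmf" where "phase = pmf_of_set {..<n}"

definition \<nu> :: "(nat \<Rightarrow> nat) measure" where
  "\<nu> = distr (measure_pmf phase \<Otimes>\<^sub>M \<Omega>) BX sample"

lemma shift_paste_measurable: "(\<lambda>\<omega>. (shift_map ^^ j) (paste \<omega>)) \<in> \<Omega> \<rightarrow>\<^sub>M BX"
  by (rule measurable_compose[OF paste_measurable shift_measurable])

lemma sample_measurable: "sample \<in> measure_pmf phase \<Otimes>\<^sub>M \<Omega> \<rightarrow>\<^sub>M BX"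
proof -
  have "sample \<in> count_space UNIV \<Otimes>\<^sub>M \<Omega> \<rightarrow>\<^sub>M BX"
    by (rule measurable_pair_measure_countable1) (auto simp: sample_def shift_paste_measurable)
  moreover have "sets (measure_pmf phase \<Otimes>\<^sub>M \<Omega>) = sets (count_space UNIV \<Otimes>\<^sub>M \<Omega>)"
    by (intro sets_pair_measure_cong) auto
  ultimately show ?thesis using measurable_cong_sets by blast
qed

sublocale Q: pair_prob_space "measure_pmf phase" \<Omega>
  by unfold_locales

lemma \<nu>_MX: "\<nu> \<in> MX"
  unfolding MX_def \<nu>_def BX_def[symmetric]
  using Q.prob_space_distr[OF sample_measurable] by simp

sublocale \<nu>: prob_space \<nu>
  using \<nu>_MX by (simp add: MX_def)

lemma sets_\<nu>: "sets \<nu> = sets BX" and space_\<nu>: "space \<nu> = XN"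
  using sets_MX[OF \<nu>_MX] space_MX[OF \<nu>_MX] by auto

lemma integral_\<nu>:
  fixes f :: "(nat \<Rightarrow> nat) \<Rightarrow> real"
  assumes f: "f \<in> borel_measurable BX"
    and B: "\<And>j \<omega>. blocks \<omega> \<Longrightarrow> \<bar>f ((shift_map ^^ j) (paste \<omega>))\<bar> \<le> B"
  shows "integrable \<nu> f" and "\<And>j. integrable \<Omega> (\<lambda>\<omega>. f ((shift_map ^^ j) (paste \<omega>)))"
    and "(\<integral>x. f x \<partial>\<nu>) = (\<Sum>j<n. \<integral>\<omega>. f ((shift_map ^^ j) (paste \<omega>)) \<partial>\<Omega>) / real n"
proof -
  have m: "(\<lambda>z. f (sample z)) \<in> borel_measurable (measure_pmf phase \<Otimes>\<^sub>M \<Omega>)"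
    by (rule measurable_compose[OF sample_measurable f])
  have ae: "AE z in measure_pmf phase \<Otimes>\<^sub>M \<Omega>. norm (f (sample z)) \<le> B"
  proof (rule Q.AE_pair_measure)
    show "{z \<in> space (measure_pmf phase \<Otimes>\<^sub>M \<Omega>). norm (f (sample z)) \<le> B} \<in> sets (measure_pmf phase \<Otimes>\<^sub>M \<Omega>)"
      using m by measurable
    have "AE \<omega> in \<Omega>. norm (f (sample (j, \<omega>))) \<le> B" for j
      using AE_blocks by eventually_elim (simp add: sample_def B)
    then show "AE x in measure_pmf phase. AE y in \<Omega>. norm (f (sample (x, y))) \<le> B" by simp
  qed
  have i: "integrable (measure_pmf phase \<Otimes>\<^sub>M \<Omega>) (\<lambda>z. f (sample z))"
    by (rule Q.integrable_const_bound[OF ae m])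
  then show "integrable \<nu> f"
    unfolding \<nu>_def using f by (subst integrable_distr_eq[OF sample_measurable])
  show "integrable \<Omega> (\<lambda>\<omega>. f ((shift_map ^^ j) (paste \<omega>)))" for j
    using AE_blocks B
    by (intro \<Omega>.integrable_const_bound[where B=B] measurable_compose[OF shift_paste_measurable f]) auto
  have "(\<integral>x. f x \<partial>\<nu>) = (\<integral>z. f (sample z) \<partial>(measure_pmf phase \<Otimes>\<^sub>M \<Omega>))"
    unfolding \<nu>_def by (rule integral_distr[OF sample_measurable f])
  also have "\<dots> = (\<integral>j. (\<integral>\<omega>. f (sample (j, \<omega>)) \<partial>\<Omega>) \<partial>measure_pmf phase)"
    by (rule Q.integral_fst'[OF i, symmetric])
  also have "\<dots> = (\<Sum>j<n. \<integral>\<omega>. f ((shift_map ^^ j) (paste \<omega>)) \<partial>\<Omega>) / real n"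
    unfolding phase_def using n by (subst integral_pmf_of_set) (auto simp: sample_def)
  finally show "(\<integral>x. f x \<partial>\<nu>) = (\<Sum>j<n. \<integral>\<omega>. f ((shift_map ^^ j) (paste \<omega>)) \<partial>\<Omega>) / real n" .
qed

lemma distr_\<Omega>_Suc: "distr \<Omega> \<Omega> (\<lambda>\<omega> i. \<omega> (Suc i)) = \<Omega>"
  using distr_PiM_reindex[where K = UNIV and I = UNIV and f = Suc and M = "\<lambda>_. measure_pmf p", OF measure_pmf.prob_space_axioms]
  by (simp add: \<Omega>_def restrict_def)

lemma shift_Suc_measurable: "(\<lambda>\<omega> i. \<omega> (Suc i)) \<in> \<Omega> \<rightarrow>\<^sub>M \<Omega>"
  unfolding \<Omega>_def by (rule measurable_PiM_single') (auto intro: measurable_component_singleton)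

lemma shift_paste_n: "(shift_map ^^ n) (paste \<omega>) = paste (\<lambda>i. \<omega> (Suc i))"
  using n by (intro ext) (simp add: shift_pow paste_def Suc_eq_plus1)

lemma \<nu>_inv: "\<nu> \<in> MX_inv"
proof -
  have "distr \<nu> \<nu> shift_map = \<nu>"
  proof (rule measure_eqI)
    fix A assume "A \<in> sets (distr \<nu> \<nu> shift_map)"
    then have A[measurable]: "A \<in> sets BX" by (simp add: sets_\<nu>)
    define f where "f = indicat_real A"
    have f: "f \<in> borel_measurable BX" by (simp add: f_def)
    have fs: "(\<lambda>x. f (shift_map x)) \<in> borel_measurable BX" by (rule measurable_compose[OF shift_measurable1 f])
    have sm: "shift_map \<in> \<nu> \<rightarrow>\<^sub>M \<nu>"
      using shift_measurable1 measurable_cong_sets[OF sets_\<nu> sets_\<nu>] by simp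
    let ?a = "\<lambda>j. \<integral>\<omega>. f ((shift_map ^^ j) (paste \<omega>)) \<partial>\<Omega>"
    have "?a n = (\<integral>\<omega>. f (paste (\<lambda>i. \<omega> (Suc i))) \<partial>\<Omega>)" by (simp add: shift_paste_n)
    also have "\<dots> = (\<integral>\<omega>. f (paste \<omega>) \<partial>distr \<Omega> \<Omega> (\<lambda>\<omega> i. \<omega> (Suc i)))"
      by (rule integral_distr[symmetric, OF shift_Suc_measurable measurable_compose[OF paste_measurable f]])
    also have "\<dots> = ?a 0" by (simp add: distr_\<Omega>_Suc)
    finally have a: "?a n = ?a 0" .
    have "measure (distr \<nu> \<nu> shift_map) A = (\<integral>x. f x \<partial>distr \<nu> \<nu> shift_map)"
      using A sets.sets_into_space[OF A] by (simp add: f_def sets_\<nu> space_\<nu> Int_absorb2)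
    also have "\<dots> = (\<integral>x. f (shift_map x) \<partial>\<nu>)"
      using f by (intro integral_distr sm) (simp add: measurable_cong_sets[OF sets_\<nu> refl])
    also have "\<dots> = (\<Sum>j<n. \<integral>\<omega>. f (shift_map ((shift_map ^^ j) (paste \<omega>))) \<partial>\<Omega>) / real n"
      by (rule integral_\<nu>(3)[OF fs, of 1]) (auto simp: f_def indicator_def)
    also have "\<dots> = (\<Sum>j<n. ?a (Suc j)) / real n" by simp
    also have "(\<Sum>j<n. ?a (Suc j)) = (\<Sum>j<n. ?a j)"
      using sum.lessThan_Suc_shift[of ?a n] sum.lessThan_Suc[of ?a n] a by simp
    also have "(\<Sum>j<n. ?a j) / real n = (\<integral>x. f x \<partial>\<nu>)"
      by (rule integral_\<nu>(3)[OF f, of 1, symmetric]) (auto simp: f_def indicator_def)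
    also have "\<dots> = measure \<nu> A"
      using A sets.sets_into_space[OF A] by (simp add: f_def sets_\<nu> space_\<nu> Int_absorb2)
    finally have "measure (distr \<nu> \<nu> shift_map) A = measure \<nu> A" .
    moreover have "prob_space (distr \<nu> \<nu> shift_map)" by (rule \<nu>.prob_space_distr[OF sm])
    ultimately show "emeasure (distr \<nu> \<nu> shift_map) A = emeasure \<nu> A"
      by (simp add: \<nu>.emeasure_eq_measure finite_measure.emeasure_eq_measure prob_space.finite_measure)
  qed simp
  then show ?thesis using \<nu>_MX by (simp add: MX_inv_def)
qed

lemma paste_eq:
  assumes "blocks \<omega>"
  shows "paste \<omega> k = \<omega> (k div n) (k mod n)"
proof -
  have "\<omega> (k div n) \<in> XN" using assms per EN_XN[of _ n] by (auto simp: blocks_def)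
  then show ?thesis by (simp add: paste_def XN_iff max_absorb2)
qed

lemma paste_agree: "blocks \<omega> \<Longrightarrow> agree n (paste \<omega>) (\<omega> 0)"
  by (simp add: agree_def paste_eq)

lemma expectation_block:
  fixes g :: "(nat \<Rightarrow> nat) \<Rightarrow> real"
  shows "(\<integral>\<omega>. g (\<omega> i) \<partial>\<Omega>) = measure_pmf.expectation p g" and "integrable \<Omega> (\<lambda>\<omega>. g (\<omega> i))"
proof -
  have m: "(\<lambda>\<omega>. \<omega> i) \<in> \<Omega> \<rightarrow>\<^sub>M measure_pmf p" unfolding \<Omega>_def by (rule measurable_component_singleton) simp
  have d: "distr \<Omega> (measure_pmf p) (\<lambda>\<omega>. \<omega> i) = measure_pmf p"
    unfolding \<Omega>_def by (rule distr_PiM_component) (auto intro: measure_pmf.prob_space_axioms)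
  show "(\<integral>\<omega>. g (\<omega> i) \<partial>\<Omega>) = measure_pmf.expectation p g"
    using integral_distr[OF m, of g] by (simp add: d)
  show "integrable \<Omega> (\<lambda>\<omega>. g (\<omega> i))"
    using integrable_distr_eq[OF m, of g] integrable_measure_pmf_finite[OF fin, of g] by (simp add: d)
qed

lemma integral_\<nu>_ge:
  assumes f: "f \<in> borel_measurable BX"
    and B: "\<And>j \<omega>. blocks \<omega> \<Longrightarrow> \<bar>f ((shift_map ^^ j) (paste \<omega>))\<bar> \<le> B"
    and l: "\<And>x y. x \<in> XN \<Longrightarrow> y \<in> set_pmf p \<Longrightarrow> agree n x y \<Longrightarrow> l y \<le> birkhoff n f x"
  shows "measure_pmf.expectation p l \<le> real n * (\<integral>x. f x \<partial>\<nu>)"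
proof -
  have "measure_pmf.expectation p l = (\<integral>\<omega>. l (\<omega> 0) \<partial>\<Omega>)" by (rule expectation_block(1)[symmetric])
  also have "\<dots> \<le> (\<integral>\<omega>. birkhoff n f (paste \<omega>) \<partial>\<Omega>)"
  proof (rule integral_mono_AE)
    show "integrable \<Omega> (\<lambda>\<omega>. birkhoff n f (paste \<omega>))"
      unfolding birkhoff_def by (intro Bochner_Integration.integrable_sum integral_\<nu>(2)[OF f B])
    show "AE \<omega> in \<Omega>. l (\<omega> 0) \<le> birkhoff n f (paste \<omega>)"
      using AE_blocks
    proof eventually_elim
      case (elim \<omega>)
      then show ?case by (intro l paste_XN paste_agree) (auto simp: blocks_def)
    qed
  qed (rule expectation_block)
  also have "\<dots> = (\<Sum>j<n. \<integral>\<omega>. f ((shift_map ^^ j) (paste \<omega>)) \<partial>\<Omega>)"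
    unfolding birkhoff_def by (intro Bochner_Integration.integral_sum integral_\<nu>(2)[OF f B])
  also have "\<dots> = real n * (\<integral>x. f x \<partial>\<nu>)"
    using integral_\<nu>(3)[OF f B] n by simp
  finally show ?thesis .
qed

definition letter_bound :: nat where
  "letter_bound = Max ((\<lambda>(y, k). y k) ` (set_pmf p \<times> {..<n}))"

lemma letter_bound: "y \<in> set_pmf p \<Longrightarrow> k < n \<Longrightarrow> y k \<le> letter_bound"
  unfolding letter_bound_def using fin by (intro Max_ge) force+

lemma paste_le: "blocks \<omega> \<Longrightarrow> paste \<omega> k \<le> letter_bound"
  using letter_bound[of "\<omega> (k div n)" "k mod n"] n by (simp add: paste_eq blocks_def)

text \<open>Only letters up to the bound occur almost surely, so the finite partition by this capped first letter
  generates as much entropy as the letters themselves.\<close>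

definition capped :: "(nat \<Rightarrow> nat) \<Rightarrow> nat" where "capped x = min (x 0) (Suc letter_bound)"

definition \<xi> :: "(nat \<Rightarrow> nat) set set" where
  "\<xi> = (\<lambda>l. {x \<in> XN. capped x = l}) ` {1..Suc letter_bound}"

lemma capped_in: "x \<in> XN \<Longrightarrow> capped x \<in> {1..Suc letter_bound}"
  by (auto simp: capped_def XN_iff One_nat_def Suc_le_eq)

lemma \<xi>: "\<xi> \<in> finite_partitions \<nu>"
  unfolding finite_partitions_def mem_Collect_eq
proof (intro conjI)
  show "finite \<xi>" by (simp add: \<xi>_def)
  have "capped \<in> BX \<rightarrow>\<^sub>M count_space UNIV"
    unfolding capped_def by (rule measurable_compose[OF coord_measurable]) simp
  from measurable_sets[OF this] have "capped -` {l} \<inter> space BX \<in> sets BX" for l by simp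
  moreover have "capped -` {l} \<inter> space BX = {x \<in> XN. capped x = l}" for l by auto
  ultimately have "{x \<in> XN. capped x = l} \<in> sets BX" for l by metis
  then show "\<xi> \<subseteq> sets \<nu>" by (auto simp: \<xi>_def sets_\<nu>)
  show "partition_on (space \<nu>) \<xi>"
  proof (rule partition_onI)
    show "\<Union>\<xi> = space \<nu>" using capped_in by (auto simp: \<xi>_def space_\<nu>)
    show "\<And>A B. A \<in> \<xi> \<Longrightarrow> B \<in> \<xi> \<Longrightarrow> A \<noteq> B \<Longrightarrow> disjnt A B" by (auto simp: \<xi>_def disjnt_def)
    have "(\<lambda>_. l) \<in> {x \<in> XN. capped x = l}" if "l \<in> {1..Suc letter_bound}" for l
      using that by (auto simp: XN_iff capped_def)
    then show "{} \<notin> \<xi>" unfolding \<xi>_def by blast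
  qed
qed

sublocale mp: mp_system \<nu> shift_map
  by (rule mp_system_MX_inv[OF \<nu>_inv])

lemma part_of_\<xi>: "x \<in> XN \<Longrightarrow> part_of \<xi> x = {z \<in> XN. capped z = capped x}"
  by (rule mp.part_of_eq[OF \<xi>]) (use capped_in in \<open>auto simp: space_\<nu> \<xi>_def\<close>)

lemma part_of_\<xi>_eq: "x \<in> XN \<Longrightarrow> y \<in> XN \<Longrightarrow> part_of \<xi> x = part_of \<xi> y \<longleftrightarrow> capped x = capped y"
  by (auto simp: part_of_\<xi>)

definition block_entropy :: real where
  "block_entropy = measure_pmf.expectation p (\<lambda>y. - ln (pmf p y))"

text \<open>A window of length \<open>m\<close> at any phase contains the complete blocks number \<open>1, \<dots>, K\<close>. Its itinerary
  determines them, so its probability is at most the product of theirs.\<close>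

lemma phase_entropy:
  assumes m: "(K + 1) * n \<le> m" and j: "j < n"
  defines "f \<equiv> (\<lambda>\<omega>. itinerary shift_map (part_of \<xi>) m ((shift_map ^^ j) (paste \<omega>)))"
  shows "simple_function \<Omega> f" and "real K * block_entropy \<le> fun_entropy \<Omega> f"
proof -
  let ?I = "itinerary shift_map (part_of \<xi>) m"
  have sI: "simple_function \<nu> ?I" by (rule mp.simple_itinerary[OF mp.simple_part_of[OF \<xi>]])
  show s: "simple_function \<Omega> f"
    unfolding simple_function_def
  proof (intro conjI ballI)
    have "f ` space \<Omega> \<subseteq> ?I ` space \<nu>" using shift_pow_XN[OF paste_XN] by (auto simp: f_def space_\<nu>)
    then show "finite (f ` space \<Omega>)" using simple_functionD(1)[OF sI] by (rule finite_subset)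
    fix b
    have "f -` {b} \<inter> space \<Omega> = (\<lambda>\<omega>. (shift_map ^^ j) (paste \<omega>)) -` (?I -` {b} \<inter> space \<nu>) \<inter> space \<Omega>"
      using shift_pow_XN[OF paste_XN] by (auto simp: f_def space_\<nu>)
    then show "f -` {b} \<inter> space \<Omega> \<in> sets \<Omega>"
      using measurable_sets[OF shift_paste_measurable, of "?I -` {b} \<inter> space \<nu>"] simple_functionD(2)[OF sI]
      by (simp add: sets_\<nu>)
  qed
  have sub: "\<omega>' i = \<omega> i" if b: "blocks \<omega>" "blocks \<omega>'" and eq: "f \<omega>' = f \<omega>" and i: "i \<in> {1..K}" for \<omega> \<omega>' i
  proof (rule EN_eqI[OF _ _ n])
    show "\<omega>' i \<in> EN n" "\<omega> i \<in> EN n" using b per by (auto simp: blocks_def)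
    show "agree n (\<omega>' i) (\<omega> i)"
      unfolding agree_def
    proof (intro allI impI)
      fix r assume r: "r < n"
      define t where "t = i * n + r - j"
      have "n \<le> i * n" using i by simp
      then have "j \<le> i * n + r" using j by linarith
      then have t: "t + j = i * n + r" unfolding t_def by (rule le_add_diff_inverse2)
      have "i * n + r < i * n + n" using r by simp
      also have "\<dots> = (i + 1) * n" by (simp add: algebra_simps)
      also have "\<dots> \<le> (K + 1) * n" using i by (intro mult_right_mono) auto
      finally have "t < m" using m t by linarith
      then have "capped ((shift_map ^^ t) ((shift_map ^^ j) (paste \<omega>'))) = capped ((shift_map ^^ t) ((shift_map ^^ j) (paste \<omega>)))"
        using eq by (simp add: f_def itinerary_eq_iff part_of_\<xi>_eq shift_pow_XN paste_XN)
      then have "paste \<omega>' (i * n + r) = paste \<omega> (i * n + r)"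
        using paste_le[OF b(1), of "i * n + r"] paste_le[OF b(2), of "i * n + r"]
        by (simp add: capped_def shift_pow t min_absorb1 le_SucI)
      then show "\<omega>' i r = \<omega> i r" using r by (simp add: paste_eq[OF b(1)] paste_eq[OF b(2)])
    qed
  qed
  have ub: "fiber_prob \<Omega> f (f \<omega>) \<le> (\<Prod>i\<in>{1..K}. pmf p (\<omega> i))" if b: "blocks \<omega>" for \<omega>
  proof -
    have S: "{\<omega>' \<in> space \<Omega>. \<forall>i\<in>{1..K}. \<omega>' i \<in> {\<omega> i}} \<in> sets \<Omega>"
    proof (rule sets.sets_Collect_finite_All)
      fix i
      have "(\<lambda>\<omega>'. \<omega>' i) -` {\<omega> i} \<inter> space \<Omega> \<in> sets \<Omega>"
        by (rule measurable_sets[OF block_measurable[of "\<lambda>y. y" i]]) simp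
      then show "{\<omega>' \<in> space \<Omega>. \<omega>' i \<in> {\<omega> i}} \<in> sets \<Omega>" by (simp add: vimage_def)
    qed simp
    have "fiber_prob \<Omega> f (f \<omega>) \<le> measure \<Omega> {\<omega>' \<in> space \<Omega>. \<forall>i\<in>{1..K}. \<omega>' i \<in> {\<omega> i}}"
      unfolding fiber_prob_def
    proof (rule \<Omega>.finite_measure_mono_AE[OF _ S])
      show "AE x in \<Omega>. x \<in> f -` {f \<omega>} \<inter> space \<Omega> \<longrightarrow> x \<in> {\<omega>' \<in> space \<Omega>. \<forall>i\<in>{1..K}. \<omega>' i \<in> {\<omega> i}}"
        using AE_blocks by eventually_elim (use sub[OF b] in auto)
    qed
    also have "\<dots> = (\<Prod>i\<in>{1..K}. pmf p (\<omega> i))"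
    proof -
      have "emeasure \<Omega> {\<omega>' \<in> space \<Omega>. \<forall>i\<in>{1..K}. \<omega>' i \<in> {\<omega> i}} = (\<Prod>i\<in>{1..K}. emeasure (measure_pmf p) {\<omega> i})"
        unfolding \<Omega>_def by (rule P.emeasure_PiM_Collect) auto
      also have "\<dots> = ennreal (\<Prod>i\<in>{1..K}. pmf p (\<omega> i))"
        by (simp add: emeasure_pmf_single prod_ennreal)
      finally show ?thesis by (simp add: \<Omega>.emeasure_eq_measure prod_nonneg)
    qed
    finally show ?thesis .
  qed
  have int: "integrable \<Omega> (\<lambda>\<omega>. \<Sum>i\<in>{1..K}. - ln (pmf p (\<omega> i)))"
    by (intro Bochner_Integration.integrable_sum expectation_block(2)[of "\<lambda>y. - ln (pmf p y)"])
  have "real K * block_entropy = (\<Sum>i\<in>{1..K}. \<integral>\<omega>. - ln (pmf p (\<omega> i)) \<partial>\<Omega>)"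
    unfolding block_entropy_def by (subst expectation_block(1)[of "\<lambda>y. - ln (pmf p y)"]) simp
  also have "\<dots> = (\<integral>\<omega>. (\<Sum>i\<in>{1..K}. - ln (pmf p (\<omega> i))) \<partial>\<Omega>)"
    by (rule Bochner_Integration.integral_sum[symmetric]) (rule expectation_block(2)[of "\<lambda>y. - ln (pmf p y)"])
  also have "\<dots> \<le> (\<integral>\<omega>. - ln (fiber_prob \<Omega> f (f \<omega>)) \<partial>\<Omega>)"
  proof (rule integral_mono_AE[OF int \<Omega>.integral_simple_range(1)[OF s, of "\<lambda>b. - ln (fiber_prob \<Omega> f b)"]])
    show "AE \<omega> in \<Omega>. (\<Sum>i\<in>{1..K}. - ln (pmf p (\<omega> i))) \<le> - ln (fiber_prob \<Omega> f (f \<omega>))"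
      using AE_blocks \<Omega>.AE_fiber_prob_pos[OF s]
    proof eventually_elim
      case (elim \<omega>)
      have pos: "0 < pmf p (\<omega> i)" for i using elim(1) by (simp add: blocks_def pmf_positive)
      have "ln (fiber_prob \<Omega> f (f \<omega>)) \<le> ln (\<Prod>i\<in>{1..K}. pmf p (\<omega> i))"
        using ub[OF elim(1)] elim(2) by simp
      also have "\<dots> = (\<Sum>i\<in>{1..K}. ln (pmf p (\<omega> i)))" by (rule ln_prod[OF finite_atLeastAtMost less_imp_neq[OF pos, symmetric]])
      finally show ?case by (simp add: sum_negf)
    qed
  qed
  also have "\<dots> = fun_entropy \<Omega> f" by (rule \<Omega>.fun_entropy_integral[OF s, symmetric])
  finally show "real K * block_entropy \<le> fun_entropy \<Omega> f" .
qed

text \<open>Entropy is concave: Gibbs' inequality, applied at each phase with the law of the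
  averaged process as reference, bounds the entropy of the average from below by the average of the entropies.\<close>

lemma \<nu>_itinerary_entropy:
  assumes m: "(K + 1) * n \<le> m"
  shows "real K * block_entropy \<le> fun_entropy \<nu> (itinerary shift_map (part_of \<xi>) m)"
proof -
  let ?I = "itinerary shift_map (part_of \<xi>) m"
  let ?f = "\<lambda>j \<omega>. ?I ((shift_map ^^ j) (paste \<omega>))"
  let ?F = "fiber_prob \<nu> ?I"
  have sI: "simple_function \<nu> ?I" by (rule mp.simple_itinerary[OF mp.simple_part_of[OF \<xi>]])
  have fr: "?f j ` space \<Omega> \<subseteq> ?I ` space \<nu>" for j using shift_pow_XN[OF paste_XN] by (auto simp: space_\<nu>)
  have F: "?F b = (\<Sum>j<n. fiber_prob \<Omega> (?f j) b) / real n" for b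
  proof -
    have A: "?I -` {b} \<inter> XN \<in> sets BX" using simple_functionD(2)[OF sI, of "{b}"] by (simp add: sets_\<nu> space_\<nu>)
    have "?F b = (\<integral>x. indicat_real (?I -` {b} \<inter> XN) x \<partial>\<nu>)"
      by (simp add: fiber_prob_def space_\<nu>)
    also have "\<dots> = (\<Sum>j<n. \<integral>\<omega>. indicat_real (?I -` {b} \<inter> XN) ((shift_map ^^ j) (paste \<omega>)) \<partial>\<Omega>) / real n"
      by (rule integral_\<nu>(3)[OF borel_measurable_indicator[OF A], of 1]) (auto simp: indicator_def)
    also have "(\<lambda>j. \<integral>\<omega>. indicat_real (?I -` {b} \<inter> XN) ((shift_map ^^ j) (paste \<omega>)) \<partial>\<Omega>) = (\<lambda>j. fiber_prob \<Omega> (?f j) b)"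
    proof
      fix j
      have "(\<lambda>\<omega>. indicat_real (?I -` {b} \<inter> XN) ((shift_map ^^ j) (paste \<omega>))) = indicat_real (?f j -` {b} \<inter> space \<Omega>)"
        using shift_pow_XN[OF paste_XN] by (auto simp: indicator_def fun_eq_iff)
      then show "(\<integral>\<omega>. indicat_real (?I -` {b} \<inter> XN) ((shift_map ^^ j) (paste \<omega>)) \<partial>\<Omega>) = fiber_prob \<Omega> (?f j) b"
        by (simp add: fiber_prob_def)
    qed
    finally show ?thesis .
  qed
  have each: "real K * block_entropy \<le> (\<integral>\<omega>. - ln (?F (?f j \<omega>)) \<partial>\<Omega>)" if j: "j < n" for j
  proof -
    note s = phase_entropy(1)[OF m j]
    have "real K * block_entropy \<le> fun_entropy \<Omega> (?f j)" by (rule phase_entropy(2)[OF m j])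
    also have "\<dots> \<le> (\<Sum>b\<in>?f j ` space \<Omega>. fiber_prob \<Omega> (?f j) b * - ln (?F b))"
      using s
    proof (rule \<Omega>.gibbs_sum)
      show "0 \<le> ?F b" for b by (rule fiber_prob_nonneg)
      show "0 < ?F b" if "0 < fiber_prob \<Omega> (?f j) b" for b
      proof -
        have "fiber_prob \<Omega> (?f j) b \<le> (\<Sum>j<n. fiber_prob \<Omega> (?f j) b)"
          using j by (intro member_le_sum) (auto simp: fiber_prob_nonneg)
        then show ?thesis unfolding F using n that by (intro divide_pos_pos) auto
      qed
      have "(\<Sum>b\<in>?f j ` space \<Omega>. ?F b) \<le> (\<Sum>b\<in>?I ` space \<nu>. ?F b)"
        by (rule sum_mono2[OF simple_functionD(1)[OF sI] fr]) (rule fiber_prob_nonneg)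
      then show "(\<Sum>b\<in>?f j ` space \<Omega>. ?F b) \<le> 1" by (simp add: \<nu>.sum_fiber_prob[OF sI])
    qed
    also have "\<dots> = (\<integral>\<omega>. - ln (?F (?f j \<omega>)) \<partial>\<Omega>)"
      by (rule \<Omega>.integral_simple_range(2)[OF s, symmetric])
    finally show ?thesis .
  qed
  have "real K * block_entropy = (\<Sum>j<n. real K * block_entropy) / real n" using n by simp
  also have "\<dots> \<le> (\<Sum>j<n. \<integral>\<omega>. - ln (?F (?f j \<omega>)) \<partial>\<Omega>) / real n"
    by (intro divide_right_mono sum_mono each) auto
  also have "\<dots> = (\<integral>x. - ln (?F (?I x)) \<partial>\<nu>)"
  proof (rule integral_\<nu>(3)[symmetric])
    show "(\<lambda>x. - ln (?F (?I x))) \<in> borel_measurable BX"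
      using borel_measurable_integrable[OF \<nu>.integral_simple_range(1)[OF sI, of "\<lambda>b. - ln (?F b)"]]
      by (simp add: measurable_cong_sets[OF sets_\<nu> refl])
    fix j \<omega>
    have "?f j \<omega> \<in> ?I ` space \<nu>" using shift_pow_XN[OF paste_XN] by (auto simp: space_\<nu>)
    then show "\<bar>- ln (?F (?f j \<omega>))\<bar> \<le> (\<Sum>b\<in>?I ` space \<nu>. \<bar>- ln (?F b)\<bar>)"
      by (intro member_le_sum) (auto intro: simple_functionD(1)[OF sI])
  qed
  also have "\<dots> = fun_entropy \<nu> ?I" by (rule \<nu>.fun_entropy_integral[OF sI, symmetric])
  finally show ?thesis .
qed

lemma ks_entropy_\<nu>: "ereal (block_entropy / real n) \<le> ks_entropy \<nu> shift_map"
proof -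
  define L where "L = lim (\<lambda>m. partition_entropy \<nu> (iterated_join \<nu> shift_map \<xi> m) / real m)"
  let ?e = "\<lambda>m. fun_entropy \<nu> (itinerary shift_map (part_of \<xi>) m) / real m"
  have "?e \<longlonglongrightarrow> L" unfolding L_def by (rule mp.entropy_rate(1)[OF \<xi>])
  moreover have "strict_mono (\<lambda>K. (K + 1) * n)" using n by (auto simp: strict_mono_def)
  ultimately have l: "(\<lambda>K. ?e ((K + 1) * n)) \<longlonglongrightarrow> L"
    using LIMSEQ_subseq_LIMSEQ[of ?e L "\<lambda>K. (K + 1) * n"] by (simp add: o_def)
  have "(\<lambda>K. real K / real (K + 1) * (block_entropy / real n)) \<longlonglongrightarrow> 1 * (block_entropy / real n)"
    using LIMSEQ_n_over_Suc_n[where 'a = real] by (intro tendsto_mult tendsto_const) (simp add: add.commute)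
  then have "1 * (block_entropy / real n) \<le> L"
  proof (rule LIMSEQ_le[OF _ l])
    have "real K / real (K + 1) * (block_entropy / real n) \<le> ?e ((K + 1) * n)" for K
    proof -
      have "real K / real (K + 1) * (block_entropy / real n) = real K * block_entropy / real ((K + 1) * n)"
        by (simp only: times_divide_times_eq of_nat_mult)
      also have "\<dots> \<le> ?e ((K + 1) * n)"
        using \<nu>_itinerary_entropy[OF order_refl] by (rule divide_right_mono) simp
      finally show ?thesis .
    qed
    then show "\<exists>N. \<forall>K\<ge>N. real K / real (K + 1) * (block_entropy / real n) \<le> ?e ((K + 1) * n)" by blast
  qed
  then have "ereal (block_entropy / real n) \<le> ereal L" by simp
  also have "\<dots> \<le> ks_entropy \<nu> shift_map"
    unfolding ks_entropy_def L_def by (rule SUP_upper) (rule \<xi>)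
  finally show ?thesis .
qed

end

section \<open>Block measures with large free energy\<close>

context finite_pressure
begin

text \<open>With \<open>p\<close> proportional to \<open>exp (birkhoff n \<phi>)\<close> on \<open>S\<close>, the entropy of \<open>p\<close> plus the mean of
  \<open>birkhoff n \<phi>\<close> equals \<open>ln (Q * ZN n \<phi>)\<close>. The last clause transfers bounds on Birkhoff sums from \<open>S\<close>
  to the integral over \<open>\<nu>\<close>.\<close>

lemma large_block_measure:
  assumes n: "n > 0" and S: "finite S" "S \<subseteq> EN n" and Q: "measure_pmf.prob (per_pmf n) S = Q" "Q > 0"
  obtains \<nu> where "\<nu> \<in> MX_inv"
    and "\<And>\<epsilon> C. (\<And>x y. x \<in> XN \<Longrightarrow> y \<in> XN \<Longrightarrow> agree n x y \<Longrightarrow>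
        \<bar>birkhoff n \<phi> x - birkhoff n \<phi> y\<bar> \<le> real n * \<epsilon> + C) \<Longrightarrow>
      ereal ((ln Q - 2 * C) / real n - 2 * \<epsilon>) \<le> free_energy \<phi> \<nu>"
    and "\<And>f B l. f \<in> borel_measurable BX \<Longrightarrow> (\<And>x. x \<in> XN \<Longrightarrow> \<bar>f x\<bar> \<le> B) \<Longrightarrow>
      (\<And>x y. x \<in> XN \<Longrightarrow> y \<in> S \<Longrightarrow> agree n x y \<Longrightarrow> l \<le> birkhoff n f x) \<Longrightarrow> l \<le> real n * (\<integral>x. f x \<partial>\<nu>)"
proof -
  define p where "p = cond_pmf (per_pmf n) S"
  have ne: "set_pmf (per_pmf n) \<inter> S \<noteq> {}"
    using Q measure_pmf_zero_iff[of "per_pmf n" S] by auto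
  have Z: "ZN n \<phi> > 0" by (rule ZN_pos[OF n])
  have setp: "set_pmf p = S" using ne S(2) set_per_pmf[OF n] by (auto simp: p_def set_cond_pmf)
  have pmfp: "pmf p y = exp (birkhoff n \<phi> y) / (ZN n \<phi> * Q)" if "y \<in> S" for y
    using that S(2) Q ne by (auto simp: p_def pmf_cond pmf_per[OF n])
  interpret block_process n p
    by unfold_locales (use n S setp in auto)
  obtain c where c: "\<And>x y. x \<in> XN \<Longrightarrow> y \<in> XN \<Longrightarrow> x 0 = y 0 \<Longrightarrow> \<bar>\<phi> x - \<phi> y\<bar> \<le> c"
    using tame unfolding tame_def by metis
  define B where "B = c + (\<Sum>y\<in>S. \<Sum>k<n. \<bar>\<phi> ((shift_map ^^ k) y)\<bar>)"
  have B: "\<bar>\<phi> ((shift_map ^^ j) (paste \<omega>))\<bar> \<le> B" if b: "blocks \<omega>" for j \<omega>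
  proof -
    let ?y = "\<omega> (j div n)" and ?k = "j mod n"
    have y: "?y \<in> S" using b setp by (auto simp: blocks_def)
    have k: "?k < n" using n by simp
    have "\<bar>\<phi> ((shift_map ^^ j) (paste \<omega>)) - \<phi> ((shift_map ^^ ?k) ?y)\<bar> \<le> c"
      using y S(2) EN_XN by (intro c shift_pow_XN paste_XN) (auto simp: shift_pow paste_eq[OF b])
    moreover have "\<bar>\<phi> ((shift_map ^^ ?k) ?y)\<bar> \<le> (\<Sum>k<n. \<bar>\<phi> ((shift_map ^^ k) ?y)\<bar>)"
      using k by (intro member_le_sum) auto
    moreover have "\<dots> \<le> (\<Sum>y\<in>S. \<Sum>k<n. \<bar>\<phi> ((shift_map ^^ k) y)\<bar>)"
      using y S(1) by (intro member_le_sum[of ?y S "\<lambda>y. \<Sum>k<n. \<bar>\<phi> ((shift_map ^^ k) y)\<bar>"]) (auto intro: sum_nonneg)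
    ultimately show ?thesis unfolding B_def by linarith
  qed
  have meas: "\<phi> \<in> borel_measurable BX" by (rule tame_measurable[OF tame])
  have int: "integrable \<nu> \<phi>" by (rule integral_\<nu>(1)[OF meas B])
  have phi: "\<nu> \<in> MX_phi \<phi>" using \<nu>_inv by (simp add: MX_phi_def ext_integral_eq[OF int])
  have iS: "integrable (measure_pmf p) g" for g :: "_ \<Rightarrow> real"
    by (rule integrable_measure_pmf_finite) (simp add: setp S)
  have "block_entropy = measure_pmf.expectation p (\<lambda>y. ln (ZN n \<phi> * Q) - birkhoff n \<phi> y)"
    unfolding block_entropy_def
  proof (rule integral_cong_AE)
    show "AE y in measure_pmf p. - ln (pmf p y) = ln (ZN n \<phi> * Q) - birkhoff n \<phi> y"
      using Z Q(2) by (auto simp: AE_measure_pmf_iff setp pmfp ln_div)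
  qed auto
  also have "\<dots> = ln (ZN n \<phi> * Q) - measure_pmf.expectation p (birkhoff n \<phi>)"
    by (simp add: iS)
  finally have e2: "block_entropy = ln (ZN n \<phi>) + ln Q - measure_pmf.expectation p (birkhoff n \<phi>)"
    using Z Q(2) by (simp add: ln_mult)
  have fe: "ereal ((ln Q - 2 * C) / real n - 2 * \<epsilon>) \<le> free_energy \<phi> \<nu>"
    if dist: "\<And>x y. x \<in> XN \<Longrightarrow> y \<in> XN \<Longrightarrow> agree n x y \<Longrightarrow> \<bar>birkhoff n \<phi> x - birkhoff n \<phi> y\<bar> \<le> real n * \<epsilon> + C" for \<epsilon> C
  proof -
    define D where "D = real n * \<epsilon> + C"
    have "measure_pmf.expectation p (\<lambda>y. birkhoff n \<phi> y - D) \<le> real n * (\<integral>x. \<phi> x \<partial>\<nu>)"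
    proof (rule integral_\<nu>_ge[OF meas B])
      fix x y assume xy: "x \<in> XN" "y \<in> set_pmf p" "agree n x y"
      then have "y \<in> XN" using setp S(2) EN_XN by auto
      then show "birkhoff n \<phi> y - D \<le> birkhoff n \<phi> x" using dist[of x y] xy by (simp add: D_def)
    qed
    then have e1: "measure_pmf.expectation p (birkhoff n \<phi>) - D \<le> real n * (\<integral>x. \<phi> x \<partial>\<nu>)"
      by (simp add: iS)
    have e3: "real n * press - D \<le> ln (ZN n \<phi>)"
    proof (rule ln_ZN_ge[OF n])
      fix x y assume xy: "x \<in> XN" "y \<in> XN" "agree n x y"
      show "birkhoff n \<phi> x \<le> birkhoff n \<phi> y + D" using dist[OF xy] by (simp add: D_def)
    qed
    have "ln Q - 2 * D \<le> block_entropy + real n * (\<integral>x. \<phi> x \<partial>\<nu>) - real n * press"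
      using e1 e2 e3 by linarith
    then have "(ln Q - 2 * D) / real n \<le> (block_entropy + real n * (\<integral>x. \<phi> x \<partial>\<nu>) - real n * press) / real n"
      by (rule divide_right_mono) simp
    also have "\<dots> = block_entropy / real n + (\<integral>x. \<phi> x \<partial>\<nu>) - press"
      using n by (simp add: add_divide_distrib diff_divide_distrib)
    also have "(ln Q - 2 * D) / real n = (ln Q - 2 * C) / real n - 2 * \<epsilon>"
      using n by (simp add: D_def field_simps)
    finally have "ereal ((ln Q - 2 * C) / real n - 2 * \<epsilon>) \<le> ereal (block_entropy / real n) + ereal (\<integral>x. \<phi> x \<partial>\<nu>) - ereal press"
      by simp
    also have "\<dots> \<le> ks_entropy \<nu> shift_map + ereal (\<integral>x. \<phi> x \<partial>\<nu>) - ereal press"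
      by (intro ereal_minus_mono add_right_mono ks_entropy_\<nu>) auto
    also have "\<dots> = free_energy \<phi> \<nu>"
      using phi by (simp add: free_energy_def ext_integral_eq[OF int] pressure_eq)
    finally show "ereal ((ln Q - 2 * C) / real n - 2 * \<epsilon>) \<le> free_energy \<phi> \<nu>" .
  qed
  show thesis
  proof (rule that[OF \<nu>_inv fe])
    fix f :: "(nat \<Rightarrow> nat) \<Rightarrow> real" and B l
    assume f: "f \<in> borel_measurable BX" and fB: "\<And>x. x \<in> XN \<Longrightarrow> \<bar>f x\<bar> \<le> B"
      and l: "\<And>x y. x \<in> XN \<Longrightarrow> y \<in> S \<Longrightarrow> agree n x y \<Longrightarrow> l \<le> birkhoff n f x"
    have "measure_pmf.expectation p (\<lambda>_. l) \<le> real n * (\<integral>x. f x \<partial>\<nu>)"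
      by (rule integral_\<nu>_ge[OF f, of B]) (use fB l setp shift_pow_XN[OF paste_XN] in auto)
    then show "l \<le> real n * (\<integral>x. f x \<partial>\<nu>)" by simp
  qed
qed

end

section \<open>Exponential tightness\<close>

lemma pmf_prob_le:
  assumes "\<And>F. finite F \<Longrightarrow> F \<subseteq> A \<Longrightarrow> sum (pmf p) F \<le> c"
  shows "measure_pmf.prob p A \<le> c"
proof -
  have "measure_pmf.prob p A = infsum (pmf p) A"
    by (simp add: measure_pmf_conv_infsetsum infsetsum_infsum pmf_abs_summable)
  also have "\<dots> \<le> c"
    by (rule infsum_le_finite_sums[OF _ assms])
       (use abs_summable_equivalent[of "pmf p" A] pmf_abs_summable in auto)
  finally show ?thesis .
qed

text \<open>With \<open>r k\<close> the tail of the series, the weight \<open>sqrt (r 0 / r k)\<close> tends to infinity, while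
  \<open>b k / sqrt (r k) \<le> 2 (sqrt (r k) - sqrt (r (k + 1)))\<close> telescopes.\<close>

lemma exists_slow_weight:
  fixes b :: "nat \<Rightarrow> real"
  assumes pos: "\<And>k. b k > 0" and sum: "summable b"
  obtains v where "\<And>k. 0 \<le> v k" and "filterlim v at_top sequentially" and "summable (\<lambda>k. b k * exp (v k))"
proof -
  define r where "r k = suminf b - (\<Sum>i<k. b i)" for k
  have r_pos: "r k > 0" for k using sum_less_suminf[OF sum, of k] pos by (simp add: r_def)
  have r_Suc: "r (Suc k) = r k - b k" for k by (simp add: r_def)
  have r0: "r k \<le> r 0" for k using pos by (simp add: r_def sum_nonneg less_imp_le)
  have lim: "r \<longlonglongrightarrow> 0"
    unfolding r_def using tendsto_diff[OF tendsto_const summable_LIMSEQ[OF sum], of "suminf b"] by simp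
  define v where "v k = ln (sqrt (r 0 / r k))" for k
  have ev: "exp (v k) = sqrt (r 0 / r k)" for k
    unfolding v_def using r_pos by (intro exp_ln) simp
  have v0: "0 \<le> v k" for k
    unfolding v_def using r_pos[of k] r0[of k] by (intro ln_ge_zero) (simp add: field_simps)
  have term_le: "b k * exp (v k) \<le> 2 * sqrt (r 0) * (sqrt (r k) - sqrt (r (Suc k)))" for k
  proof -
    let ?s = "sqrt (r k)" and ?t = "sqrt (r (Suc k))"
    have s: "?s > 0" "?t > 0" using r_pos by auto
    have ts: "?t \<le> ?s" using pos[of k] by (simp add: r_Suc)
    have "b k = ?s\<^sup>2 - ?t\<^sup>2" using r_pos[of k] r_pos[of "Suc k"] r_Suc[of k] by simp
    also have "\<dots> = (?s - ?t) * (?s + ?t)" by (simp add: power2_eq_square algebra_simps)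
    also have "\<dots> \<le> (?s - ?t) * (2 * ?s)" using ts by (intro mult_left_mono) auto
    finally have "b k * (sqrt (r 0) / ?s) \<le> (?s - ?t) * (2 * ?s) * (sqrt (r 0) / ?s)"
      using r_pos[of 0] s by (intro mult_right_mono) auto
    also have "\<dots> = 2 * sqrt (r 0) * (?s - ?t)" using s by simp
    finally show ?thesis by (simp add: ev real_sqrt_divide)
  qed
  have "summable (\<lambda>k. b k * exp (v k))"
  proof (rule summableI_nonneg_bounded)
    show "0 \<le> b k * exp (v k)" for k using pos[of k] by simp
    fix K
    have "(\<Sum>k<K. b k * exp (v k)) \<le> (\<Sum>k<K. 2 * sqrt (r 0) * (sqrt (r k) - sqrt (r (Suc k))))"
      by (intro sum_mono term_le)
    also have "\<dots> = 2 * sqrt (r 0) * (sqrt (r 0) - sqrt (r K))"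
      by (simp only: sum_distrib_left[symmetric] sum_lessThan_telescope'[of "\<lambda>k. sqrt (r k)" K])
    also have "\<dots> \<le> 2 * sqrt (r 0) * sqrt (r 0)"
      using r_pos by (intro mult_left_mono) (auto simp: less_imp_le)
    finally show "(\<Sum>k<K. b k * exp (v k)) \<le> 2 * sqrt (r 0) * sqrt (r 0)" .
  qed
  moreover have "filterlim v at_top sequentially"
  proof -
    have "filterlim (\<lambda>k. r 0 * inverse (r k)) at_top sequentially"
      using r_pos by (intro filterlim_tendsto_pos_mult_at_top[OF tendsto_const] filterlim_inverse_at_top lim) auto
    then have "filterlim (\<lambda>k. r 0 / r k) at_top sequentially" by (simp add: divide_inverse)
    then show ?thesis unfolding v_def
      by (intro filterlim_compose[OF ln_at_top] filterlim_compose[OF sqrt_at_top])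
  qed
  ultimately show thesis using v0 by (intro that)
qed

context finite_pressure
begin

text \<open>The sum of the letter weights converges even after multiplication with \<open>exp (u p)\<close> for some \<open>u\<close>
  tending to infinity. Thus the expectation of \<open>exp (\<Sum>k<n. u (x k))\<close> grows at most exponentially, and
  Markov's inequality applies.\<close>

lemma tight_periodic:
  obtains u :: "nat \<Rightarrow> real" and L where "\<And>k. 0 \<le> u k" and "filterlim u at_top sequentially"
    and "(\<lambda>n. measure_pmf.prob (per_pmf n) {x. real n * L < (\<Sum>k<n. u (x k))}) \<longlonglongrightarrow> 0"
proof -
  define b where "b k = enn2real (cyl_weight \<phi> [Suc k])" for k
  have w1: "[Suc k] \<in> words {1..} 1" for k by (simp add: words_def One_nat_def)
  have fin1: "cyl_weight \<phi> [Suc k] < \<infinity>" for k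
    using sum_le_cyl_sum[of "{[Suc k]}" 1 \<phi>] w1 cyl_sum_1_finite by (auto intro: le_less_trans)
  have bpos: "b k > 0" for k
  proof -
    have "prefix_word 1 (\<lambda>_. Suc k) = [Suc k]" by (simp add: prefix_word_def One_nat_def)
    then have "ennreal (exp (birkhoff 1 \<phi> (\<lambda>_. Suc k))) \<le> cyl_weight \<phi> [Suc k]"
      using exp_le_cyl_weight[of "\<lambda>_. Suc k" 1 \<phi>] by (simp add: XN_iff)
    then have "0 < cyl_weight \<phi> [Suc k]" by (rule less_le_trans[rotated]) simp
    then show ?thesis using fin1[of k] by (simp add: b_def enn2real_positive_iff)
  qed
  have bw: "ennreal (b k) = cyl_weight \<phi> [Suc k]" for k using fin1[of k] by (simp add: b_def)
  have sb: "summable b"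
  proof (rule summableI_nonneg_bounded)
    show "0 \<le> b k" for k using bpos[of k] by simp
    fix K
    have "ennreal (\<Sum>k<K. b k) = (\<Sum>k<K. cyl_weight \<phi> [Suc k])"
      using bpos by (simp add: sum_ennreal[symmetric] less_imp_le bw)
    also have "\<dots> = sum (cyl_weight \<phi>) ((\<lambda>k. [Suc k]) ` {..<K})"
      by (simp add: sum.reindex inj_on_def)
    also have "\<dots> \<le> ennreal (exp (log_cyl_sum 1))"
      unfolding cyl_sum_exp[symmetric] using w1 by (intro sum_le_cyl_sum) auto
    finally show "(\<Sum>k<K. b k) \<le> exp (log_cyl_sum 1)" by simp
  qed
  obtain v where v: "\<And>k. 0 \<le> v k" "filterlim v at_top sequentially" "summable (\<lambda>k. b k * exp (v k))"
    by (rule exists_slow_weight[OF bpos sb]) (rule that)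
  define u where "u k = v (k - 1)" for k
  define T where "T = suminf (\<lambda>k. b k * exp (v k))"
  \<comment> \<open>The cylinder sums of this potential are the exponential moments in question.\<close>
  define \<psi> where "\<psi> x = \<phi> x + u (x 0)" for x :: "nat \<Rightarrow> nat"
  have T: "T > 0" unfolding T_def using bpos v by (intro suminf_pos) auto
  have cw: "cyl_weight \<psi> [Suc k] \<le> ennreal (b k * exp (v k))" for k
    unfolding cyl_weight_def[of \<psi>]
  proof (rule SUP_least)
    fix x assume x: "x \<in> cyl {1..} [Suc k]"
    then have "ennreal (exp (\<phi> x)) \<le> ennreal (b k)"
      unfolding bw cyl_weight_def by (intro SUP_upper2[of x]) (auto simp: birkhoff_def)
    then have "exp (\<phi> x) \<le> b k" using bpos[of k] by simp
    then have "exp (\<phi> x) * exp (v k) \<le> b k * exp (v k)" by simp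
    moreover have "x 0 = Suc k" using x by (simp add: cyl_iff)
    ultimately show "ennreal (exp (birkhoff (length [Suc k]) \<psi> x)) \<le> ennreal (b k * exp (v k))"
      by (intro ennreal_leI) (simp add: birkhoff_def \<psi>_def u_def exp_add One_nat_def)
  qed
  have W1: "cyl_sum \<psi> 1 \<le> ennreal T"
  proof (rule cyl_sum_le)
    fix F :: "nat list set" assume F: "finite F" "F \<subseteq> words {1..} 1"
    define G where "G = (\<lambda>w. hd w - 1) ` F"
    have Fw: "w = [Suc (hd w - 1)]" if "w \<in> F" for w
      using F(2) that by (auto simp: words_def length_Suc_conv One_nat_def)
    have "sum (cyl_weight \<psi>) F = sum (cyl_weight \<psi>) ((\<lambda>k. [Suc k]) ` G)"
      unfolding G_def image_image using Fw by (metis (no_types, lifting) image_cong image_ident)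
    also have "\<dots> = (\<Sum>k\<in>G. cyl_weight \<psi> [Suc k])" by (simp add: sum.reindex inj_on_def)
    also have "\<dots> \<le> (\<Sum>k\<in>G. ennreal (b k * exp (v k)))" by (intro sum_mono cw)
    also have "\<dots> = ennreal (\<Sum>k\<in>G. b k * exp (v k))"
      using bpos by (intro sum_ennreal) (simp add: less_imp_le)
    also have "\<dots> \<le> ennreal T"
      unfolding T_def using bpos F(1) by (intro ennreal_leI sum_le_suminf v) (auto simp: G_def less_imp_le)
    finally show "sum (cyl_weight \<psi>) F \<le> ennreal T" .
  qed
  obtain C where C: "C \<ge> 0" "\<And>n x y. x \<in> XN \<Longrightarrow> y \<in> XN \<Longrightarrow> agree n x y \<Longrightarrow>
     \<bar>birkhoff n \<phi> x - birkhoff n \<phi> y\<bar> \<le> real n * 1 + C"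
    by (rule distortion[OF tame zero_less_one]) (rule that)
  \<comment> \<open>\<open>ln T\<close> and \<open>press\<close> compensate the two exponential factors; one unit of the summand 2 pays for the distortion, the other gives the decay.\<close>
  define L where "L = ln T - press + 2"
  have bound: "measure_pmf.prob (per_pmf n) {x. real n * L < (\<Sum>k<n. u (x k))} \<le> exp C * exp (- real n)"
    if n: "n > 0" for n
  proof -
    let ?A = "{x. real n * L < (\<Sum>k<n. u (x k))}"
    have bk: "birkhoff n \<psi> x = birkhoff n \<phi> x + (\<Sum>k<n. u (x k))" for x
      by (simp add: birkhoff_def \<psi>_def sum.distrib shift_pow)
    have Z: "exp (real n * press - (real n + C)) \<le> ZN n \<phi>"
    proof -
      have "real n * press - (real n + C) \<le> ln (ZN n \<phi>)"
      proof (rule ln_ZN_ge[OF n])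
        fix x y assume xy: "x \<in> XN" "y \<in> XN" "agree n x y"
        from C(2)[OF this] show "birkhoff n \<phi> x \<le> birkhoff n \<phi> y + (real n + C)" by simp
      qed
      then have "exp (real n * press - (real n + C)) \<le> exp (ln (ZN n \<phi>))" by simp
      then show ?thesis using ZN_pos[OF n] by simp
    qed
    have fs: "sum (pmf (per_pmf n)) F \<le> exp C * exp (- real n)" if F: "finite F" "F \<subseteq> ?A" for F
    proof -
      have "sum (pmf (per_pmf n)) F = sum (pmf (per_pmf n)) (F \<inter> EN n)"
        by (rule sum.mono_neutral_right) (use F in \<open>auto simp: pmf_per[OF n]\<close>)
      also have "\<dots> = (\<Sum>x\<in>F \<inter> EN n. exp (birkhoff n \<phi> x)) / ZN n \<phi>"
        by (simp add: pmf_per[OF n] sum_divide_distrib)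
      also have "\<dots> \<le> (exp (- (real n * L)) * T ^ n) / ZN n \<phi>"
      proof (rule divide_right_mono)
        have "(\<Sum>x\<in>F \<inter> EN n. exp (birkhoff n \<phi> x)) \<le> (\<Sum>x\<in>F \<inter> EN n. exp (- (real n * L)) * exp (birkhoff n \<psi> x))"
          unfolding exp_add[symmetric] using F(2) by (intro sum_mono) (auto simp: bk)
        also have "\<dots> = exp (- (real n * L)) * (\<Sum>x\<in>F \<inter> EN n. exp (birkhoff n \<psi> x))"
          by (simp add: sum_distrib_left)
        also have "(\<Sum>x\<in>F \<inter> EN n. exp (birkhoff n \<psi> x)) \<le> T ^ n"
        proof -
          have "ennreal (\<Sum>x\<in>F \<inter> EN n. exp (birkhoff n \<psi> x)) \<le> cyl_sum \<psi> n"
            using F(1) by (intro EN_sum_le_cyl_sum n) auto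
          also have "\<dots> \<le> cyl_sum \<psi> 1 ^ n" by (rule cyl_sum_pow[OF n])
          also have "\<dots> \<le> ennreal T ^ n" by (intro power_mono W1) simp
          also have "\<dots> = ennreal (T ^ n)" using T by (simp add: ennreal_power)
          finally show ?thesis using T by simp
        qed
        finally show "(\<Sum>x\<in>F \<inter> EN n. exp (birkhoff n \<phi> x)) \<le> exp (- (real n * L)) * T ^ n" by simp
      qed (use ZN_pos[OF n] in simp)
      also have "\<dots> \<le> (exp (- (real n * L)) * T ^ n) / exp (real n * press - (real n + C))"
        using Z T ZN_pos[OF n] by (intro divide_left_mono) auto
      also have "\<dots> = exp (- (real n * L) + real n * ln T - (real n * press - (real n + C)))"
      proof -
        have "T ^ n = exp (real n * ln T)" using T by (simp add: exp_of_nat_mult)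
        then show ?thesis by (simp only: exp_add exp_diff)
      qed
      also have "- (real n * L) + real n * ln T - (real n * press - (real n + C)) = C + - real n"
        by (simp add: L_def algebra_simps)
      finally show ?thesis by (simp only: exp_add)
    qed
    show ?thesis by (rule pmf_prob_le[OF fs])
  qed
  have "(\<lambda>n. exp C * exp (- real n)) \<longlonglongrightarrow> exp C * 0"
    by (intro tendsto_mult tendsto_const filterlim_compose[OF exp_at_bot] filterlim_compose[OF filterlim_uminus_at_bot_at_top] filterlim_real_sequentially)
  then have "(\<lambda>n. exp C * exp (- real n)) \<longlonglongrightarrow> 0" by simp
  then have lim: "(\<lambda>n. measure_pmf.prob (per_pmf n) {x. real n * L < (\<Sum>k<n. u (x k))}) \<longlonglongrightarrow> 0"
    by (rule tendsto_sandwich[rotated 2, OF tendsto_const])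
       (auto intro!: eventually_mono[OF eventually_gt_at_top[of 0]] bound)
  have "filterlim u at_top sequentially"
    unfolding u_def by (rule filterlim_compose[OF v(2)]) (rule filterlim_minus_const_nat_at_top)
  then show thesis using that[of u L] v(1) lim by (simp add: u_def)
qed

end

section \<open>Compactness of tight families\<close>

lemma measurable_map_word:
  "n \<le> i \<Longrightarrow> (\<lambda>\<omega>. map \<omega> [0..<n]) \<in> PiM {0..<i} (\<lambda>_. count_space (UNIV :: nat set)) \<rightarrow>\<^sub>M count_space UNIV"
proof (induction n)
  case (Suc n)
  have "(\<lambda>\<omega>. (map \<omega> [0..<n]) @ [\<omega> n]) \<in> PiM {0..<i} (\<lambda>_. count_space (UNIV :: nat set)) \<rightarrow>\<^sub>M count_space UNIV"
  proof (rule measurable_compose_countable[where f = "\<lambda>u \<omega>. u @ [\<omega> n]" and g = "\<lambda>\<omega>. map \<omega> [0..<n]"])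
    show "(\<lambda>\<omega>. u @ [\<omega> n]) \<in> PiM {0..<i} (\<lambda>_. count_space (UNIV :: nat set)) \<rightarrow>\<^sub>M count_space UNIV" for u
      by (rule measurable_compose[OF measurable_component_singleton]) (use Suc.prems in auto)
  qed (use Suc in auto)
  then show ?case by simp
qed simp

text \<open>The theorem of Ionescu-Tulcea with the conditional probabilities of the next letter as kernels;
  words of mass 0 receive an arbitrary kernel.\<close>

lemma measure_from_cylinders:
  fixes m :: "nat list \<Rightarrow> real"
  assumes nonneg: "\<And>w. 0 \<le> m w" and total: "m [] = 1" and consistent: "\<And>w. (\<lambda>p. m (w @ [p])) sums m w"
  obtains \<mu> :: "(nat \<Rightarrow> nat) measure"
    where "prob_space \<mu>" "sets \<mu> = sets (PiM UNIV (\<lambda>_. count_space UNIV))"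
      "\<And>w. measure \<mu> {x. \<forall>k<length w. x k = w ! k} = m w"
proof -
  define K where "K w = (if m w > 0 then embed_pmf (\<lambda>p. m (w @ [p]) / m w) else return_pmf 0)" for w
  have K: "m w * pmf (K w) p = m (w @ [p])" for w p
  proof (cases "m w > 0")
    case True
    have "pmf (embed_pmf (\<lambda>p. m (w @ [p]) / m w)) p = m (w @ [p]) / m w"
    proof (rule pmf_embed_pmf)
      show "0 \<le> m (w @ [p]) / m w" for p using nonneg True by simp
      have "(\<lambda>p. m (w @ [p]) / m w) sums (m w / m w)" by (intro sums_divide consistent)
      then have s: "(\<lambda>p. m (w @ [p]) / m w) sums 1" using True by simp
      have "(\<integral>\<^sup>+ p. ennreal (m (w @ [p]) / m w) \<partial>count_space UNIV) = (\<Sum>p. ennreal (m (w @ [p]) / m w))"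
        by (rule nn_integral_count_space_nat)
      also have "\<dots> = ennreal 1"
        using nonneg True s by (intro suminf_ennreal_eq) auto
      finally show "(\<integral>\<^sup>+ p. ennreal (m (w @ [p]) / m w) \<partial>count_space UNIV) = 1" by simp
    qed
    then show ?thesis using True by (simp add: K_def)
  next
    case False
    then have "m w = 0" using nonneg[of w] by simp
    moreover have "m (w @ [p]) \<le> m w"
    proof -
      have "(\<Sum>p\<in>{p}. m (w @ [p])) \<le> (\<Sum>p. m (w @ [p]))"
        using consistent[of w] nonneg by (intro sum_le_suminf) (auto simp: sums_iff)
      then show ?thesis using consistent[of w] by (simp add: sums_iff)
    qed
    ultimately show ?thesis using nonneg[of "w @ [p]"] by simp
  qed
  define P where "P i \<omega> = measure_pmf (K (map \<omega> [0..<i]))" for i and \<omega> :: "nat \<Rightarrow> nat"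
  let ?M = "\<lambda>_::nat. count_space (UNIV :: nat set)"
  interpret Ionescu_Tulcea P ?M
  proof (rule Ionescu_Tulcea.intro)
    fix i
    show "P i \<in> PiM {0..<i} ?M \<rightarrow>\<^sub>M subprob_algebra (count_space UNIV)"
      unfolding P_def
      by (rule measurable_compose[OF measurable_map_word[OF order_refl]]) (auto simp: space_subprob_algebra intro!: measure_pmf.subprob_space_axioms)
  next
    fix i and x :: "nat \<Rightarrow> nat"
    show "prob_space (P i x)" unfolding P_def by (rule measure_pmf.prob_space_axioms)
  qed
  define X where "X n w = {\<omega> \<in> space (PiM {0..<n} ?M). map \<omega> [0..<n] = w}" for n w
  have X: "X n w \<in> sets (PiM {0..<n} ?M)" for n w
  proof -
    have "X n w = (\<lambda>\<omega>. map \<omega> [0..<n]) -` {w} \<inter> space (PiM {0..<n} ?M)" by (auto simp: X_def)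
    then show ?thesis using measurable_sets[OF measurable_map_word[OF order_refl], of "{w}" n] by simp
  qed
  have C: "emeasure (C 0 n (\<lambda>_. undefined)) (X n w) = ennreal (m w)" if "length w = n" for n w
    using that
  proof (induction n arbitrary: w)
    case 0
    then show ?case by (simp add: X_def total space_PiM_empty PiM_empty emeasure_return)
  next
    case (Suc n)
    obtain u p where w: "w = u @ [p]" "length u = n" using Suc.prems by (cases w rule: rev_cases) auto
    have u0: "(\<lambda>_. undefined) \<in> space (PiM {0..<0} ?M)" by (simp add: space_PiM_empty)
    have "emeasure (C 0 (Suc n) (\<lambda>_. undefined)) (X (Suc n) w) =
        (\<integral>\<^sup>+\<omega>. emeasure (eP n \<omega>) (X (Suc n) w) \<partial>C 0 n (\<lambda>_. undefined))"
    proof -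
      have "space (C 0 n (\<lambda>_. undefined)) \<noteq> {}" by (rule prob_space.not_empty[OF prob_space_C[OF u0]])
      moreover have "eP n \<in> C 0 n (\<lambda>_. undefined) \<rightarrow>\<^sub>M subprob_algebra (PiM {0..<Suc n} ?M)"
      proof -
        have "sets (C 0 n (\<lambda>_. undefined)) = sets (PiM {0..<n} ?M)" using sets_C[OF u0, of n] by simp
        from measurable_cong_sets[OF this refl] show ?thesis using measurable_eP[of n] by blast
      qed
      ultimately show ?thesis using X[of "Suc n" w] by (simp add: emeasure_bind)
    qed
    also have "\<dots> = (\<integral>\<^sup>+\<omega>. ennreal (pmf (K u) p) * indicator (X n u) \<omega> \<partial>C 0 n (\<lambda>_. undefined))"
    proof (rule nn_integral_cong)
      fix \<omega> assume "\<omega> \<in> space (C 0 n (\<lambda>_. undefined))"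
      then have \<omega>: "\<omega> \<in> space (PiM {0..<n} ?M)" using space_C[OF u0, of n] by simp
      have "map (fun_upd \<omega> n x) [0..<Suc n] = map \<omega> [0..<n] @ [x]" for x by simp
      then have "(\<lambda>x. fun_upd \<omega> n x) -` X (Suc n) w \<inter> space (count_space UNIV) = (if \<omega> \<in> X n u then {p} else {})"
        using \<omega> by (auto simp: X_def w space_PiM PiE_iff extensional_def)
      then show "emeasure (eP n \<omega>) (X (Suc n) w) = ennreal (pmf (K u) p) * indicator (X n u) \<omega>"
        unfolding emeasure_eP[OF \<omega> X] by (auto simp: P_def X_def emeasure_pmf_single)
    qed
    also have "\<dots> = ennreal (pmf (K u) p) * ennreal (m u)"
      using X[of n u] sets_C[OF u0, of n] Suc.IH[OF w(2)] by (subst nn_integral_cmult_indicator) auto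
    also have "\<dots> = ennreal (m w)"
      using K[of u p] by (simp add: w mult.commute nonneg flip: ennreal_mult)
    finally show ?case .
  qed
  have pl: "prob_space PF.lim"
  proof
    have "emeasure PF.lim (PF.emb UNIV {} {\<lambda>_. undefined}) = emeasure (CI {}) {\<lambda>_. undefined}"
      by (rule lim) (auto simp: PiM_empty)
    also have "\<dots> = emeasure (CI {}) (space (CI {}))" by (simp add: CI_def space_PiM_empty)
    also have "\<dots> = 1" by (rule prob_space.emeasure_space_1[OF PF.prob_space_P]) auto
    also have "PF.emb UNIV {} {\<lambda>_. undefined} = space PF.lim"
      by (auto simp: prod_emb_def PF.space_lim space_PiM)
    finally show "emeasure PF.lim (space PF.lim) = 1" .
  qed
  have meas: "measure PF.lim {x. \<forall>k<length w. x k = w ! k} = m w" for w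
  proof -
    let ?n = "length w"
    have "PF.emb UNIV {0..<?n} (X ?n w) = {x. \<forall>k<?n. x k = w ! k}"
    proof (rule set_eqI)
      fix x :: "nat \<Rightarrow> nat"
      have mx: "map (restrict x {0..<?n}) [0..<?n] = map x [0..<?n]" by simp
      have "x \<in> PF.emb UNIV {0..<?n} (X ?n w) \<longleftrightarrow> map x [0..<?n] = w"
        unfolding prod_emb_iff X_def mem_Collect_eq mx by (simp add: space_PiM)
      also have "\<dots> \<longleftrightarrow> map x [0..<?n] = map ((!) w) [0..<?n]" by (simp only: map_nth)
      also have "\<dots> \<longleftrightarrow> (\<forall>k<?n. x k = w ! k)" unfolding map_eq_conv set_upt by auto
      finally show "x \<in> PF.emb UNIV {0..<?n} (X ?n w) \<longleftrightarrow> x \<in> {x. \<forall>k<?n. x k = w ! k}" by simp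
    qed
    then have "emeasure PF.lim {x. \<forall>k<?n. x k = w ! k} = emeasure (CI {0..<?n}) (X ?n w)"
      using lim[OF finite_atLeastLessThan X[of ?n w]] by simp
    also have "\<dots> = emeasure (C 0 ?n (\<lambda>_. undefined)) (PF.emb {0..<?n} {0..<?n} (X ?n w))"
      by (rule emeasure_CI[OF order_refl X])
    also have "PF.emb {0..<?n} {0..<?n} (X ?n w) = X ?n w"
      by (rule prod_emb_id[OF X[THEN sets.sets_into_space, unfolded space_PiM]])
    also have "emeasure (C 0 ?n (\<lambda>_. undefined)) (X ?n w) = ennreal (m w)" by (rule C) simp
    finally show ?thesis by (simp add: measure_def nonneg)
  qed
  show thesis by (rule that[OF pl _ meas]) (simp add: PF.sets_lim)
qed

lemma cyl_sets[measurable]: "cyl {1..} w \<in> sets BX"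
proof -
  have "cyl {1..} w = cyl_set (length w) {w}"
    by (auto simp: cyl_iff cyl_set_def list_eq_iff_nth_eq)
  then show ?thesis by simp
qed

lemma bounded_function_subsequence:
  fixes f :: "nat \<Rightarrow> 'a :: countable \<Rightarrow> real"
  assumes "\<And>i w. 0 \<le> f i w \<and> f i w \<le> 1"
  obtains l r where "strict_mono (r :: nat \<Rightarrow> nat)" and "\<And>w. (\<lambda>i. f (r i) w) \<longlonglongrightarrow> l w"
proof -
  have "compactin (product_topology (\<lambda>_::'a. euclidean) UNIV) (\<Pi>\<^sub>E w\<in>UNIV. {0..1::real})"
    by (subst compactin_PiE) auto
  then have "compact (\<Pi>\<^sub>E w\<in>(UNIV :: 'a set). {0..1::real})" by (simp add: euclidean_product_topology)
  then have "seq_compact (\<Pi>\<^sub>E w\<in>(UNIV :: 'a set). {0..1::real})" by (rule compact_imp_seq_compact)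
  moreover have "\<forall>i. f i \<in> (\<Pi>\<^sub>E w\<in>UNIV. {0..1})" using assms by auto
  ultimately obtain l r where r: "strict_mono (r :: nat \<Rightarrow> nat)" "(f \<circ> r) \<longlonglongrightarrow> l" by (rule seq_compactE)
  have "(\<lambda>i. f (r i) w) \<longlonglongrightarrow> l w" for w
  proof -
    have "continuous_on UNIV (\<lambda>x :: 'a \<Rightarrow> real. x w)" by (rule continuous_on_product_coordinates)
    from continuous_on_eq_continuous_at[OF open_UNIV, THEN iffD1, OF this] have "isCont (\<lambda>x. x w) l" by blast
    from isCont_tendsto_compose[OF this r(2)] show ?thesis by (simp add: o_def)
  qed
  with r(1) show thesis by (rule that)
qed

text \<open>A diagonal argument gives limits on all cylinders. Tightness of the first coordinate, which invariance
  carries over to every coordinate, prevents mass from escaping to infinity, so the limits are consistent.\<close>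

lemma tight_cylinder_subsequence:
  fixes \<nu>s :: "nat \<Rightarrow> (nat \<Rightarrow> nat) measure"
  assumes inv: "\<And>i. \<nu>s i \<in> MX_inv"
    and tight: "\<And>\<epsilon>. \<epsilon> > 0 \<Longrightarrow> \<exists>M. \<forall>i. measure (\<nu>s i) {x \<in> XN. M < x 0} \<le> \<epsilon>"
  obtains \<nu> r where "\<nu> \<in> MX" and "strict_mono (r :: nat \<Rightarrow> nat)"
    and "\<And>w. (\<lambda>i. measure (\<nu>s (r i)) (cyl {1..} w)) \<longlonglongrightarrow> measure \<nu> (cyl {1..} w)"
proof -
  have MX: "\<nu>s i \<in> MX" for i using inv by (simp add: MX_inv_def)
  have prob: "prob_space (\<nu>s i)" for i using MX by (simp add: MX_def)
  obtain l r where r: "strict_mono (r :: nat \<Rightarrow> nat)" and l: "\<And>w. (\<lambda>i. measure (\<nu>s (r i)) (cyl {1..} w)) \<longlonglongrightarrow> l w"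
    by (rule bounded_function_subsequence[of "\<lambda>i w. measure (\<nu>s i) (cyl {1..} w)"])
       (use prob in \<open>auto intro: prob_space.prob_le_1\<close>)
  \<comment> \<open>The letters are shifted by 1, so that sums over letters become series indexed by \<open>nat\<close>.\<close>
  define m where "m w = l (map Suc w)" for w
  have nonneg: "0 \<le> m w" for w
    unfolding m_def by (rule LIMSEQ_le_const[OF l]) auto
  have one: "measure (\<nu>s i) (cyl {1..} []) = 1" for i
  proof -
    have "cyl {1..} [] = space (\<nu>s i)" using space_MX[OF MX] by (auto simp: cyl_iff)
    then show ?thesis using prob_space.prob_space[OF prob] by simp
  qed
  have total: "m [] = 1"
    using LIMSEQ_unique[OF l[of "[]"]] one by (simp add: m_def)
  have consistent: "(\<lambda>p. m (w @ [p])) sums m w" for w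
  proof -
    let ?w = "map Suc w" and ?c = "\<lambda>i v. measure (\<nu>s i) (cyl {1..} v)"
    have fin: "?c i ?w - measure (\<nu>s i) {x \<in> XN. M < x 0} \<le> (\<Sum>p<M. ?c i (?w @ [Suc p]))"
      and fin2: "(\<Sum>p<M. ?c i (?w @ [Suc p])) \<le> ?c i ?w" for i M
    proof -
      interpret mp_system "\<nu>s i" shift_map by (rule mp_system_MX_inv[OF inv])
      note st = sets_MX[OF MX[of i]] and sp = space_MX[OF MX[of i]]
      let ?U = "\<Union>p\<in>{..<M}. cyl {1..} (?w @ [Suc p])"
      let ?V = "{x \<in> XN. M < x 0}"
      have V: "?V \<in> sets BX"
        using measurable_sets[OF coord_measurable[of 0], of "{M<..}"] by (simp add: vimage_def Int_def conj_commute)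
      let ?T = "(shift_map ^^ length w) -` ?V \<inter> space (\<nu>s i)"
      have T: "?T \<in> sets (\<nu>s i)" using measurable_sets[OF T_pow, of ?V "length w"] V by (simp add: st)
      have mU: "measure (\<nu>s i) ?U = (\<Sum>p<M. ?c i (?w @ [Suc p]))"
      proof (rule finite_measure_finite_Union)
        show "disjoint_family_on (\<lambda>p. cyl {1..} (?w @ [Suc p])) {..<M}"
          unfolding disjoint_family_on_def
        proof (intro ballI impI)
          fix p q :: nat assume pq: "p \<noteq> q"
          have "x (length w) = Suc p" if "x \<in> cyl {1..} (?w @ [Suc p])" for x p
            using that unfolding cyl_iff by (auto simp: nth_append dest!: spec[of _ "length w"])
          from this[of _ p] this[of _ q] pq
          show "cyl {1..} (?w @ [Suc p]) \<inter> cyl {1..} (?w @ [Suc q]) = {}" by (metis (no_types, lifting) disjoint_iff nat.inject)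
        qed
      qed (auto simp: st)
      have sub: "?U \<subseteq> cyl {1..} ?w" using cyl_append(1) by blast
      have "measure (\<nu>s i) ?U \<le> ?c i ?w" by (rule finite_measure_mono[OF sub]) (simp add: st)
      then show "(\<Sum>p<M. ?c i (?w @ [Suc p])) \<le> ?c i ?w" by (simp add: mU)
      have cov: "cyl {1..} ?w \<subseteq> ?U \<union> ?T"
      proof
        fix x assume x: "x \<in> cyl {1..} ?w"
        then have xX: "x \<in> XN" and xw: "\<And>k. k < length w \<Longrightarrow> x k = ?w ! k" by (auto simp: cyl_iff)
        show "x \<in> ?U \<union> ?T"
        proof (cases "M < x (length w)")
          case True
          then show ?thesis using xX by (auto simp: sp shift_pow shift_pow_XN XN_iff)
        next
          case False
          have "1 \<le> x (length w)" using xX by (simp add: XN_iff)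
          then obtain p where p: "x (length w) = Suc p" by (cases "x (length w)") auto
          have "x k = (?w @ [Suc p]) ! k" if "k < length (?w @ [Suc p])" for k
            using that xw[of k] p by (cases "k < length w") (auto simp: nth_append less_Suc_eq)
          then have "x \<in> cyl {1..} (?w @ [Suc p])" using xX unfolding cyl_iff by blast
          then show ?thesis using False p by auto
        qed
      qed
      have "?c i ?w \<le> measure (\<nu>s i) (?U \<union> ?T)"
        using T by (intro finite_measure_mono[OF cov] sets.Un sets.finite_UN) (auto simp: st)
      also have "\<dots> \<le> measure (\<nu>s i) ?U + measure (\<nu>s i) ?T"
        using T by (intro measure_Un_le sets.finite_UN) (auto simp: st)
      also have "measure (\<nu>s i) ?T = measure (distr (\<nu>s i) (\<nu>s i) (shift_map ^^ length w)) ?V"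
        using V by (intro measure_distr[symmetric] T_pow) (simp add: st)
      also have "\<dots> = measure (\<nu>s i) ?V" by (simp add: distr_pow)
      finally show "?c i ?w - measure (\<nu>s i) ?V \<le> (\<Sum>p<M. ?c i (?w @ [Suc p]))" by (simp add: mU)
    qed
    have lim: "(\<lambda>i. \<Sum>p<M. ?c (r i) (?w @ [Suc p])) \<longlonglongrightarrow> (\<Sum>p<M. m (w @ [p]))" for M
      unfolding m_def by (intro tendsto_sum) (use l in simp)
    have up: "(\<Sum>p<M. m (w @ [p])) \<le> m w" for M
      by (rule LIMSEQ_le[OF lim l[of ?w, folded m_def]]) (use fin2 in auto)
    show ?thesis
      unfolding sums_def
    proof (rule LIMSEQ_I)
      fix e :: real assume e: "e > 0"
      obtain M where M: "\<And>i. measure (\<nu>s i) {x \<in> XN. M < x 0} \<le> e / 2" using tight[of "e/2"] e by auto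
      have "m w - e / 2 \<le> (\<Sum>p<M. m (w @ [p]))"
      proof (rule LIMSEQ_le[OF _ lim])
        show "(\<lambda>i. ?c (r i) ?w - e / 2) \<longlonglongrightarrow> m w - e / 2"
          unfolding m_def by (intro tendsto_diff l tendsto_const)
        show "\<exists>N. \<forall>i\<ge>N. ?c (r i) ?w - e / 2 \<le> (\<Sum>p<M. ?c (r i) (?w @ [Suc p]))"
        proof (intro exI allI impI)
          fix i
          show "?c (r i) ?w - e / 2 \<le> (\<Sum>p<M. ?c (r i) (?w @ [Suc p]))"
            using fin[of "r i" M] M[of "r i"] by linarith
        qed
      qed
      note low = this
      have "norm ((\<Sum>p<M'. m (w @ [p])) - m w) < e" if "M \<le> M'" for M'
      proof -
        have "(\<Sum>p<M. m (w @ [p])) \<le> (\<Sum>p<M'. m (w @ [p]))"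
          using that nonneg by (intro sum_mono2) auto
        then show ?thesis unfolding real_norm_def using up[of M'] low e by linarith
      qed
      then show "\<exists>no. \<forall>n\<ge>no. norm ((\<Sum>p<n. m (w @ [p])) - m w) < e" by blast
    qed
  qed
  obtain \<mu> :: "(nat \<Rightarrow> nat) measure" where \<mu>: "prob_space \<mu>" "sets \<mu> = sets (PiM UNIV (\<lambda>_. count_space UNIV))"
      "\<And>w. measure \<mu> {x. \<forall>k<length w. x k = w ! k} = m w"
    by (rule measure_from_cylinders[OF nonneg total consistent]) (rule that)
  define s where "s = (\<lambda>(x :: nat \<Rightarrow> nat) k. Suc (x k))"
  have s: "s \<in> \<mu> \<rightarrow>\<^sub>M BX"
  proof (rule measurable_into_BX)
    fix k
    have "(\<lambda>x. x k) \<in> PiM UNIV (\<lambda>_::nat. count_space (UNIV :: nat set)) \<rightarrow>\<^sub>M count_space UNIV"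
      by (rule measurable_component_singleton) simp
    then have "(\<lambda>x :: nat \<Rightarrow> nat. x k) \<in> \<mu> \<rightarrow>\<^sub>M count_space UNIV" by (simp add: measurable_cong_sets[OF \<mu>(2) refl])
    then show "(\<lambda>x. s x k) \<in> \<mu> \<rightarrow>\<^sub>M count_space UNIV" unfolding s_def by (rule measurable_compose) simp
  qed (simp add: s_def XN_iff)
  define \<nu> where "\<nu> = distr \<mu> BX s"
  have \<nu>: "\<nu> \<in> MX"
    using prob_space.prob_space_distr[OF \<mu>(1) s] by (simp add: \<nu>_def MX_def BX_def)
  have space: "space \<mu> = UNIV" using sets_eq_imp_space_eq[OF \<mu>(2)] by (simp add: space_PiM)
  have cylm: "measure \<nu> (cyl {1..} w) = l w" for w
  proof (cases "0 \<in> set w")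
    case True
    then have "cyl {1..} w = {}" by (auto simp: cyl_iff XN_iff in_set_conv_nth) (metis not_one_le_zero)
    then show ?thesis using l[of w] by (simp add: LIMSEQ_const_iff)
  next
    case False
    define v where "v = map (\<lambda>p. p - 1) w"
    have "Suc (p - 1) = p" if "p \<in> set w" for p using False that by (cases p) (auto simp: One_nat_def)
    then have w: "w = map Suc v" by (simp add: v_def map_idI)
    have "measure \<nu> (cyl {1..} w) = measure \<mu> (s -` cyl {1..} w \<inter> space \<mu>)"
      unfolding \<nu>_def by (rule measure_distr[OF s]) simp
    also have "s -` cyl {1..} w \<inter> space \<mu> = {x. \<forall>k<length v. x k = v ! k}"
      by (auto simp: cyl_iff s_def w space XN_iff)
    finally show ?thesis by (simp add: \<mu>(3) m_def w)
  qed
  show thesis by (rule that[OF \<nu> r]) (simp add: cylm l)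
qed

section \<open>Cylinders determine weak* convergence\<close>

lemma cyl_set_cyl: "length w = N \<Longrightarrow> x \<in> cyl {1..} w \<longleftrightarrow> x \<in> XN \<and> prefix_word N x = w"
proof -
  assume N: "length w = N"
  have "prefix_word N x = w \<longleftrightarrow> (\<forall>k<N. x k = w ! k)"
  proof
    assume "prefix_word N x = w"
    then show "\<forall>k<N. x k = w ! k" by auto
  next
    assume "\<forall>k<N. x k = w ! k"
    then show "prefix_word N x = w" using N by (intro nth_equalityI) auto
  qed
  then show ?thesis using N by (simp add: cyl_iff)
qed

lemma sum_indicator_cyl:
  fixes h :: "nat list \<Rightarrow> real"
  assumes F: "finite F" "\<And>w. w \<in> F \<Longrightarrow> length w = N" and x: "x \<in> XN"
  shows "(\<Sum>w\<in>F. h w * indicator (cyl {1..} w) x) = (if prefix_word N x \<in> F then h (prefix_word N x) else 0)"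
proof -
  have "(\<Sum>w\<in>F. h w * indicator (cyl {1..} w) x) = (\<Sum>w\<in>F. if w = prefix_word N x then h w else 0)"
  proof (rule sum.cong[OF refl])
    fix w assume "w \<in> F"
    then show "h w * indicator (cyl {1..} w) x = (if w = prefix_word N x then h w else 0)"
      using x cyl_set_cyl[OF F(2), of w x] by (auto simp: indicator_def)
  qed
  then show ?thesis using F(1) by (simp add: sum.delta)
qed

lemma integral_cyl_approx:
  assumes \<mu>: "\<mu> \<in> MX" and F: "finite F" "\<And>w. w \<in> F \<Longrightarrow> length w = N"
    and f: "f \<in> borel_measurable BX" "\<And>x. x \<in> XN \<Longrightarrow> \<bar>f x\<bar> \<le> M"
    and h: "\<And>w x. w \<in> F \<Longrightarrow> x \<in> cyl {1..} w \<Longrightarrow> \<bar>f x - h w\<bar> \<le> e" and e: "e \<ge> 0"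
  shows "\<bar>(\<integral>x. f x \<partial>\<mu>) - (\<Sum>w\<in>F. h w * measure \<mu> (cyl {1..} w))\<bar> \<le> e + M * (1 - (\<Sum>w\<in>F. measure \<mu> (cyl {1..} w)))"
proof -
  interpret prob_space \<mu> using \<mu> by (simp add: MX_def)
  note st = sets_MX[OF \<mu>] and sp = space_MX[OF \<mu>]
  have fm: "f \<in> borel_measurable \<mu>" using f(1) by (simp add: measurable_cong_sets[OF st refl])
  have fi: "integrable \<mu> f" using f(2) by (intro integrable_const_bound[where B=M] fm) (auto simp: sp)
  have ci: "integrable \<mu> (\<lambda>x. g w * indicat_real (cyl {1..} w) x)" for g :: "nat list \<Rightarrow> real" and w
    by (intro integrable_mult_right integrable_real_indicator) (auto simp: st emeasure_eq_measure)
  have c: "(\<integral>x. (\<Sum>w\<in>F. g w * indicat_real (cyl {1..} w) x) \<partial>\<mu>) = (\<Sum>w\<in>F. g w * measure \<mu> (cyl {1..} w))" for g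
  proof -
    have "cyl {1..} w \<inter> space \<mu> = cyl {1..} w" for w :: "nat list" by (auto simp: sp cyl_iff)
    moreover have "integrable \<mu> (indicat_real (cyl {1..} w))" for w :: "nat list" using ci[of "\<lambda>_. 1"] by simp
    ultimately show ?thesis by (subst Bochner_Integration.integral_sum) (auto simp: ci)
  qed
  have si: "integrable \<mu> (\<lambda>x. \<Sum>w\<in>F. g w * indicat_real (cyl {1..} w) x)" for g
    by (intro Bochner_Integration.integrable_sum ci)
  have s1: "integrable \<mu> (\<lambda>x. \<Sum>w\<in>F. 1 * indicat_real (cyl {1..} w) x)" by (rule si)
  have pw: "\<bar>f x - (\<Sum>w\<in>F. h w * indicat_real (cyl {1..} w) x)\<bar> \<le> e + M * (1 - (\<Sum>w\<in>F. 1 * indicat_real (cyl {1..} w) x))"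
    if x: "x \<in> space \<mu>" for x
  proof -
    have x: "x \<in> XN" using x sp by simp
    show ?thesis
    proof (cases "prefix_word N x \<in> F")
      case True
      then have "x \<in> cyl {1..} (prefix_word N x)" using x F(2) cyl_set_cyl by blast
      then show ?thesis using h[OF True] True by (simp only: sum_indicator_cyl[OF F x] if_True) simp
    next
      case False
      then show ?thesis using f(2)[OF x] e by (simp only: sum_indicator_cyl[OF F x] if_False) simp
    qed
  qed
  have "(\<integral>x. f x \<partial>\<mu>) - (\<Sum>w\<in>F. h w * measure \<mu> (cyl {1..} w)) = (\<integral>x. f x - (\<Sum>w\<in>F. h w * indicat_real (cyl {1..} w) x) \<partial>\<mu>)"
    using fi si by (simp add: c)
  also have "\<bar>\<dots>\<bar> \<le> (\<integral>x. \<bar>f x - (\<Sum>w\<in>F. h w * indicat_real (cyl {1..} w) x)\<bar> \<partial>\<mu>)"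
    by (rule integral_abs_bound)
  also have "\<dots> \<le> (\<integral>x. e + M * (1 - (\<Sum>w\<in>F. 1 * indicat_real (cyl {1..} w) x)) \<partial>\<mu>)"
  proof (rule integral_mono)
    show "integrable \<mu> (\<lambda>x. \<bar>f x - (\<Sum>w\<in>F. h w * indicat_real (cyl {1..} w) x)\<bar>)"
      by (intro integrable_abs Bochner_Integration.integrable_diff fi si)
    show "integrable \<mu> (\<lambda>x. e + M * (1 - (\<Sum>w\<in>F. 1 * indicat_real (cyl {1..} w) x)))"
      by (intro Bochner_Integration.integrable_add integrable_mult_right Bochner_Integration.integrable_diff s1 integrable_const)
  qed (rule pw)
  also have "\<dots> = e + M * (1 - (\<Sum>w\<in>F. 1 * measure \<mu> (cyl {1..} w)))"
    unfolding c[symmetric] using s1 by (simp add: prob_space del: mult_1)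
  finally show ?thesis by simp
qed

text \<open>Up to small \<open>\<nu>\<close>-mass, the space is covered by finitely many cylinders of equal length on which
  \<open>f\<close> is almost constant. A measure that gives these cylinders almost the same masses as \<open>\<nu>\<close> also gives
  their complement a small mass.\<close>

lemma cylinder_neighbourhood:
  assumes \<nu>: "\<nu> \<in> MX" and f: "f \<in> CX" and \<epsilon>: "\<epsilon> > 0"
  obtains W \<delta> where "finite W" and "\<delta> > 0"
    and "\<forall>\<mu>\<in>MX. (\<forall>w\<in>W. \<bar>measure \<mu> (cyl {1..} w) - measure \<nu> (cyl {1..} w)\<bar> < \<delta>) \<longrightarrow>
      \<bar>(\<integral>x. f x \<partial>\<mu>) - (\<integral>x. f x \<partial>\<nu>)\<bar> < \<epsilon>"
proof -
  interpret prob_space \<nu> using \<nu> by (simp add: MX_def)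
  note st = sets_MX[OF \<nu>] and sp = space_MX[OF \<nu>]
  have cont: "continuous_on XN f" and bd: "bounded (f ` XN)" using f by (auto simp: CX_def)
  obtain M0 where "\<forall>y\<in>f ` XN. norm y \<le> M0" using bd unfolding bounded_iff by blast
  then have M0: "\<And>x. x \<in> XN \<Longrightarrow> \<bar>f x\<bar> \<le> M0" by auto
  define M where "M = max M0 1"
  have M: "M \<ge> 1" and fM: "\<And>x. x \<in> XN \<Longrightarrow> \<bar>f x\<bar> \<le> M" using M0 by (force simp: M_def)+
  define e where "e = \<epsilon> / 8"
  define d where "d = \<epsilon> / (16 * M)"
  have e: "e > 0" and d: "d > 0" using \<epsilon> M by (auto simp: e_def d_def)
  define G where "G N = {w. \<forall>x\<in>XN. \<forall>y\<in>XN. prefix_word N x = w \<longrightarrow> prefix_word N y = w \<longrightarrow> \<bar>f x - f y\<bar> \<le> e}" for N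
  have incG: "incseq (\<lambda>N. cyl_set N (G N))"
  proof (intro incseq_SucI subsetI)
    fix N x assume x: "x \<in> cyl_set N (G N)"
    have "prefix_word N z = take N (prefix_word (Suc N) z)" for z :: "nat \<Rightarrow> nat" by (simp add: take_prefix_word)
    then have "\<And>y z. y \<in> XN \<Longrightarrow> z \<in> XN \<Longrightarrow> prefix_word (Suc N) y = prefix_word (Suc N) x \<Longrightarrow>
        prefix_word (Suc N) z = prefix_word (Suc N) x \<Longrightarrow> \<bar>f y - f z\<bar> \<le> e"
      using x unfolding cyl_set_def G_def by (metis (mono_tags, lifting) IntE mem_Collect_eq vimageE)
    then show "x \<in> cyl_set (Suc N) (G (Suc N))" using x by (auto simp: cyl_set_def G_def)
  qed
  have UG: "(\<Union>N. cyl_set N (G N)) = XN"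
  proof
    show "XN \<subseteq> (\<Union>N. cyl_set N (G N))"
    proof
      fix x assume x: "x \<in> XN"
      obtain N where N: "\<forall>y\<in>XN. agree N x y \<longrightarrow> \<bar>f x - f y\<bar> < e / 2"
        using continuous_on_agreeD[OF cont x, of "e / 2"] e by auto
      have "\<bar>f x - f y\<bar> < e / 2" if "y \<in> XN" "prefix_word N y = prefix_word N x" for y
      proof -
        have "agree N x y" unfolding agree_def using that(2) by (metis nth_prefix_word)
        then show ?thesis using N that(1) by blast
      qed
      then have "\<bar>f y - f z\<bar> \<le> e" if "y \<in> XN" "prefix_word N y = prefix_word N x" "z \<in> XN" "prefix_word N z = prefix_word N x" for y z
        using that(1,2) that(3,4) by (smt (verit) field_sum_of_halves)
      then have "x \<in> cyl_set N (G N)" using x by (auto simp: cyl_set_def G_def)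
      then show "x \<in> (\<Union>N. cyl_set N (G N))" by blast
    qed
  qed (auto simp: cyl_set_def)
  have "(\<lambda>N. measure \<nu> (cyl_set N (G N))) \<longlonglongrightarrow> measure \<nu> (\<Union>N. cyl_set N (G N))"
    using incG by (intro finite_Lim_measure_incseq) (auto simp: st)
  moreover have "measure \<nu> (\<Union>N. cyl_set N (G N)) = 1" unfolding UG using prob_space sp by simp
  ultimately have lN: "(\<lambda>N. measure \<nu> (cyl_set N (G N))) \<longlonglongrightarrow> 1" by simp
  have d1: "1 - d < 1" using d by simp
  obtain N where N: "1 - d < measure \<nu> (cyl_set N (G N))"
    using order_tendstoD(1)[OF lN d1] by (auto simp: eventually_sequentially)
  define H where "H m = {w \<in> G N. set w \<subseteq> {..m} \<and> length w = N}" for m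
  have finH: "finite (H m)" for m
    by (rule finite_subset[OF _ finite_lists_length_eq[OF finite_atMost[of m], of N]]) (auto simp: H_def)
  have "incseq (\<lambda>m. cyl_set N (H m))"
    unfolding incseq_def by (auto simp: cyl_set_def H_def)
  then have "(\<lambda>m. measure \<nu> (cyl_set N (H m))) \<longlonglongrightarrow> measure \<nu> (\<Union>m. cyl_set N (H m))"
    by (intro finite_Lim_measure_incseq) (auto simp: st)
  moreover have "(\<Union>m. cyl_set N (H m)) = cyl_set N (G N)"
  proof
    show "cyl_set N (G N) \<subseteq> (\<Union>m. cyl_set N (H m))"
    proof
      fix x assume x: "x \<in> cyl_set N (G N)"
      then have "x \<in> cyl_set N (H (Max (set (prefix_word N x))))"
        by (auto simp: cyl_set_def H_def intro!: Max_ge)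
      then show "x \<in> (\<Union>m. cyl_set N (H m))" by blast
    qed
  qed (auto simp: cyl_set_def H_def)
  ultimately have lm: "(\<lambda>m. measure \<nu> (cyl_set N (H m))) \<longlonglongrightarrow> measure \<nu> (cyl_set N (G N))" by simp
  obtain m where m: "1 - d < measure \<nu> (cyl_set N (H m))"
    using order_tendstoD(1)[OF lm N] by (auto simp: eventually_sequentially)
  define F where "F = H m"
  have F: "finite F" "\<And>w. w \<in> F \<Longrightarrow> length w = N" using finH by (auto simp: F_def H_def)
  have mF: "measure \<nu> (cyl_set N F) = (\<Sum>w\<in>F. measure \<nu> (cyl {1..} w))"
  proof -
    have "cyl_set N F = (\<Union>w\<in>F. cyl {1..} w)"
      using cyl_set_cyl[OF F(2)] by (auto simp: cyl_set_def)
    moreover have "disjoint_family_on (\<lambda>w. cyl {1..} w) F"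
      unfolding disjoint_family_on_def using cyl_set_cyl[OF F(2)] by fastforce
    ultimately show ?thesis using F(1) by (simp add: finite_measure_finite_Union st image_subset_iff)
  qed
  define h where "h w = f (SOME x. x \<in> cyl {1..} w)" for w :: "nat list"
  have h: "\<bar>f x - h w\<bar> \<le> e" and hM: "\<bar>h w\<bar> \<le> M" if w: "w \<in> F" and x: "x \<in> cyl {1..} w" for w x
  proof -
    have y: "(SOME x. x \<in> cyl {1..} w) \<in> cyl {1..} w" using x by (rule someI[of "\<lambda>x. x \<in> cyl {1..} w" x])
    then show "\<bar>h w\<bar> \<le> M" unfolding h_def by (intro fM) (simp add: cyl_iff)
    have "w \<in> G N" using w by (simp add: F_def H_def)
    then show "\<bar>f x - h w\<bar> \<le> e"
      using x y cyl_set_cyl[OF F(2)[OF w]] unfolding h_def G_def by blast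
  qed
  define \<delta> where "\<delta> = d / (card F + 1)"
  have \<delta>: "\<delta> > 0" using d by (simp add: \<delta>_def)
  have card\<delta>: "card F * \<delta> \<le> d" using d by (simp add: \<delta>_def field_simps)
  show thesis
  proof (rule that[OF F(1) \<delta>], intro ballI impI)
    fix \<mu> assume \<mu>: "\<mu> \<in> MX" and close: "\<forall>w\<in>F. \<bar>measure \<mu> (cyl {1..} w) - measure \<nu> (cyl {1..} w)\<bar> < \<delta>"
    let ?c = "\<lambda>\<mu> w. measure \<mu> (cyl {1..} w)"
    have fm: "f \<in> borel_measurable BX" by (rule measurable_continuous_XN[OF cont])
    have a1: "\<bar>(\<integral>x. f x \<partial>\<mu>) - (\<Sum>w\<in>F. h w * ?c \<mu> w)\<bar> \<le> e + M * (1 - (\<Sum>w\<in>F. ?c \<mu> w))"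
      by (rule integral_cyl_approx[OF \<mu> F fm fM h]) (use e in auto)
    have a2: "\<bar>(\<integral>x. f x \<partial>\<nu>) - (\<Sum>w\<in>F. h w * ?c \<nu> w)\<bar> \<le> e + M * (1 - (\<Sum>w\<in>F. ?c \<nu> w))"
      by (rule integral_cyl_approx[OF \<nu> F fm fM h]) (use e in auto)
    have diff: "\<bar>?c \<mu> w - ?c \<nu> w\<bar> \<le> \<delta>" if "w \<in> F" for w using close that by (simp add: less_imp_le)
    have "\<bar>(\<Sum>w\<in>F. ?c \<mu> w) - (\<Sum>w\<in>F. ?c \<nu> w)\<bar> \<le> (\<Sum>w\<in>F. \<bar>?c \<mu> w - ?c \<nu> w\<bar>)"
      unfolding sum_subtractf[symmetric] by (rule sum_abs)
    also have "\<dots> \<le> (\<Sum>w\<in>F. \<delta>)" by (intro sum_mono diff)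
    also have "\<dots> \<le> d" using card\<delta> by simp
    finally have b1: "\<bar>(\<Sum>w\<in>F. ?c \<mu> w) - (\<Sum>w\<in>F. ?c \<nu> w)\<bar> \<le> d" .
    have "\<bar>(\<Sum>w\<in>F. h w * ?c \<mu> w) - (\<Sum>w\<in>F. h w * ?c \<nu> w)\<bar> \<le> (\<Sum>w\<in>F. \<bar>h w * ?c \<mu> w - h w * ?c \<nu> w\<bar>)"
      unfolding sum_subtractf[symmetric] by (rule sum_abs)
    also have "\<dots> \<le> (\<Sum>w\<in>F. M * \<delta>)"
    proof (rule sum_mono)
      fix w assume w: "w \<in> F"
      show "\<bar>h w * ?c \<mu> w - h w * ?c \<nu> w\<bar> \<le> M * \<delta>"
      proof (cases "cyl {1..} w = {}")
        case True
        then show ?thesis using M \<delta> by simp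
      next
        case False
        then have "\<bar>h w\<bar> \<le> M" using hM[OF w] by blast
        then show ?thesis
          unfolding right_diff_distrib[symmetric] abs_mult using diff[OF w] by (intro mult_mono) auto
      qed
    qed
    also have "\<dots> \<le> M * d" using card\<delta> M by (simp add: mult.left_commute)
    finally have b2: "\<bar>(\<Sum>w\<in>F. h w * ?c \<mu> w) - (\<Sum>w\<in>F. h w * ?c \<nu> w)\<bar> \<le> M * d" .
    have m': "1 - d < (\<Sum>w\<in>F. ?c \<nu> w)" using m by (simp only: F_def[symmetric] mF)
    have "1 - (\<Sum>w\<in>F. ?c \<nu> w) \<le> d" using m' by linarith
    then have c1: "M * (1 - (\<Sum>w\<in>F. ?c \<nu> w)) \<le> M * d" using M by (intro mult_left_mono) auto
    have "1 - (\<Sum>w\<in>F. ?c \<mu> w) \<le> 2 * d" using m' b1 by linarith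
    then have c2: "M * (1 - (\<Sum>w\<in>F. ?c \<mu> w)) \<le> M * (2 * d)" using M by (intro mult_left_mono) auto
    have Md: "M * d = \<epsilon> / 16" using M by (simp add: d_def)
    have "M * (2 * d) = \<epsilon> / 8" using M by (simp add: d_def)
    then show "\<bar>(\<integral>x. f x \<partial>\<mu>) - (\<integral>x. f x \<partial>\<nu>)\<bar> < \<epsilon>"
      using a1 a2 b2 c1 c2 Md e_def \<epsilon> by linarith
  qed
qed

definition cyl_tendsto :: "(nat \<Rightarrow> (nat \<Rightarrow> nat) measure) \<Rightarrow> (nat \<Rightarrow> nat) measure \<Rightarrow> bool" where
  "cyl_tendsto \<nu>s \<nu> \<longleftrightarrow> (\<forall>w. (\<lambda>i. measure (\<nu>s i) (cyl {1..} w)) \<longlonglongrightarrow> measure \<nu> (cyl {1..} w))"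

lemma cyl_tendsto_integral:
  assumes \<nu>: "\<nu> \<in> MX" and \<nu>s: "\<And>i. \<nu>s i \<in> MX" and conv: "cyl_tendsto \<nu>s \<nu>" and f: "f \<in> CX"
  shows "(\<lambda>i. \<integral>x. f x \<partial>\<nu>s i) \<longlonglongrightarrow> (\<integral>x. f x \<partial>\<nu>)"
proof (rule tendstoI)
  fix \<epsilon> :: real assume \<epsilon>: "\<epsilon> > 0"
  obtain W \<delta> where W: "finite W" "\<delta> > 0"
    "\<forall>\<mu>\<in>MX. (\<forall>w\<in>W. \<bar>measure \<mu> (cyl {1..} w) - measure \<nu> (cyl {1..} w)\<bar> < \<delta>) \<longrightarrow>
      \<bar>(\<integral>x. f x \<partial>\<mu>) - (\<integral>x. f x \<partial>\<nu>)\<bar> < \<epsilon>"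
    by (rule cylinder_neighbourhood[OF \<nu> f \<epsilon>]) (rule that)
  have "\<forall>\<^sub>F i in sequentially. \<forall>w\<in>W. \<bar>measure (\<nu>s i) (cyl {1..} w) - measure \<nu> (cyl {1..} w)\<bar> < \<delta>"
  proof (rule eventually_ball_finite[OF W(1)], intro ballI)
    fix w
    have "(\<lambda>i. measure (\<nu>s i) (cyl {1..} w)) \<longlonglongrightarrow> measure \<nu> (cyl {1..} w)" using conv by (simp add: cyl_tendsto_def)
    from tendstoD[OF this W(2)]
    show "\<forall>\<^sub>F i in sequentially. \<bar>measure (\<nu>s i) (cyl {1..} w) - measure \<nu> (cyl {1..} w)\<bar> < \<delta>"
      by (simp add: dist_real_def)
  qed
  then show "\<forall>\<^sub>F i in sequentially. dist (\<integral>x. f x \<partial>\<nu>s i) (\<integral>x. f x \<partial>\<nu>) < \<epsilon>"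
  proof eventually_elim
    case (elim i)
    then show ?case using W(3) \<nu>s[of i] by (simp add: dist_real_def)
  qed
qed

lemma cyl_tendsto_weak_star:
  assumes \<nu>: "\<nu> \<in> MX" and \<nu>s: "\<And>i. \<nu>s i \<in> MX" and conv: "cyl_tendsto \<nu>s \<nu>"
    and G: "openin weak_star G" "\<nu> \<in> G"
  shows "\<forall>\<^sub>F i in sequentially. \<nu>s i \<in> G"
proof -
  have "generate_topology_on {{\<mu> \<in> MX. (LINT x|\<mu>. f x) \<in> U} | f U. f \<in> CX \<and> open U} G"
    using G(1) by (simp add: weak_star_def openin_topology_generated_by_iff)
  then show ?thesis using G(2)
  proof induction
    case (Int a b)
    then show ?case by (auto simp: eventually_conj_iff)
  next
    case (UN K)
    then obtain k where k: "k \<in> K" "\<nu> \<in> k" by auto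
    from UN.IH[OF k] show ?case by eventually_elim (use k in auto)
  next
    case (Basis s)
    then obtain f U where s: "s = {\<mu> \<in> MX. (LINT x|\<mu>. f x) \<in> U}" "f \<in> CX" "open U" by auto
    have "(LINT x|\<nu>. f x) \<in> U" using Basis.prems s by simp
    from topological_tendstoD[OF cyl_tendsto_integral[OF \<nu> \<nu>s conv s(2)] s(3) this]
    show ?case by eventually_elim (simp add: s \<nu>s)
  qed simp
qed

text \<open>The supremum of the free energy over any neighbourhood of \<open>\<nu>\<close> is at least 0 because of the \<open>\<nu>s\<close>, and
  at most 0 by the variational inequality.\<close>

lemma (in finite_pressure) rate_function_limit:
  assumes \<nu>: "\<nu> \<in> MX" and \<nu>s: "\<And>i. \<nu>s i \<in> MX" and conv: "cyl_tendsto \<nu>s \<nu>"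
    and fe: "\<And>\<epsilon>. \<epsilon> > 0 \<Longrightarrow> \<forall>\<^sub>F i in sequentially. ereal (- \<epsilon>) \<le> free_energy \<phi> (\<nu>s i)"
  shows "rate_function \<phi> \<nu> = 0"
proof -
  have "(SUP \<mu>\<in>G. free_energy \<phi> \<mu>) = 0" if G: "openin weak_star G" "\<nu> \<in> G" for G
  proof (rule antisym)
    show "(SUP \<mu>\<in>G. free_energy \<phi> \<mu>) \<le> 0" by (rule SUP_least) (rule free_energy_le_0)
    show "0 \<le> (SUP \<mu>\<in>G. free_energy \<phi> \<mu>)"
    proof (rule ereal_le_epsilon2)
      fix \<epsilon> :: real assume "\<epsilon> > 0"
      from eventually_conj[OF fe[OF this] cyl_tendsto_weak_star[OF \<nu> \<nu>s conv G]]
      obtain i where i: "ereal (- \<epsilon>) \<le> free_energy \<phi> (\<nu>s i)" "\<nu>s i \<in> G"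
        by (auto simp: eventually_sequentially)
      have "ereal (- \<epsilon>) \<le> (SUP \<mu>\<in>G. free_energy \<phi> \<mu>)"
        using i by (intro SUP_upper2[of "\<nu>s i"])
      then have "ereal (- \<epsilon>) + ereal \<epsilon> \<le> (SUP \<mu>\<in>G. free_energy \<phi> \<mu>) + ereal \<epsilon>" by (rule add_right_mono)
      then show "0 \<le> (SUP \<mu>\<in>G. free_energy \<phi> \<mu>) + ereal \<epsilon>" by (simp add: zero_ereal_def)
    qed
  qed
  moreover have "openin weak_star MX" using openin_topspace[of weak_star] by (simp add: topspace_weak_star)
  ultimately have "(INF G\<in>{G. openin weak_star G \<and> \<nu> \<in> G}. SUP \<mu>\<in>G. free_energy \<phi> \<mu>) = 0"
    using \<nu> by (intro INF_eq_const) auto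
  then show ?thesis by (simp add: rate_function_def)
qed

section \<open>Concentration of Birkhoff averages\<close>

lemma finite_subset_prob:
  assumes "c < measure_pmf.prob p A"
  obtains F where "finite F" "F \<subseteq> A" "c < measure_pmf.prob p F"
proof -
  have "\<exists>F. finite F \<and> F \<subseteq> A \<and> c < sum (pmf p) F"
  proof (rule ccontr)
    assume "\<not> ?thesis"
    then have "measure_pmf.prob p A \<le> c" by (intro pmf_prob_le) (meson not_le)
    then show False using assms by simp
  qed
  then show thesis using that by (auto simp: measure_measure_pmf_finite)
qed

lemma birkhoff_agree:
  assumes dep: "\<And>x y. x \<in> XN \<Longrightarrow> y \<in> XN \<Longrightarrow> agree N x y \<Longrightarrow> f x = f y"
    and bd: "\<And>x. x \<in> XN \<Longrightarrow> \<bar>f x\<bar> \<le> 1" and xy: "x \<in> XN" "y \<in> XN" "agree n x y"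
  shows "\<bar>birkhoff n f x - birkhoff n f y\<bar> \<le> 2 * real N"
proof -
  let ?d = "\<lambda>k. f ((shift_map ^^ k) x) - f ((shift_map ^^ k) y)"
  have z: "?d k = 0" if "k + N \<le> n" for k
  proof -
    have "agree N ((shift_map ^^ k) x) ((shift_map ^^ k) y)"
      by (rule agree_shift) (use xy(3) that in \<open>auto intro: agree_mono\<close>)
    then show ?thesis using dep[OF shift_pow_XN[OF xy(1)] shift_pow_XN[OF xy(2)]] by simp
  qed
  have b: "\<bar>?d k\<bar> \<le> 2" for k
    using bd[OF shift_pow_XN[OF xy(1), of k]] bd[OF shift_pow_XN[OF xy(2), of k]] by linarith
  have "\<bar>birkhoff n f x - birkhoff n f y\<bar> \<le> (\<Sum>k<n. \<bar>?d k\<bar>)"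
    unfolding birkhoff_def sum_subtractf[symmetric] by (rule sum_abs)
  also have "\<dots> = (\<Sum>k\<in>{n-N..<n}. \<bar>?d k\<bar>)"
  proof (rule sum.mono_neutral_right)
    show "\<forall>k\<in>{..<n} - {n - N..<n}. \<bar>?d k\<bar> = 0" using z by force
  qed auto
  also have "\<dots> \<le> (\<Sum>k\<in>{n-N..<n}. 2)" by (intro sum_mono b)
  also have "\<dots> \<le> 2 * real N" by simp
  finally show ?thesis .
qed

context finite_pressure
begin

text \<open>The contrapositive of a large deviation upper bound: deviations whose probability does not vanish
  are realised by a measure at which the rate function vanishes.\<close>

lemma deviation_limit:
  assumes dep: "\<And>x y. x \<in> XN \<Longrightarrow> y \<in> XN \<Longrightarrow> agree N x y \<Longrightarrow> f x = f y"
    and bd: "\<And>x. x \<in> XN \<Longrightarrow> \<bar>f x\<bar> \<le> 1" and f: "f \<in> CX" and \<delta>: "\<delta> > 0"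
    and inf: "\<forall>n0. \<exists>n\<ge>n0. \<delta> \<le> measure_pmf.prob (per_pmf n) {x. real n * c \<le> birkhoff n f x}"
  obtains \<nu> where "\<nu> \<in> MX" "rate_function \<phi> \<nu> = 0" "c \<le> (\<integral>x. f x \<partial>\<nu>)"
proof -
  have fm: "f \<in> borel_measurable BX" using f measurable_continuous_XN by (simp add: CX_def)
  obtain u L where u: "\<And>k. 0 \<le> u k" "filterlim u at_top sequentially"
    and lim0: "(\<lambda>n. measure_pmf.prob (per_pmf n) {x. real n * L < (\<Sum>k<n. u (x k))}) \<longlonglongrightarrow> 0"
    by (rule tight_periodic) (rule that)
  have \<delta>2: "\<delta> / 2 > 0" "\<delta> / 4 > 0" using \<delta> by auto
  obtain n1 where n1: "\<And>n. n \<ge> n1 \<Longrightarrow> measure_pmf.prob (per_pmf n) {x. real n * L < (\<Sum>k<n. u (x k))} < \<delta> / 2"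
    using order_tendstoD(2)[OF lim0 \<delta>2(1)] by (auto simp: eventually_sequentially)
  \<comment> \<open>The properties of the block measure at time \<open>n\<close>: almost maximal free energy, large integral of \<open>f\<close>, tightness.\<close>
  define good where "good n \<nu> \<longleftrightarrow> \<nu> \<in> MX_inv \<and>
    (\<forall>\<epsilon> C. (\<forall>x\<in>XN. \<forall>y\<in>XN. agree n x y \<longrightarrow> \<bar>birkhoff n \<phi> x - birkhoff n \<phi> y\<bar> \<le> real n * \<epsilon> + C) \<longrightarrow>
        ereal ((ln (\<delta> / 4) - 2 * C) / real n - 2 * \<epsilon>) \<le> free_energy \<phi> \<nu>) \<and>
    real n * c - 2 * real N \<le> real n * (\<integral>x. f x \<partial>\<nu>) \<and>
    (\<forall>M U. 0 < U \<longrightarrow> (\<forall>p>M. U \<le> u p) \<longrightarrow> measure \<nu> {x \<in> XN. M < x 0} \<le> L / U)" for n \<nu>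
  have ex: "\<exists>n \<nu>. i < n \<and> good n \<nu>" for i
  proof -
    obtain n where n: "n \<ge> max (Suc i) n1" "\<delta> \<le> measure_pmf.prob (per_pmf n) {x. real n * c \<le> birkhoff n f x}"
      using inf by blast
    have n0: "n > 0" and ni: "i < n" using n(1) by auto
    let ?A = "{x. real n * c \<le> birkhoff n f x}" and ?B = "{x. real n * L < (\<Sum>k<n. u (x k))}"
    have "measure_pmf.prob (per_pmf n) ?A \<le> measure_pmf.prob (per_pmf n) ((?A - ?B) \<inter> EN n \<union> (?B \<union> - EN n))"
      by (rule measure_pmf.finite_measure_mono) auto
    also have "\<dots> \<le> measure_pmf.prob (per_pmf n) ((?A - ?B) \<inter> EN n) + measure_pmf.prob (per_pmf n) (?B \<union> - EN n)"
      by (rule measure_Un_le) auto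
    also have "measure_pmf.prob (per_pmf n) (?B \<union> - EN n) \<le> measure_pmf.prob (per_pmf n) ?B + measure_pmf.prob (per_pmf n) (- EN n)"
      by (rule measure_Un_le) auto
    also have "measure_pmf.prob (per_pmf n) (- EN n) = 0"
      by (simp add: measure_pmf_zero_iff set_per_pmf[OF n0])
    finally have "\<delta> \<le> measure_pmf.prob (per_pmf n) ((?A - ?B) \<inter> EN n) + measure_pmf.prob (per_pmf n) ?B"
      using n(2) by linarith
    then have "\<delta> / 4 < measure_pmf.prob (per_pmf n) ((?A - ?B) \<inter> EN n)"
      using n1[of n] n(1) \<delta> by simp
    then obtain S where S: "finite S" "S \<subseteq> (?A - ?B) \<inter> EN n" "\<delta> / 4 < measure_pmf.prob (per_pmf n) S"
      by (rule finite_subset_prob) (rule that)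
    have SE: "S \<subseteq> EN n" and SA: "\<And>y. y \<in> S \<Longrightarrow> real n * c \<le> birkhoff n f y"
      and SB: "\<And>y. y \<in> S \<Longrightarrow> (\<Sum>k<n. u (y k)) \<le> real n * L" using S(2) by (auto simp: not_less)
    have Qpos: "0 < measure_pmf.prob (per_pmf n) S" using S(3) \<delta> by simp
    obtain \<nu> where \<nu>: "\<nu> \<in> MX_inv"
      and fe: "\<And>\<epsilon> C. (\<And>x y. x \<in> XN \<Longrightarrow> y \<in> XN \<Longrightarrow> agree n x y \<Longrightarrow>
        \<bar>birkhoff n \<phi> x - birkhoff n \<phi> y\<bar> \<le> real n * \<epsilon> + C) \<Longrightarrow>
        ereal ((ln (measure_pmf.prob (per_pmf n) S) - 2 * C) / real n - 2 * \<epsilon>) \<le> free_energy \<phi> \<nu>"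
      and int: "\<And>f B l. f \<in> borel_measurable BX \<Longrightarrow> (\<And>x. x \<in> XN \<Longrightarrow> \<bar>f x\<bar> \<le> B) \<Longrightarrow>
        (\<And>x y. x \<in> XN \<Longrightarrow> y \<in> S \<Longrightarrow> agree n x y \<Longrightarrow> l \<le> birkhoff n f x) \<Longrightarrow> l \<le> real n * (\<integral>x. f x \<partial>\<nu>)"
      using large_block_measure[OF n0 S(1) SE refl Qpos] by (metis (no_types, lifting))
    have MX: "\<nu> \<in> MX" using \<nu> by (simp add: MX_inv_def)
    interpret prob_space \<nu> using MX by (simp add: MX_def)
    have "good n \<nu>"
      unfolding good_def
    proof (intro conjI allI impI)
      fix \<epsilon> C assume d: "\<forall>x\<in>XN. \<forall>y\<in>XN. agree n x y \<longrightarrow> \<bar>birkhoff n \<phi> x - birkhoff n \<phi> y\<bar> \<le> real n * \<epsilon> + C"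
      have "(ln (\<delta> / 4) - 2 * C) / real n - 2 * \<epsilon> \<le> (ln (measure_pmf.prob (per_pmf n) S) - 2 * C) / real n - 2 * \<epsilon>"
        using S(3) \<delta>2 Qpos by (intro diff_right_mono divide_right_mono) auto
      then have "ereal ((ln (\<delta> / 4) - 2 * C) / real n - 2 * \<epsilon>) \<le> ereal ((ln (measure_pmf.prob (per_pmf n) S) - 2 * C) / real n - 2 * \<epsilon>)"
        by simp
      also have "\<dots> \<le> free_energy \<phi> \<nu>" by (rule fe) (use d in blast)
      finally show "ereal ((ln (\<delta> / 4) - 2 * C) / real n - 2 * \<epsilon>) \<le> free_energy \<phi> \<nu>" .
    next
      show "real n * c - 2 * real N \<le> real n * (\<integral>x. f x \<partial>\<nu>)"
      proof (rule int[OF fm bd])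
        fix x y assume xy: "x \<in> XN" "y \<in> S" "agree n x y"
        have y: "y \<in> XN" using xy(2) SE EN_XN by blast
        show "real n * c - 2 * real N \<le> birkhoff n f x"
          using birkhoff_agree[of N f x y n, OF dep bd xy(1) y xy(3)] SA[OF xy(2)] by linarith
      qed
    next
      fix M :: nat and U :: real assume U: "0 < U" "\<forall>p>M. U \<le> u p"
      let ?V = "{x \<in> XN. M < x 0}"
      define g where "g x = - indicat_real ?V x" for x
      have V: "?V \<in> sets BX"
        using measurable_sets[OF coord_measurable[of 0], of "{M<..}"] by (simp add: vimage_def Int_def conj_commute)
      have "- (real n * L / U) \<le> real n * (\<integral>x. g x \<partial>\<nu>)"
      proof (rule int)
        show "g \<in> borel_measurable BX" unfolding g_def using V by simp
        show "\<bar>g x\<bar> \<le> 1" for x by (simp add: g_def indicator_def)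
        fix x y assume xy: "x \<in> XN" "y \<in> S" "agree n x y"
        have "- birkhoff n g x = (\<Sum>k<n. indicat_real ?V ((shift_map ^^ k) x))"
          by (simp add: birkhoff_def g_def sum_negf)
        also have "\<dots> \<le> (\<Sum>k<n. u (y k) / U)"
        proof (rule sum_mono)
          fix k assume "k \<in> {..<n}"
          then have xk: "x k = y k" using xy(3) by (simp add: agree_def)
          show "indicat_real ?V ((shift_map ^^ k) x) \<le> u (y k) / U"
          proof (cases "M < y k")
            case True
            then have "1 \<le> u (y k) / U" using U by simp
            then show ?thesis by (simp add: indicator_def)
          next
            case False
            then show ?thesis using u(1) U(1) xk by (simp add: indicator_def shift_pow)
          qed
        qed
        also have "\<dots> \<le> real n * L / U"
          unfolding sum_divide_distrib[symmetric] using SB[OF xy(2)] U(1) by (intro divide_right_mono) auto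
        finally show "- (real n * L / U) \<le> birkhoff n g x" by simp
      qed
      moreover have "(\<integral>x. g x \<partial>\<nu>) = - measure \<nu> ?V"
      proof -
        have "?V \<inter> space \<nu> = ?V" by (auto simp: space_MX[OF MX])
        then show ?thesis by (simp add: g_def)
      qed
      ultimately have "real n * measure \<nu> ?V \<le> real n * (L / U)" by simp
      then show "measure \<nu> ?V \<le> L / U" by (rule mult_left_le_imp_le) (use n0 in simp)
    qed (rule \<nu>)
    then show ?thesis using ni by blast
  qed
  then obtain n \<nu>s where n: "\<And>i. i < n i" and good: "\<And>i. good (n i) (\<nu>s i)" by metis
  have inv: "\<nu>s i \<in> MX_inv" for i using good[of i] by (simp add: good_def)
  have tight: "\<exists>M. \<forall>i. measure (\<nu>s i) {x \<in> XN. M < x 0} \<le> \<epsilon>" if \<epsilon>: "\<epsilon> > 0" for \<epsilon>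
  proof -
    \<comment> \<open>Then \<open>L / U \<le> \<epsilon>\<close>, also for negative \<open>L\<close>.\<close>
    define U where "U = (\<bar>L\<bar> + 1) / \<epsilon>"
    have U: "U > 0" using \<epsilon> by (simp add: U_def add_nonneg_pos)
    have "L / U \<le> (\<bar>L\<bar> + 1) / U" by (rule divide_right_mono) (use U in auto)
    also have "\<bar>L\<bar> + 1 \<noteq> 0" by linarith
    then have "(\<bar>L\<bar> + 1) / U = \<epsilon>" by (simp add: U_def)
    finally have LU: "L / U \<le> \<epsilon>" .
    obtain M where M: "\<And>p. p \<ge> M \<Longrightarrow> U \<le> u p"
      using u(2) unfolding filterlim_at_top eventually_sequentially by blast
    have "\<forall>p>M. U \<le> u p" using M by auto
    then have "measure (\<nu>s i) {x \<in> XN. M < x 0} \<le> L / U" for i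
      using good[of i] U unfolding good_def by blast
    then show ?thesis using order_trans[OF _ LU] by blast
  qed
  obtain \<nu> r where \<nu>: "\<nu> \<in> MX" and r: "strict_mono (r :: nat \<Rightarrow> nat)"
    and lim: "\<And>w. (\<lambda>i. measure (\<nu>s (r i)) (cyl {1..} w)) \<longlonglongrightarrow> measure \<nu> (cyl {1..} w)"
    by (rule tight_cylinder_subsequence[OF inv], erule tight) (rule that)
  have conv: "cyl_tendsto (\<lambda>i. \<nu>s (r i)) \<nu>" using lim by (simp add: cyl_tendsto_def)
  have MXs: "\<nu>s (r i) \<in> MX" for i using inv by (simp add: MX_inv_def)
  have nr: "i < n (r i)" for i using n[of "r i"] seq_suble[OF r, of i] by simp
  have inf0: "(\<lambda>i. a / real (n (r i))) \<longlonglongrightarrow> 0" for a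
  proof -
    have "filterlim (\<lambda>i. n (r i)) at_top sequentially"
      by (rule filterlim_at_top_mono[OF filterlim_ident]) (auto intro: always_eventually less_imp_le nr)
    then show ?thesis
      by (intro tendsto_divide_0[OF tendsto_const] filterlim_at_top_imp_at_infinity filterlim_compose[OF filterlim_real_sequentially])
  qed
  have "rate_function \<phi> \<nu> = 0"
  proof (rule rate_function_limit[OF \<nu> MXs conv])
    fix \<epsilon> :: real assume \<epsilon>: "\<epsilon> > 0"
    then have \<epsilon>4: "\<epsilon> / 4 > 0" by simp
    obtain C where C: "C \<ge> 0" "\<And>n x y. x \<in> XN \<Longrightarrow> y \<in> XN \<Longrightarrow> agree n x y \<Longrightarrow>
      \<bar>birkhoff n \<phi> x - birkhoff n \<phi> y\<bar> \<le> real n * (\<epsilon> / 4) + C"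
      by (rule distortion[OF tame \<epsilon>4]) (rule that)
    have "- (\<epsilon> / 4) < (0 :: real)" using \<epsilon> by simp
    from order_tendstoD(1)[OF inf0[of "ln (\<delta> / 4) - 2 * C"] this]
    show "\<forall>\<^sub>F i in sequentially. ereal (- \<epsilon>) \<le> free_energy \<phi> (\<nu>s (r i))"
    proof eventually_elim
      case (elim i)
      have "ereal (- \<epsilon>) \<le> ereal ((ln (\<delta> / 4) - 2 * C) / real (n (r i)) - 2 * (\<epsilon> / 4))"
        using elim \<epsilon> by simp
      also have "\<dots> \<le> free_energy \<phi> (\<nu>s (r i))"
        using good[of "r i"] C(2) unfolding good_def by blast
      finally show ?case .
    qed
  qed
  moreover have "c \<le> (\<integral>x. f x \<partial>\<nu>)"
  proof (rule LIMSEQ_le[OF _ cyl_tendsto_integral[OF \<nu> MXs conv f]])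
    show "(\<lambda>i. c - 2 * real N / real (n (r i))) \<longlonglongrightarrow> c"
      using tendsto_diff[OF tendsto_const[of c] inf0[of "2 * real N"]] by simp
    have "c - 2 * real N / real (n (r i)) \<le> (\<integral>x. f x \<partial>\<nu>s (r i))" for i
    proof -
      have "real (n (r i)) * c - 2 * real N \<le> real (n (r i)) * (\<integral>x. f x \<partial>\<nu>s (r i))"
        using good[of "r i"] by (simp add: good_def)
      moreover have "0 < real (n (r i))" using nr[of i] by simp
      ultimately show ?thesis by (simp add: field_simps)
    qed
    then show "\<exists>k. \<forall>i\<ge>k. c - 2 * real N / real (n (r i)) \<le> (\<integral>x. f x \<partial>\<nu>s (r i))" by blast
  qed
  ultimately show thesis using \<nu> that by blast
qed

end

text \<open>Through these measures, \<open>cylinder_neighbourhood\<close> applies to Birkhoff averages.\<close>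

definition empirical :: "nat \<Rightarrow> (nat \<Rightarrow> nat) \<Rightarrow> (nat \<Rightarrow> nat) measure" where
  "empirical n x = distr (measure_pmf (pmf_of_set {..<n})) BX (\<lambda>k. (shift_map ^^ k) x)"

lemma empirical:
  assumes x: "x \<in> XN" and n: "n > 0"
  shows "empirical n x \<in> MX"
    and "f \<in> borel_measurable BX \<Longrightarrow> (\<integral>y. f y \<partial>empirical n x) = birkhoff n f x / real n"
    and "measure (empirical n x) (cyl {1..} w) = birkhoff n (indicat_real (cyl {1..} w)) x / real n"
proof -
  have m: "(\<lambda>k. (shift_map ^^ k) x) \<in> measure_pmf (pmf_of_set {..<n}) \<rightarrow>\<^sub>M BX"
    using shift_pow_XN[OF x] by simp
  show MX: "empirical n x \<in> MX"
    unfolding MX_def empirical_def BX_def[symmetric] using measure_pmf.prob_space_distr[OF m] by simp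
  show int: "(\<integral>y. f y \<partial>empirical n x) = birkhoff n f x / real n" if "f \<in> borel_measurable BX" for f :: "_ \<Rightarrow> real"
    unfolding empirical_def birkhoff_def using n that
    by (subst integral_distr[OF m]) (auto simp: integral_pmf_of_set lessThan_empty_iff)
  have "cyl {1..} w \<inter> space (empirical n x) = cyl {1..} w" by (auto simp: space_MX[OF MX] cyl_iff)
  then show "measure (empirical n x) (cyl {1..} w) = birkhoff n (indicat_real (cyl {1..} w)) x / real n"
    using int[of "indicat_real (cyl {1..} w)"] by simp
qed

lemma cyl_indicator_CX: "(\<lambda>x. s * indicat_real (cyl {1..} w) x) \<in> CX"
  unfolding CX_def mem_Collect_eq
proof
  have eq: "indicat_real (cyl {1..} w) x = indicat_real (cyl {1..} w) y" if "x \<in> XN" "y \<in> XN" "agree (length w) x y" for x y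
    using that by (auto simp: indicator_def cyl_iff agree_def)
  show "continuous_on XN (\<lambda>x. s * indicat_real (cyl {1..} w) x)"
  proof (rule continuous_onI_agree)
    fix x and \<epsilon> :: real assume "x \<in> XN" "\<epsilon> > 0"
    then show "\<exists>N. \<forall>y\<in>XN. agree N x y \<longrightarrow> \<bar>s * indicat_real (cyl {1..} w) x - s * indicat_real (cyl {1..} w) y\<bar> \<le> \<epsilon>"
      using eq[of x] by (intro exI[of _ "length w"]) auto
  qed
  show "bounded ((\<lambda>x. s * indicat_real (cyl {1..} w) x) ` XN)"
    by (rule boundedI[of _ "\<bar>s\<bar>"]) (auto simp: indicator_def)
qed

locale unique_equilibrium = finite_pressure +
  fixes \<mu> :: "(nat \<Rightarrow> nat) measure"
  assumes unique: "{\<nu> \<in> MX. rate_function \<phi> \<nu> = 0} = {\<mu>}"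
begin

lemma \<mu>_MX: "\<mu> \<in> MX" using unique by auto

text \<open>The signs \<open>s = 1\<close> and \<open>s = -1\<close> give the two directions of deviation.\<close>

lemma cylinder_deviation:
  assumes s: "\<bar>s\<bar> = 1" and \<epsilon>: "\<epsilon> > 0"
  shows "(\<lambda>n. measure_pmf.prob (per_pmf n) {x. real n * (s * measure \<mu> (cyl {1..} w) + \<epsilon>) \<le> birkhoff n (\<lambda>x. s * indicat_real (cyl {1..} w) x) x}) \<longlonglongrightarrow> 0"
    (is "?p \<longlonglongrightarrow> 0")
proof (rule ccontr)
  let ?f = "\<lambda>x. s * indicat_real (cyl {1..} w) x"
  assume "\<not> ?p \<longlonglongrightarrow> 0"
  then obtain \<delta> where \<delta>: "\<delta> > 0" "\<forall>n0. \<exists>n\<ge>n0. \<delta> \<le> ?p n"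
    unfolding LIMSEQ_def by (auto simp: not_less)
  obtain \<nu> where \<nu>: "\<nu> \<in> MX" "rate_function \<phi> \<nu> = 0" "s * measure \<mu> (cyl {1..} w) + \<epsilon> \<le> (\<integral>x. ?f x \<partial>\<nu>)"
  proof (rule deviation_limit[OF _ _ cyl_indicator_CX \<delta>])
    show "?f x = ?f y" if "x \<in> XN" "y \<in> XN" "agree (length w) x y" for x y
      using that by (auto simp: indicator_def cyl_iff agree_def)
    show "\<bar>?f x\<bar> \<le> 1" for x using s by (auto simp: indicator_def)
  qed (rule that)
  then have "\<nu> = \<mu>" using unique by auto
  moreover have "cyl {1..} w \<inter> space \<mu> = cyl {1..} w" by (auto simp: space_MX[OF \<mu>_MX] cyl_iff)
  ultimately have "s * measure \<mu> (cyl {1..} w) + \<epsilon> \<le> s * measure \<mu> (cyl {1..} w)" using \<nu>(3) by simp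
  then show False using \<epsilon> by simp
qed

text \<open>Convergence in probability with respect to the weighted periodic points.\<close>

definition conv_prob :: "(nat \<Rightarrow> (nat \<Rightarrow> nat) \<Rightarrow> real) \<Rightarrow> real \<Rightarrow> bool" where
  "conv_prob Q q \<longleftrightarrow> (\<forall>\<epsilon>>0. (\<lambda>n. measure_pmf.prob (per_pmf n) {x. \<epsilon> \<le> \<bar>Q n x - q\<bar>}) \<longlonglongrightarrow> 0)"

lemma prob_per_tendsto_0:
  assumes A: "\<And>j. j \<in> J \<Longrightarrow> (\<lambda>n. measure_pmf.prob (per_pmf n) (A j n)) \<longlonglongrightarrow> 0" and J: "finite J"
    and sub: "\<And>n x. n > 0 \<Longrightarrow> x \<in> EN n \<Longrightarrow> x \<in> B n \<Longrightarrow> \<exists>j\<in>J. x \<in> A j n"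
  shows "(\<lambda>n. measure_pmf.prob (per_pmf n) (B n)) \<longlonglongrightarrow> 0"
proof (rule tendsto_sandwich[OF _ _ tendsto_const])
  show "(\<lambda>n. \<Sum>j\<in>J. measure_pmf.prob (per_pmf n) (A j n)) \<longlonglongrightarrow> 0"
    using tendsto_sum[of J "\<lambda>j n. measure_pmf.prob (per_pmf n) (A j n)" "\<lambda>_. 0" sequentially] A by simp
  show "\<forall>\<^sub>F n in sequentially. measure_pmf.prob (per_pmf n) (B n) \<le> (\<Sum>j\<in>J. measure_pmf.prob (per_pmf n) (A j n))"
    using eventually_gt_at_top[of 0]
  proof eventually_elim
    case (elim n)
    have "measure_pmf.prob (per_pmf n) (B n) = measure_pmf.prob (per_pmf n) (B n \<inter> EN n)"
      using measure_Int_set_pmf[of "per_pmf n" "B n"] by (simp add: set_per_pmf[OF elim])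
    also have "\<dots> \<le> measure_pmf.prob (per_pmf n) (\<Union>j\<in>J. A j n)"
      by (rule measure_pmf.finite_measure_mono) (use sub[OF elim] in auto)
    also have "\<dots> \<le> (\<Sum>j\<in>J. measure_pmf.prob (per_pmf n) (A j n))"
      by (rule measure_pmf.finite_measure_subadditive_finite[OF J]) auto
    finally show ?case .
  qed
qed auto

lemma conv_prob_cylinder: "conv_prob (\<lambda>n x. birkhoff n (indicat_real (cyl {1..} w)) x / real n) (measure \<mu> (cyl {1..} w))"
  unfolding conv_prob_def
proof (intro allI impI)
  fix \<epsilon> :: real assume \<epsilon>: "\<epsilon> > 0"
  let ?m = "measure \<mu> (cyl {1..} w)" and ?b = "\<lambda>n s x. birkhoff n (\<lambda>x. s * indicat_real (cyl {1..} w) x) x"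
  have b: "?b n s x = s * birkhoff n (indicat_real (cyl {1..} w)) x" for n s x
    by (simp add: birkhoff_def sum_distrib_left)
  show "(\<lambda>n. measure_pmf.prob (per_pmf n) {x. \<epsilon> \<le> \<bar>birkhoff n (indicat_real (cyl {1..} w)) x / real n - ?m\<bar>}) \<longlonglongrightarrow> 0"
  proof (rule prob_per_tendsto_0)
    show "(\<lambda>n. measure_pmf.prob (per_pmf n) {x. real n * (s * ?m + \<epsilon>) \<le> ?b n s x}) \<longlonglongrightarrow> 0" if "s \<in> {1, -1}" for s
      using that by (intro cylinder_deviation \<epsilon>) auto
    fix n x assume n: "n > 0" and "x \<in> {x. \<epsilon> \<le> \<bar>birkhoff n (indicat_real (cyl {1..} w)) x / real n - ?m\<bar>}"
    then have "\<epsilon> \<le> birkhoff n (indicat_real (cyl {1..} w)) x / real n - ?m \<or> \<epsilon> \<le> ?m - birkhoff n (indicat_real (cyl {1..} w)) x / real n"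
      by auto
    then have "real n * (?m + \<epsilon>) \<le> birkhoff n (indicat_real (cyl {1..} w)) x \<or> real n * (- ?m + \<epsilon>) \<le> - birkhoff n (indicat_real (cyl {1..} w)) x"
      using n by (simp add: field_simps)
    then show "\<exists>s\<in>{1, -1}. x \<in> {x. real n * (s * ?m + \<epsilon>) \<le> ?b n s x}" by (simp add: b)
  qed simp
qed

lemma conv_prob_birkhoff:
  assumes f: "f \<in> CX"
  shows "conv_prob (\<lambda>n x. birkhoff n f x / real n) (\<integral>x. f x \<partial>\<mu>)"
  unfolding conv_prob_def
proof (intro allI impI)
  fix \<epsilon> :: real assume \<epsilon>: "\<epsilon> > 0"
  obtain W \<delta> where W: "finite W" "\<delta> > 0"
    "\<forall>\<nu>\<in>MX. (\<forall>w\<in>W. \<bar>measure \<nu> (cyl {1..} w) - measure \<mu> (cyl {1..} w)\<bar> < \<delta>) \<longrightarrow>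
      \<bar>(\<integral>x. f x \<partial>\<nu>) - (\<integral>x. f x \<partial>\<mu>)\<bar> < \<epsilon>"
    by (rule cylinder_neighbourhood[OF \<mu>_MX f \<epsilon>]) (rule that)
  have fm: "f \<in> borel_measurable BX" using f measurable_continuous_XN by (simp add: CX_def)
  show "(\<lambda>n. measure_pmf.prob (per_pmf n) {x. \<epsilon> \<le> \<bar>birkhoff n f x / real n - (\<integral>x. f x \<partial>\<mu>)\<bar>}) \<longlonglongrightarrow> 0"
  proof (rule prob_per_tendsto_0[OF _ W(1)])
    fix w
    show "(\<lambda>n. measure_pmf.prob (per_pmf n) {x. \<delta> \<le> \<bar>birkhoff n (indicat_real (cyl {1..} w)) x / real n - measure \<mu> (cyl {1..} w)\<bar>}) \<longlonglongrightarrow> 0"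
      using conv_prob_cylinder[of w] W(2) unfolding conv_prob_def by blast
  next
    fix n x assume n: "n > 0" and x: "x \<in> EN n" and far: "x \<in> {x. \<epsilon> \<le> \<bar>birkhoff n f x / real n - (\<integral>x. f x \<partial>\<mu>)\<bar>}"
    note e = empirical[OF EN_XN[OF x] n]
    have "\<not> \<bar>(\<integral>y. f y \<partial>empirical n x) - (\<integral>x. f x \<partial>\<mu>)\<bar> < \<epsilon>" using far by (simp add: e(2)[OF fm])
    then have "\<not> (\<forall>w\<in>W. \<bar>measure (empirical n x) (cyl {1..} w) - measure \<mu> (cyl {1..} w)\<bar> < \<delta>)" using W(3) e(1) by blast
    then show "\<exists>w\<in>W. x \<in> {x. \<delta> \<le> \<bar>birkhoff n (indicat_real (cyl {1..} w)) x / real n - measure \<mu> (cyl {1..} w)\<bar>}"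
      by (auto simp: e(3) not_less)
  qed
qed

end

section \<open>Averages over periodic points\<close>

lemma CX_bounded:
  assumes "f \<in> CX"
  obtains M where "M \<ge> 0" "\<And>x. x \<in> XN \<Longrightarrow> \<bar>f x\<bar> \<le> M"
proof -
  obtain M where "\<forall>y\<in>f ` XN. norm y \<le> M" using assms unfolding CX_def bounded_iff by blast
  then have "\<bar>f x\<bar> \<le> max M 0" if "x \<in> XN" for x using that by force
  then show thesis by (intro that[of "max M 0"]) auto
qed

lemma CX_measurable: "f \<in> CX \<Longrightarrow> f \<in> borel_measurable BX"
  using measurable_continuous_XN by (simp add: CX_def)

lemma CX_power: "f \<in> CX \<Longrightarrow> (\<lambda>x. f x ^ j) \<in> CX"
proof -
  assume f: "f \<in> CX"
  obtain M where M: "M \<ge> 0" "\<And>x. x \<in> XN \<Longrightarrow> \<bar>f x\<bar> \<le> M" by (rule CX_bounded[OF f]) (rule that)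
  have "norm (f x ^ j) \<le> M ^ j" if "x \<in> XN" for x
    unfolding norm_power using M(2)[OF that] by (intro power_mono) auto
  then have "bounded ((\<lambda>x. f x ^ j) ` XN)" by (intro boundedI[of _ "M ^ j"]) auto
  then show ?thesis using f by (auto simp: CX_def intro: continuous_on_power)
qed

lemma birkhoff_bound:
  assumes "\<And>x. x \<in> XN \<Longrightarrow> \<bar>f x\<bar> \<le> M" "x \<in> XN" "n > 0"
  shows "\<bar>birkhoff n f x / real n\<bar> \<le> M"
proof -
  have "\<bar>birkhoff n f x\<bar> \<le> (\<Sum>k<n. \<bar>f ((shift_map ^^ k) x)\<bar>)" unfolding birkhoff_def by (rule sum_abs)
  also have "\<dots> \<le> (\<Sum>k<n. M)" by (intro sum_mono assms(1) shift_pow_XN assms(2))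
  finally show ?thesis using assms(3) by (simp add: field_simps)
qed

lemma sum_sum_swap: "(\<Sum>a\<in>A. \<Sum>b\<in>B. \<Sum>i\<in>I. h i a b) = (\<Sum>i\<in>I. \<Sum>a\<in>A. \<Sum>b\<in>B. h i a b)"
proof -
  have "(\<Sum>a\<in>A. \<Sum>b\<in>B. \<Sum>i\<in>I. h i a b) = (\<Sum>a\<in>A. \<Sum>i\<in>I. \<Sum>b\<in>B. h i a b)"
    by (rule sum.cong[OF refl]) (rule sum.swap)
  also have "\<dots> = (\<Sum>i\<in>I. \<Sum>a\<in>A. \<Sum>b\<in>B. h i a b)" by (rule sum.swap)
  finally show ?thesis .
qed

lemma polynomial_of_sum:
  fixes a :: "nat \<Rightarrow> real"
  shows "(\<Sum>i\<le>m. a i * (s + t) ^ i) =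
    (\<Sum>z\<in>(SIGMA i:{..m}. {..i}). a (fst z) * real (fst z choose snd z) * (s ^ snd z * t ^ (fst z - snd z)))"
proof -
  have "(\<Sum>i\<le>m. a i * (s + t) ^ i) = (\<Sum>i\<le>m. \<Sum>j\<le>i. a i * real (i choose j) * (s ^ j * t ^ (i - j)))"
    unfolding binomial_ring sum_distrib_left by (simp add: mult.assoc)
  also have "\<dots> = (\<Sum>z\<in>(SIGMA i:{..m}. {..i}). a (fst z) * real (fst z choose snd z) * (s ^ snd z * t ^ (fst z - snd z)))"
    by (subst sum.Sigma) (auto simp: case_prod_beta)
  finally show ?thesis .
qed

context unique_equilibrium
begin

interpretation \<mu>: prob_space \<mu> using \<mu>_MX by (simp add: MX_def)

interpretation pair: pair_prob_space \<mu> \<mu> ..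

lemma CX_measurable_\<mu>: "f \<in> CX \<Longrightarrow> f \<in> borel_measurable \<mu>"
  using CX_measurable measurable_cong_sets[OF sets_MX[OF \<mu>_MX] refl] by blast

lemma CX_integrable: "f \<in> CX \<Longrightarrow> integrable \<mu> f"
proof -
  assume f: "f \<in> CX"
  obtain M where M: "M \<ge> 0" "\<And>x. x \<in> XN \<Longrightarrow> \<bar>f x\<bar> \<le> M" by (rule CX_bounded[OF f]) (rule that)
  show ?thesis
    by (rule \<mu>.integrable_const_bound[where B = M]) (use M CX_measurable_\<mu>[OF f] in \<open>auto simp: space_MX[OF \<mu>_MX]\<close>)
qed

lemma conv_prob_average:
  assumes Q: "conv_prob Q q" and B: "\<And>n x. n > 0 \<Longrightarrow> x \<in> EN n \<Longrightarrow> \<bar>Q n x\<bar> \<le> B"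
  shows "(\<lambda>n. 1 / ZN n \<phi> * (\<Sum>\<^sub>\<infinity>x\<in>EN n. exp (birkhoff n \<phi> x) * Q n x)) \<longlonglongrightarrow> q"
proof -
  have lim: "(\<lambda>n. measure_pmf.expectation (per_pmf n) (Q n)) \<longlonglongrightarrow> q"
  proof (rule tendstoI)
    fix \<epsilon> :: real assume \<epsilon>: "\<epsilon> > 0"
    define c where "c = \<bar>B\<bar> + \<bar>q\<bar> + 1"
    have c: "c > 0" unfolding c_def by linarith
    let ?A = "\<lambda>n. {x. \<epsilon> / 2 \<le> \<bar>Q n x - q\<bar>}"
    have "(\<lambda>n. measure_pmf.prob (per_pmf n) (?A n)) \<longlonglongrightarrow> 0"
      using Q \<epsilon> unfolding conv_prob_def by (meson half_gt_zero)
    moreover have "0 < \<epsilon> / 2 / c" using \<epsilon> c by simp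
    ultimately have "\<forall>\<^sub>F n in sequentially. measure_pmf.prob (per_pmf n) (?A n) < \<epsilon> / 2 / c" by (rule order_tendstoD(2))
    then show "\<forall>\<^sub>F n in sequentially. dist (measure_pmf.expectation (per_pmf n) (Q n)) q < \<epsilon>"
      using eventually_gt_at_top[of 0]
    proof eventually_elim
      case (elim n)
      let ?p = "measure_pmf (per_pmf n)"
      have ae: "AE x in ?p. \<bar>Q n x\<bar> \<le> B"
        by (simp add: AE_measure_pmf_iff set_per_pmf[OF elim(2)] B[OF elim(2)])
      have i: "integrable ?p (Q n)" using ae by (intro measure_pmf.integrable_const_bound[where B = B]) auto
      have iA: "integrable ?p (\<lambda>x. \<epsilon> / 2 + c * indicat_real (?A n) x)"
        by (intro Bochner_Integration.integrable_add integrable_mult_right integrable_real_indicator) (auto simp: measure_pmf.emeasure_eq_measure)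
      have "(\<integral>x. Q n x \<partial>?p) - q = (\<integral>x. Q n x - q \<partial>?p)" using i by simp
      also have "\<bar>\<dots>\<bar> \<le> (\<integral>x. \<bar>Q n x - q\<bar> \<partial>?p)" by (rule integral_abs_bound)
      also have "\<dots> \<le> (\<integral>x. \<epsilon> / 2 + c * indicat_real (?A n) x \<partial>?p)"
      proof (rule integral_mono_AE[OF _ iA])
        show "integrable ?p (\<lambda>x. \<bar>Q n x - q\<bar>)" by (intro integrable_abs Bochner_Integration.integrable_diff i) simp
        show "AE x in ?p. \<bar>Q n x - q\<bar> \<le> \<epsilon> / 2 + c * indicat_real (?A n) x"
          using ae
        proof eventually_elim
          case (elim x)
          show ?case
          proof (cases "x \<in> ?A n")
            case True
            have "\<bar>Q n x - q\<bar> \<le> c" using elim unfolding c_def by linarith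
            then show ?thesis using True \<epsilon> by simp
          qed simp
        qed
      qed
      also have "\<dots> = \<epsilon> / 2 + c * measure_pmf.prob (per_pmf n) (?A n)"
        by (subst Bochner_Integration.integral_add) (auto simp: measure_pmf.emeasure_eq_measure)
      also have "\<dots> < \<epsilon> / 2 + \<epsilon> / 2" using elim(1) c by (simp add: field_simps)
      finally show ?case by (simp add: dist_real_def)
    qed
  qed
  show ?thesis
  proof (rule Lim_transform_eventually[OF lim])
    show "\<forall>\<^sub>F n in sequentially. measure_pmf.expectation (per_pmf n) (Q n) = 1 / ZN n \<phi> * (\<Sum>\<^sub>\<infinity>x\<in>EN n. exp (birkhoff n \<phi> x) * Q n x)"
      using eventually_gt_at_top[of 0] by eventually_elim (simp only: per_average[OF _ B])
  qed
qed

lemma conv_prob_cong: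
  assumes Q: "conv_prob Q q" and eq: "\<And>n x. n > 0 \<Longrightarrow> x \<in> EN n \<Longrightarrow> Q n x = R n x"
  shows "conv_prob R q"
  unfolding conv_prob_def
proof (intro allI impI)
  fix \<epsilon> :: real assume \<epsilon>: "\<epsilon> > 0"
  show "(\<lambda>n. measure_pmf.prob (per_pmf n) {x. \<epsilon> \<le> \<bar>R n x - q\<bar>}) \<longlonglongrightarrow> 0"
    by (rule prob_per_tendsto_0[of "{()}" "\<lambda>_ n. {x. \<epsilon> \<le> \<bar>Q n x - q\<bar>}"])
       (use Q \<epsilon> eq in \<open>auto simp: conv_prob_def\<close>)
qed

lemma conv_prob_continuous:
  fixes g :: "real \<times> real \<Rightarrow> real"
  assumes Q: "conv_prob Q q" and R: "conv_prob R r" and g: "isCont g (q, r)"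
  shows "conv_prob (\<lambda>n x. g (Q n x, R n x)) (g (q, r))"
  unfolding conv_prob_def
proof (intro allI impI)
  fix \<epsilon> :: real assume \<epsilon>: "\<epsilon> > 0"
  obtain d where d: "d > 0" "\<And>z. dist z (q, r) < d \<Longrightarrow> dist (g z) (g (q, r)) < \<epsilon>"
    using g \<epsilon> unfolding continuous_at_eps_delta by blast
  define d' where "d' = d / 2"
  have d2: "d' > 0" using d(1) by (simp add: d'_def)
  show "(\<lambda>n. measure_pmf.prob (per_pmf n) {x. \<epsilon> \<le> \<bar>g (Q n x, R n x) - g (q, r)\<bar>}) \<longlonglongrightarrow> 0"
  proof (rule prob_per_tendsto_0[of "{True, False}" "\<lambda>b n. if b then {x. d' \<le> \<bar>Q n x - q\<bar>} else {x. d' \<le> \<bar>R n x - r\<bar>}"])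
    show "(\<lambda>n. measure_pmf.prob (per_pmf n) (if b then {x. d' \<le> \<bar>Q n x - q\<bar>} else {x. d' \<le> \<bar>R n x - r\<bar>})) \<longlonglongrightarrow> 0" for b
      using Q R d2 by (cases b) (auto simp: conv_prob_def)
    fix n x assume "x \<in> {x. \<epsilon> \<le> \<bar>g (Q n x, R n x) - g (q, r)\<bar>}"
    then have "\<not> dist (Q n x, R n x) (q, r) < d" using d(2)[of "(Q n x, R n x)"] by (auto simp: dist_real_def)
    moreover have "dist (Q n x, R n x) (q, r) \<le> \<bar>Q n x - q\<bar> + \<bar>R n x - r\<bar>"
      unfolding dist_Pair_Pair dist_real_def using sqrt_sum_squares_le_sum_abs by auto
    ultimately have "d' \<le> \<bar>Q n x - q\<bar> \<or> d' \<le> \<bar>R n x - r\<bar>" unfolding d'_def by linarith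
    then show "\<exists>b\<in>{True, False}. x \<in> (if b then {x. d' \<le> \<bar>Q n x - q\<bar>} else {x. d' \<le> \<bar>R n x - r\<bar>})"
      by auto
  qed simp
qed

lemma conv_prob_mult: "conv_prob Q q \<Longrightarrow> conv_prob R r \<Longrightarrow> conv_prob (\<lambda>n x. Q n x * R n x) (q * r)"
  using conv_prob_continuous[of Q q R r "\<lambda>z. fst z * snd z"] by (simp add: continuous_intros)

lemma conv_prob_add: "conv_prob Q q \<Longrightarrow> conv_prob R r \<Longrightarrow> conv_prob (\<lambda>n x. Q n x + R n x) (q + r)"
  using conv_prob_continuous[of Q q R r "\<lambda>z. fst z + snd z"] by (simp add: continuous_intros)

lemma conv_prob_const: "conv_prob (\<lambda>n x. c) c"
  by (simp add: conv_prob_def not_le[symmetric])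

lemma conv_prob_sum: "finite I \<Longrightarrow> (\<And>i. i \<in> I \<Longrightarrow> conv_prob (Q i) (q i)) \<Longrightarrow> conv_prob (\<lambda>n x. \<Sum>i\<in>I. Q i n x) (\<Sum>i\<in>I. q i)"
  by (induction I rule: finite_induct) (simp_all add: conv_prob_const conv_prob_add)

theorem average_product:
  assumes \<xi>: "\<xi> \<in> CX" and \<psi>: "\<psi> \<in> CX"
  shows "(\<lambda>n. 1 / ZN n \<phi> * (\<Sum>\<^sub>\<infinity>x\<in>EN n. exp (birkhoff n \<phi> x) * (1 / (real n)\<^sup>2 * birkhoff n \<xi> x * birkhoff n \<psi> x)))
       \<longlonglongrightarrow> (\<integral>x. \<xi> x \<partial>\<mu>) * (\<integral>x. \<psi> x \<partial>\<mu>)"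
proof -
  obtain M where M: "M \<ge> 0" "\<And>x. x \<in> XN \<Longrightarrow> \<bar>\<xi> x\<bar> \<le> M" by (rule CX_bounded[OF \<xi>]) (rule that)
  obtain M' where M': "M' \<ge> 0" "\<And>x. x \<in> XN \<Longrightarrow> \<bar>\<psi> x\<bar> \<le> M'" by (rule CX_bounded[OF \<psi>]) (rule that)
  have eq: "birkhoff n \<xi> x / real n * (birkhoff n \<psi> x / real n) = 1 / (real n)\<^sup>2 * birkhoff n \<xi> x * birkhoff n \<psi> x" for n x
    by (simp add: power2_eq_square)
  show ?thesis
  proof (rule conv_prob_average)
    show "conv_prob (\<lambda>n x. 1 / (real n)\<^sup>2 * birkhoff n \<xi> x * birkhoff n \<psi> x) ((\<integral>x. \<xi> x \<partial>\<mu>) * (\<integral>x. \<psi> x \<partial>\<mu>))"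
      using conv_prob_mult[OF conv_prob_birkhoff[OF \<xi>] conv_prob_birkhoff[OF \<psi>]] by (simp only: eq)
    show "\<bar>1 / (real n)\<^sup>2 * birkhoff n \<xi> x * birkhoff n \<psi> x\<bar> \<le> M * M'" if "n > 0" "x \<in> EN n" for n x
      unfolding eq[symmetric] abs_mult[of "birkhoff n \<xi> x / real n"]
      by (intro mult_mono birkhoff_bound M M' EN_XN[OF that(2)] that(1)) (use M in auto)
  qed
qed

theorem average_quotient:
  assumes \<xi>: "\<xi> \<in> CX" and \<psi>: "\<psi> \<in> CX" and pos: "(INF x\<in>XN. \<psi> x) > 0"
  shows "(\<lambda>n. 1 / ZN n \<phi> * (\<Sum>\<^sub>\<infinity>x\<in>EN n. exp (birkhoff n \<phi> x) * (birkhoff n \<xi> x / birkhoff n \<psi> x)))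
       \<longlonglongrightarrow> (\<integral>x. \<xi> x \<partial>\<mu>) / (\<integral>x. \<psi> x \<partial>\<mu>)"
proof -
  define c where "c = (INF x\<in>XN. \<psi> x)"
  have c: "c > 0" using pos by (simp add: c_def)
  obtain M where M: "M \<ge> 0" "\<And>x. x \<in> XN \<Longrightarrow> \<bar>\<xi> x\<bar> \<le> M" by (rule CX_bounded[OF \<xi>]) (rule that)
  have "bdd_below (\<psi> ` XN)" using \<psi> by (auto simp: CX_def bounded_imp_bdd_below)
  then have \<psi>c: "c \<le> \<psi> x" if "x \<in> XN" for x unfolding c_def using that by (intro cINF_lower)
  have "(\<integral>x. c \<partial>\<mu>) \<le> (\<integral>x. \<psi> x \<partial>\<mu>)"
    by (intro integral_mono CX_integrable[OF \<psi>]) (auto simp: space_MX[OF \<mu>_MX] \<psi>c)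
  then have I: "(\<integral>x. \<psi> x \<partial>\<mu>) > 0" using c by (simp add: \<mu>.prob_space)
  have Sc: "real n * c \<le> birkhoff n \<psi> x" if "x \<in> XN" for n x
  proof -
    have "(\<Sum>k<n. c) \<le> birkhoff n \<psi> x" unfolding birkhoff_def by (intro sum_mono \<psi>c shift_pow_XN that)
    then show ?thesis by simp
  qed
  have cont: "isCont (\<lambda>z. fst z / snd z) ((\<integral>x. \<xi> x \<partial>\<mu>), (\<integral>x. \<psi> x \<partial>\<mu>))"
    using I by (intro continuous_intros) auto
  show ?thesis
  proof (rule conv_prob_average)
    show "conv_prob (\<lambda>n x. birkhoff n \<xi> x / birkhoff n \<psi> x) ((\<integral>x. \<xi> x \<partial>\<mu>) / (\<integral>x. \<psi> x \<partial>\<mu>))"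
    proof (rule conv_prob_cong)
      show "conv_prob (\<lambda>n x. birkhoff n \<xi> x / real n / (birkhoff n \<psi> x / real n)) ((\<integral>x. \<xi> x \<partial>\<mu>) / (\<integral>x. \<psi> x \<partial>\<mu>))"
        using conv_prob_continuous[OF conv_prob_birkhoff[OF \<xi>] conv_prob_birkhoff[OF \<psi>] cont] by (simp only: fst_conv snd_conv)
    qed simp
    show "\<bar>birkhoff n \<xi> x / birkhoff n \<psi> x\<bar> \<le> M / c" if n: "n > 0" and x: "x \<in> EN n" for n x
    proof -
      have "\<bar>birkhoff n \<xi> x\<bar> \<le> M * real n"
        using birkhoff_bound[OF M(2) EN_XN[OF x] n] n by (simp add: field_simps)
      then have "\<bar>birkhoff n \<xi> x\<bar> / birkhoff n \<psi> x \<le> (M * real n) / (real n * c)"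
        using Sc[OF EN_XN[OF x], of n] n c M(1) by (intro frac_le) auto
      moreover have "birkhoff n \<psi> x > 0" using Sc[OF EN_XN[OF x], of n] n c by (smt (verit) mult_pos_pos of_nat_0_less_iff)
      ultimately show ?thesis using n by simp
    qed
  qed
qed

text \<open>The limit in (c), written without convolution (\<open>convolution_joint\<close>).\<close>

definition joint :: "((nat \<Rightarrow> nat) \<Rightarrow> real) \<Rightarrow> ((nat \<Rightarrow> nat) \<Rightarrow> real) \<Rightarrow> (real \<Rightarrow> real) \<Rightarrow> real" where
  "joint \<pi>1 \<pi>2 f = (\<integral>z. f (\<pi>1 (fst z) + \<pi>2 (snd z)) \<partial>(\<mu> \<Otimes>\<^sub>M \<mu>))"

lemma integral_product:
  assumes a: "a \<in> CX" and b: "b \<in> CX"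
  shows "integrable (\<mu> \<Otimes>\<^sub>M \<mu>) (\<lambda>z. a (fst z) * b (snd z))"
    and "(\<integral>z. a (fst z) * b (snd z) \<partial>(\<mu> \<Otimes>\<^sub>M \<mu>)) = (\<integral>x. a x \<partial>\<mu>) * (\<integral>x. b x \<partial>\<mu>)"
proof -
  obtain M where M: "M \<ge> 0" "\<And>x. x \<in> XN \<Longrightarrow> \<bar>a x\<bar> \<le> M" by (rule CX_bounded[OF a]) (rule that)
  obtain M' where M': "M' \<ge> 0" "\<And>x. x \<in> XN \<Longrightarrow> \<bar>b x\<bar> \<le> M'" by (rule CX_bounded[OF b]) (rule that)
  note [measurable] = CX_measurable_\<mu>[OF a] CX_measurable_\<mu>[OF b]
  show i: "integrable (\<mu> \<Otimes>\<^sub>M \<mu>) (\<lambda>z. a (fst z) * b (snd z))"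
  proof (rule pair.integrable_const_bound[where B = "M * M'"])
    show "AE z in \<mu> \<Otimes>\<^sub>M \<mu>. norm (a (fst z) * b (snd z)) \<le> M * M'"
      by (rule AE_I2) (auto simp: space_pair_measure space_MX[OF \<mu>_MX] abs_mult intro!: mult_mono M M')
  qed measurable
  show "(\<integral>z. a (fst z) * b (snd z) \<partial>(\<mu> \<Otimes>\<^sub>M \<mu>)) = (\<integral>x. a x \<partial>\<mu>) * (\<integral>x. b x \<partial>\<mu>)"
    using pair.integral_fst'[OF i] by simp
qed

lemma convolution_joint:
  assumes \<pi>1: "\<pi>1 \<in> CX" and \<pi>2: "\<pi>2 \<in> CX" and f: "continuous_on UNIV (f :: real \<Rightarrow> real)"
  shows "(LINT t|(distr \<mu> borel \<pi>1 \<star> distr \<mu> borel \<pi>2). f t) = joint \<pi>1 \<pi>2 f"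
proof -
  note m1 = CX_measurable_\<mu>[OF \<pi>1] and m2 = CX_measurable_\<mu>[OF \<pi>2]
  have fm: "f \<in> borel_measurable borel" by (rule borel_measurable_continuous_onI[OF f])
  have p: "distr \<mu> borel \<pi>1 \<Otimes>\<^sub>M distr \<mu> borel \<pi>2 = distr (\<mu> \<Otimes>\<^sub>M \<mu>) (borel \<Otimes>\<^sub>M borel) (\<lambda>(x, y). (\<pi>1 x, \<pi>2 y))"
    using m1 m2 \<mu>.prob_space_distr[OF m2]
    by (intro pair_measure_distr) (auto intro: prob_space_imp_sigma_finite)
  have m: "(\<lambda>(x, y). (\<pi>1 x, \<pi>2 y)) \<in> \<mu> \<Otimes>\<^sub>M \<mu> \<rightarrow>\<^sub>M borel \<Otimes>\<^sub>M borel" using m1 m2 by measurable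
  have s: "(\<lambda>(x, y). x + y :: real) \<in> borel \<Otimes>\<^sub>M borel \<rightarrow>\<^sub>M borel" by measurable
  have "(LINT t|(distr \<mu> borel \<pi>1 \<star> distr \<mu> borel \<pi>2). f t) =
      (\<integral>z. f (case z of (x, y) \<Rightarrow> x + y) \<partial>distr (\<mu> \<Otimes>\<^sub>M \<mu>) (borel \<Otimes>\<^sub>M borel) (\<lambda>(x, y). (\<pi>1 x, \<pi>2 y)))"
    unfolding convolution_def p using s fm by (subst integral_distr) auto
  also have "\<dots> = joint \<pi>1 \<pi>2 f"
    unfolding joint_def using measurable_compose[OF s fm]
    by (subst integral_distr[OF m]) (auto simp: case_prod_beta)
  finally show ?thesis .
qed

definition double_average :: "((nat \<Rightarrow> nat) \<Rightarrow> real) \<Rightarrow> ((nat \<Rightarrow> nat) \<Rightarrow> real) \<Rightarrow> (real \<Rightarrow> real) \<Rightarrow> nat \<Rightarrow> (nat \<Rightarrow> nat) \<Rightarrow> real" where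
  "double_average \<pi>1 \<pi>2 f n x = 1 / (real n)\<^sup>2 * (\<Sum>k1<n. \<Sum>k2<n. f (\<pi>1 ((shift_map ^^ k1) x) + \<pi>2 ((shift_map ^^ k2) x)))"

lemma conv_prob_double_average_polynomial:
  fixes a :: "nat \<Rightarrow> real" and m :: nat
  assumes \<pi>1: "\<pi>1 \<in> CX" and \<pi>2: "\<pi>2 \<in> CX"
  defines "p \<equiv> \<lambda>t. \<Sum>i\<le>m. a i * t ^ i"
  shows "conv_prob (double_average \<pi>1 \<pi>2 p) (joint \<pi>1 \<pi>2 p)"
    and "integrable (\<mu> \<Otimes>\<^sub>M \<mu>) (\<lambda>z. p (\<pi>1 (fst z) + \<pi>2 (snd z)))"
proof -
  let ?I = "SIGMA i:{..m}. {..i}"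
  let ?c = "\<lambda>z. a (fst z) * real (fst z choose snd z)"
  let ?f = "\<lambda>z x. \<pi>1 x ^ snd z" and ?g = "\<lambda>z x. \<pi>2 x ^ (fst z - snd z)"
  have f: "?f z \<in> CX" and g: "?g z \<in> CX" for z :: "nat \<times> nat" by (intro CX_power \<pi>1 \<pi>2)+
  have pe: "p (s + t) = (\<Sum>z\<in>?I. ?c z * (s ^ snd z * t ^ (fst z - snd z)))" for s t
    unfolding p_def by (rule polynomial_of_sum)
  have i: "integrable (\<mu> \<Otimes>\<^sub>M \<mu>) (\<lambda>v. ?c z * (?f z (fst v) * ?g z (snd v)))" for z
    by (intro integrable_mult_right integral_product f g)
  show "integrable (\<mu> \<Otimes>\<^sub>M \<mu>) (\<lambda>z. p (\<pi>1 (fst z) + \<pi>2 (snd z)))"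
    unfolding pe by (intro Bochner_Integration.integrable_sum i)
  have J: "joint \<pi>1 \<pi>2 p = (\<Sum>z\<in>?I. ?c z * ((\<integral>x. ?f z x \<partial>\<mu>) * (\<integral>x. ?g z x \<partial>\<mu>)))"
    unfolding joint_def pe
    by (subst Bochner_Integration.integral_sum[OF i]) (simp only: integral_mult_right_zero integral_product(2)[OF f g])
  have D: "double_average \<pi>1 \<pi>2 p n x = (\<Sum>z\<in>?I. ?c z * (birkhoff n (?f z) x / real n * (birkhoff n (?g z) x / real n)))" for n x
  proof -
    have "(\<Sum>k1<n. \<Sum>k2<n. p (\<pi>1 ((shift_map ^^ k1) x) + \<pi>2 ((shift_map ^^ k2) x))) =
        (\<Sum>z\<in>?I. \<Sum>k1<n. \<Sum>k2<n. ?c z * (?f z ((shift_map ^^ k1) x) * ?g z ((shift_map ^^ k2) x)))"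
      unfolding pe by (rule sum_sum_swap)
    also have "\<dots> = (\<Sum>z\<in>?I. ?c z * (birkhoff n (?f z) x * birkhoff n (?g z) x))"
      unfolding birkhoff_def sum_product by (simp only: sum_distrib_left)
    finally show ?thesis
      unfolding double_average_def by (simp add: sum_distrib_left power2_eq_square mult_ac)
  qed
  have "conv_prob (\<lambda>n x. \<Sum>z\<in>?I. ?c z * (birkhoff n (?f z) x / real n * (birkhoff n (?g z) x / real n))) (joint \<pi>1 \<pi>2 p)"
    unfolding J by (intro conv_prob_sum conv_prob_mult conv_prob_const conv_prob_birkhoff f g) auto
  then show "conv_prob (double_average \<pi>1 \<pi>2 p) (joint \<pi>1 \<pi>2 p)"
    by (rule conv_prob_cong) (simp only: D)
qed

text \<open>On the compact range of \<open>\<pi>1 + \<pi>2\<close>, \<open>f\<close> is uniformly close to a polynomial, and both sides change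
  by at most the uniform distance.\<close>

lemma conv_prob_double_average:
  assumes \<pi>1: "\<pi>1 \<in> CX" and \<pi>2: "\<pi>2 \<in> CX" and f: "continuous_on UNIV (f :: real \<Rightarrow> real)" "bounded (range f)"
  shows "conv_prob (double_average \<pi>1 \<pi>2 f) (joint \<pi>1 \<pi>2 f)"
  unfolding conv_prob_def
proof (intro allI impI)
  fix \<epsilon> :: real assume \<epsilon>: "\<epsilon> > 0"
  obtain M where M: "M \<ge> 0" "\<And>x. x \<in> XN \<Longrightarrow> \<bar>\<pi>1 x\<bar> \<le> M" by (rule CX_bounded[OF \<pi>1]) (rule that)
  obtain M' where M': "M' \<ge> 0" "\<And>x. x \<in> XN \<Longrightarrow> \<bar>\<pi>2 x\<bar> \<le> M'" by (rule CX_bounded[OF \<pi>2]) (rule that)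
  let ?K = "{-(M + M')..M + M'}"
  have inK: "\<pi>1 x + \<pi>2 y \<in> ?K" if "x \<in> XN" "y \<in> XN" for x y
    using M(2)[OF that(1)] M'(2)[OF that(2)] by (simp add: abs_le_iff)
  define \<eta> where "\<eta> = \<epsilon> / 3"
  have \<eta>: "\<eta> > 0" using \<epsilon> by (simp add: \<eta>_def)
  obtain p where p: "real_polynomial_function p" "\<And>t. t \<in> ?K \<Longrightarrow> \<bar>f t - p t\<bar> < \<eta>"
    using Stone_Weierstrass_real_polynomial_function[OF compact_Icc continuous_on_subset[OF f(1) subset_UNIV] \<eta>] by metis
  obtain a m where pa: "p = (\<lambda>t. \<Sum>i\<le>m. a i * t ^ i)"
    using p(1) by (auto simp: real_polynomial_function_iff_sum)
  have cp: "conv_prob (double_average \<pi>1 \<pi>2 p) (joint \<pi>1 \<pi>2 p)"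
      "integrable (\<mu> \<Otimes>\<^sub>M \<mu>) (\<lambda>z. p (\<pi>1 (fst z) + \<pi>2 (snd z)))"
    unfolding pa by (rule conv_prob_double_average_polynomial[OF \<pi>1 \<pi>2])+
  have fm: "f \<in> borel_measurable borel" by (rule borel_measurable_continuous_onI[OF f(1)])
  obtain B where B: "\<And>t. \<bar>f t\<bar> \<le> B" using f(2) unfolding bounded_iff by auto
  note [measurable] = CX_measurable_\<mu>[OF \<pi>1] CX_measurable_\<mu>[OF \<pi>2] fm
  have fi: "integrable (\<mu> \<Otimes>\<^sub>M \<mu>) (\<lambda>z. f (\<pi>1 (fst z) + \<pi>2 (snd z)))"
    by (rule pair.integrable_const_bound[where B = B]) (use B in auto)
  have J: "\<bar>joint \<pi>1 \<pi>2 f - joint \<pi>1 \<pi>2 p\<bar> \<le> \<eta>"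
  proof -
    have "joint \<pi>1 \<pi>2 f - joint \<pi>1 \<pi>2 p = (\<integral>z. f (\<pi>1 (fst z) + \<pi>2 (snd z)) - p (\<pi>1 (fst z) + \<pi>2 (snd z)) \<partial>(\<mu> \<Otimes>\<^sub>M \<mu>))"
      unfolding joint_def by (rule Bochner_Integration.integral_diff[OF fi cp(2), symmetric])
    also have "\<bar>\<dots>\<bar> \<le> (\<integral>z. \<bar>f (\<pi>1 (fst z) + \<pi>2 (snd z)) - p (\<pi>1 (fst z) + \<pi>2 (snd z))\<bar> \<partial>(\<mu> \<Otimes>\<^sub>M \<mu>))"
      by (rule integral_abs_bound)
    also have "\<dots> \<le> (\<integral>z. \<eta> \<partial>(\<mu> \<Otimes>\<^sub>M \<mu>))"
    proof (rule integral_mono)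
      show "integrable (\<mu> \<Otimes>\<^sub>M \<mu>) (\<lambda>z. \<bar>f (\<pi>1 (fst z) + \<pi>2 (snd z)) - p (\<pi>1 (fst z) + \<pi>2 (snd z))\<bar>)"
        by (intro integrable_abs Bochner_Integration.integrable_diff fi cp(2))
      fix z assume "z \<in> space (\<mu> \<Otimes>\<^sub>M \<mu>)"
      then show "\<bar>f (\<pi>1 (fst z) + \<pi>2 (snd z)) - p (\<pi>1 (fst z) + \<pi>2 (snd z))\<bar> \<le> \<eta>"
        by (intro less_imp_le p(2) inK) (auto simp: space_pair_measure space_MX[OF \<mu>_MX])
    qed simp
    finally show ?thesis by (simp add: pair.prob_space)
  qed
  have Q: "\<bar>double_average \<pi>1 \<pi>2 f n x - double_average \<pi>1 \<pi>2 p n x\<bar> \<le> \<eta>" if n: "n > 0" and x: "x \<in> EN n" for n x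
  proof -
    let ?t = "\<lambda>k1 k2. \<pi>1 ((shift_map ^^ k1) x) + \<pi>2 ((shift_map ^^ k2) x)"
    have le: "\<bar>f (?t k1 k2) - p (?t k1 k2)\<bar> \<le> \<eta>" for k1 k2
      by (intro less_imp_le p(2) inK shift_pow_XN EN_XN[OF x])
    have "\<bar>\<Sum>k1<n. \<Sum>k2<n. f (?t k1 k2) - p (?t k1 k2)\<bar> \<le> (\<Sum>k1<n. \<Sum>k2<n. \<bar>f (?t k1 k2) - p (?t k1 k2)\<bar>)"
      by (intro order_trans[OF sum_abs] sum_mono sum_abs)
    also have "\<dots> \<le> (\<Sum>k1<n. \<Sum>k2<n. \<eta>)" by (intro sum_mono le)
    also have "\<dots> = (real n)\<^sup>2 * \<eta>" by (simp add: power2_eq_square)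
    finally have S: "\<bar>\<Sum>k1<n. \<Sum>k2<n. f (?t k1 k2) - p (?t k1 k2)\<bar> \<le> (real n)\<^sup>2 * \<eta>" .
    have eq: "double_average \<pi>1 \<pi>2 f n x - double_average \<pi>1 \<pi>2 p n x = (\<Sum>k1<n. \<Sum>k2<n. f (?t k1 k2) - p (?t k1 k2)) / (real n)\<^sup>2"
      unfolding double_average_def sum_subtractf by (simp add: diff_divide_distrib)
    show ?thesis unfolding eq using S n by (simp add: pos_divide_le_eq mult.commute)
  qed
  show "(\<lambda>n. measure_pmf.prob (per_pmf n) {x. \<epsilon> \<le> \<bar>double_average \<pi>1 \<pi>2 f n x - joint \<pi>1 \<pi>2 f\<bar>}) \<longlonglongrightarrow> 0"
  proof (rule prob_per_tendsto_0[of "{()}" "\<lambda>_ n. {x. \<eta> \<le> \<bar>double_average \<pi>1 \<pi>2 p n x - joint \<pi>1 \<pi>2 p\<bar>}"])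
    show "(\<lambda>n. measure_pmf.prob (per_pmf n) {x. \<eta> \<le> \<bar>double_average \<pi>1 \<pi>2 p n x - joint \<pi>1 \<pi>2 p\<bar>}) \<longlonglongrightarrow> 0" for j :: unit
      using cp(1) \<eta> by (simp add: conv_prob_def)
    fix n x assume n: "n > 0" and x: "x \<in> EN n" and "x \<in> {x. \<epsilon> \<le> \<bar>double_average \<pi>1 \<pi>2 f n x - joint \<pi>1 \<pi>2 f\<bar>}"
    then have "\<eta> \<le> \<bar>double_average \<pi>1 \<pi>2 p n x - joint \<pi>1 \<pi>2 p\<bar>"
      using Q[OF n x] J unfolding \<eta>_def mem_Collect_eq by linarith
    then show "\<exists>j\<in>{()}. x \<in> {x. \<eta> \<le> \<bar>double_average \<pi>1 \<pi>2 p n x - joint \<pi>1 \<pi>2 p\<bar>}" by simp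
  qed simp
qed

theorem average_convolution:
  assumes \<pi>1: "\<pi>1 \<in> CX" and \<pi>2: "\<pi>2 \<in> CX" and f: "continuous_on UNIV (f :: real \<Rightarrow> real)" "bounded (range f)"
  shows "(\<lambda>n. 1 / ZN n \<phi> * (\<Sum>\<^sub>\<infinity>x\<in>EN n. exp (birkhoff n \<phi> x) *
              (1 / (real n)\<^sup>2 * (\<Sum>k1<n. \<Sum>k2<n.
                 f (\<pi>1 ((shift_map ^^ k1) x) + \<pi>2 ((shift_map ^^ k2) x))))))
       \<longlonglongrightarrow> (LINT t|(distr \<mu> borel \<pi>1 \<star> distr \<mu> borel \<pi>2). f t)"
  unfolding convolution_joint[OF \<pi>1 \<pi>2 f(1)] double_average_def[symmetric]
proof -
  obtain B where B: "\<And>t. \<bar>f t\<bar> \<le> B" using f(2) unfolding bounded_iff by auto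
  show "(\<lambda>n. 1 / ZN n \<phi> * (\<Sum>\<^sub>\<infinity>x\<in>EN n. exp (birkhoff n \<phi> x) * double_average \<pi>1 \<pi>2 f n x)) \<longlonglongrightarrow> joint \<pi>1 \<pi>2 f"
  proof (rule conv_prob_average[OF conv_prob_double_average[OF assms]])
    fix n :: nat and x assume n: "n > 0"
    let ?t = "\<lambda>k1 k2. \<pi>1 ((shift_map ^^ k1) x) + \<pi>2 ((shift_map ^^ k2) x)"
    have "\<bar>\<Sum>k1<n. \<Sum>k2<n. f (?t k1 k2)\<bar> \<le> (\<Sum>k1<n. \<Sum>k2<n. \<bar>f (?t k1 k2)\<bar>)"
      by (intro order_trans[OF sum_abs] sum_mono sum_abs)
    also have "\<dots> \<le> (\<Sum>k1<n. \<Sum>k2<n. B)" by (intro sum_mono B)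
    also have "\<dots> = (real n)\<^sup>2 * B" by (simp add: power2_eq_square)
    finally show "\<bar>double_average \<pi>1 \<pi>2 f n x\<bar> \<le> B"
      unfolding double_average_def using n by (simp add: field_simps abs_mult)
  qed
qed

end

theorem mainTheorem3:
  fixes \<phi> :: "(nat \<Rightarrow> nat) \<Rightarrow> real" and \<mu>min :: "(nat \<Rightarrow> nat) measure"
  assumes acc: "acceptable {1..} \<phi>"
    and pressure_finite: "pressure {1..} \<phi> < \<infinity>"
    and induced: "\<exists>P::nat. P \<ge> 2 \<and>
      (\<forall>\<gamma>. locally_holder (induced_alphabet P) (induced_potential P \<phi> \<gamma> \<circ> coding P)) \<and>
      (\<exists>\<gamma>0. pressure (induced_alphabet P) (induced_potential P \<phi> \<gamma>0 \<circ> coding P) = 0)"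
    and unique_min: "{\<mu> \<in> MX. rate_function \<phi> \<mu> = 0} = {\<mu>min}"
  shows
    "(\<forall>\<xi>\<in>CX. \<forall>\<psi>\<in>CX.
       (\<lambda>n. 1 / ZN n \<phi> * (\<Sum>\<^sub>\<infinity>x\<in>EN n. exp (birkhoff n \<phi> x) *
              (1 / (real n)\<^sup>2 * birkhoff n \<xi> x * birkhoff n \<psi> x)))
       \<longlonglongrightarrow> (LINT x|\<mu>min. \<xi> x) * (LINT x|\<mu>min. \<psi> x)) \<and>
     (\<forall>\<xi>\<in>CX. \<forall>\<psi>\<in>CX. (INF x\<in>XN. \<psi> x) > 0 \<longrightarrow>
       (\<lambda>n. 1 / ZN n \<phi> * (\<Sum>\<^sub>\<infinity>x\<in>EN n. exp (birkhoff n \<phi> x) *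
              (birkhoff n \<xi> x / birkhoff n \<psi> x)))
       \<longlonglongrightarrow> (LINT x|\<mu>min. \<xi> x) / (LINT x|\<mu>min. \<psi> x)) \<and>
     (\<forall>\<pi>1\<in>CX. \<forall>\<pi>2\<in>CX. \<forall>f::real \<Rightarrow> real. continuous_on UNIV f \<longrightarrow> bounded (range f) \<longrightarrow>
       (\<lambda>n. 1 / ZN n \<phi> * (\<Sum>\<^sub>\<infinity>x\<in>EN n. exp (birkhoff n \<phi> x) *
              (1 / (real n)\<^sup>2 * (\<Sum>k1<n. \<Sum>k2<n.
                 f (\<pi>1 ((shift_map ^^ k1) x) + \<pi>2 ((shift_map ^^ k2) x))))))
       \<longlonglongrightarrow> (LINT t|(distr \<mu>min borel \<pi>1 \<star> distr \<mu>min borel \<pi>2). f t))"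
proof -
  interpret unique_equilibrium \<phi> \<mu>min
    by unfold_locales (use acceptable_tame[OF acc] pressure_finite unique_min in auto)
  show ?thesis
    using average_product average_quotient average_convolution by blast
qed

end
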